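(* Let $\Psi=(\Psi_1,\Psi_2)$ be a coverage-reweighted moment stationary bivariate random measure on $\mathbb{R}^d$ that is observed in a compact set $W\subseteq\mathbb{R}^d$ whose erosion $W_{\ominus t}=\{w\in W:B(w,t)\subseteq W\}$ has positive volume $\ell(W_{\ominus t})>0$, where $t\ge0$. Suppose that the moment expansion of $L(u_t^0)$ and the series defining $J_{12}(t)$ are absolutely convergent. Define $\Phi=(\Phi_1,\Phi_2)$ by $\Phi_i(A)=\int_A\frac1{p_1(x,i)}\,d\Psi_i(x)$ for Borel sets $A\subseteq\mathbb{R}^d$. Then $$\widehat{L_2(t)}=\frac1{\ell(W_{\ominus t})}\int_{W_{\ominus t}}e^{-\Phi_2(B(x,t))}\,dx$$ is an unbiased estimator for $L(u_t^0)$, $$\widehat{K_{12}(t)}=\frac1{\ell(W_{\ominus t})}\int_{W_{\ominus t}}\Phi_2(B(x,t))\,d\Phi_1(x)$$ is an unbiased estimator for $K_{12}(t)$, and $$\widehat{L_{12}(t)}=\frac1{\ell(W_{\ominus t})}\int_{W_{\ominus t}}e^{-\Phi_2(B(x,t))}\,d\Phi_1(x)$$ is unbiased for $L^{(0,1)}(u_t^0)$.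
   Context: $\ell$ is Lebesgue measure on $\mathbb{R}^d$; $B(a,t)$ is the closed ball of radius $t\ge0$ centred at $a$. The coverage function $p_1$ is assumed known. An estimator is unbiased for a quantity if its expectation equals that quantity. Random measures. A bivariate random measure $\Psi=(\Psi_1,\Psi_2)$ on $\mathbb{R}^d$ is a measurable map from a probability space into the locally finite Borel measures on $\mathbb{R}^d\times\{1,2\}$; $\Psi_i(B)$ is the mass of $B\times\{i\}$. Its $k$-th order moment measure is $\mu^{(k)}((B_1\times\{i_1\})\times\cdots\times(B_k\times\{i_k\}))=\mathbb{E}(\Psi_{i_1}(B_1)\cdots\Psi_{i_k}(B_k))$, assumed locally finite. If it equals $\int_{B_1}\cdots\int_{B_k}p_k((x_1,i_1),\dots,(x_k,i_k))\,dx_1\cdots dx_k$, then $p_k$ is the $k$-point coverage function. Cumulant densities. If all $p_k$ exist and $p_1>0$, define recursively $\xi_1\equiv1$ and, for $k\ge2$, $$\frac{p_k((x_1,i_1),\dots,(x_k,i_k))}{p_1(x_1,i_1)\cdots p_1(x_k,i_k)}=\sum_{m=1}^k\sum_{D_1,\dots,D_m}\prod_{j=1}^m\xi_{|D_j|}(\{(x_l,i_l):l\in D_j\}),$$ the inner sum being over all partitions of $\{1,\dots,k\}$ into $m$ non-empty sets. $\Psi$ is coverage-reweighted moment stationary if moment measures of all orders exist and are absolutely continuous, $\inf p_1(x,i)>0$, and every $\xi_k$ is translation invariant: $\xi_k((x_1+a,i_1),\dots,(x_k+a,i_k))=\xi_k((x_1,i_1),\dots,(x_k,i_k))$ for all $a$,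 all labels and almost all $x_j$. Expressions $\xi_{k+1}((0,i),(x_1,i_1),\dots)$ denote the a.e. determined function of $(x_1,\dots,x_k)$ equal to $\xi_{k+1}((a,i),(a+x_1,i_1),\dots)$ for almost all $(a,x_1,\dots,x_k)$. Cross statistics: $$K_{12}(t)=\int_{B(0,t)}(1+\xi_2((0,1),(x,2)))\,dx,$$ $$J_{12}(t)=1+\sum_{k\ge1}\frac{(-1)^k}{k!}\int_{B(0,t)}\cdots\int_{B(0,t)}\xi_{k+1}((0,1),(x_1,2),\dots,(x_k,2))\,dx_1\cdots dx_k.$$ Laplace functional: $L(u)=\mathbb{E}\exp[-\sum_i\int u(x,i)\,d\Psi_i(x)]$, with moment expansion $1+\sum_{k\ge1}\frac{(-1)^k}{k!}\int u(x_1,i_1)\cdots u(x_k,i_k)\,d\mu^{(k)}((x_1,i_1),\dots,(x_k,i_k))$. Put $u_t^a(x,i)=1\{(x,i)\in B(a,t)\times\{2\}\}/p_1(x,i)$. Palm distributions. $P^{(x,i)}$, with expectation $\mathbb{E}^{(x,i)}$, is determined, uniquely up to a $\mu^{(1)}$-null set, by $\mathbb{E}[\sum_i\int g((x,i),\Psi)\,d\Psi_i(x)]=\sum_i\int\mathbb{E}^{(x,i)}[g((x,i),\Psi)]\,d\mu^{(1)}(x,i)$ for all non-negative measurable $g$; $L^{(a,1)}$ is the Laplace functional of $\Psi$ under $P^{(a,1)}$. Under the stated convergence assumptions $L^{(a,1)}(u_t^a)$ takes the same value for almost all $a\in\mathbb{R}^d$, and $L^{(0,1)}(u_t^0)$ denotes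 this value. *)

theory Defs
  imports "HOL-Probability.Probability"
begin

text \<open>
  The Euclidean space is a type \<open>'a :: euclidean_space\<close>, and the labels 1, 2 are the two elements
  of the library type \<open>2\<close>.
\<close>

definition marked_space :: "('a::euclidean_space \<times> 2) measure" where
  "marked_space = borel \<Otimes>\<^sub>M count_space UNIV"

definition lf_measures :: "('a::euclidean_space \<times> 2) measure set" where
  "lf_measures = {\<psi>. sets \<psi> = sets marked_space \<and>
     (\<forall>B\<in>sets borel. bounded B \<longrightarrow> emeasure \<psi> (B \<times> UNIV) < \<infinity>)}"

definition lf_algebra :: "('a::euclidean_space \<times> 2) measure measure" where
  "lf_algebra =
     (SUP A \<in> sets marked_space. vimage_algebra lf_measures (\<lambda>\<psi>. emeasure \<psi> A) borel)"

definition component :: "('a::euclidean_space \<times> 2) measure \<Rightarrow> 2 \<Rightarrow> 'a measure" where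
  "component \<psi> i = distr (restrict_space \<psi> (UNIV \<times> {i})) borel fst"

definition bivariate_random_measure ::
    "'w measure \<Rightarrow> ('w \<Rightarrow> ('a::euclidean_space \<times> 2) measure) \<Rightarrow> bool" where
  "bivariate_random_measure M \<Psi> \<longleftrightarrow> prob_space M \<and> \<Psi> \<in> M \<rightarrow>\<^sub>M lf_algebra"

lemma space_marked_space [simp]: "space marked_space = UNIV"
  by (simp add: marked_space_def space_pair_measure)

lemma Times_in_marked_space [measurable]:
  "B \<in> sets borel \<Longrightarrow> B \<times> I \<in> sets marked_space"
  unfolding marked_space_def by (intro pair_measureI) auto

lemma lf_measuresD:
  assumes "\<psi> \<in> lf_measures"
  shows "sets \<psi> = sets marked_space" "space \<psi> = UNIV"
  using assms sets_eq_imp_space_eq[of \<psi> marked_space] by (auto simp: lf_measures_def)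

lemma space_lf_algebra [simp]: "space lf_algebra = lf_measures"
  by (auto simp: lf_algebra_def space_Sup_eq_UN)

lemma measurable_emeasure_lf_algebra [measurable]:
  "A \<in> sets marked_space \<Longrightarrow> (\<lambda>\<psi>. emeasure \<psi> A) \<in> borel_measurable lf_algebra"
  by (auto intro!: measurable_Sup1 measurable_vimage_algebra1 simp: lf_algebra_def)

lemma emeasure_component:
  assumes \<psi>: "\<psi> \<in> lf_measures" and B: "B \<in> sets borel"
  shows "emeasure (component \<psi> i) B = emeasure \<psi> (B \<times> {i})"
proof -
  note [simp] = lf_measuresD[OF \<psi>]
  have U: "UNIV \<times> {i} \<in> sets \<psi>" by (simp add: Times_in_marked_space)
  have "fst \<in> \<psi> \<rightarrow>\<^sub>M borel"
    by (subst measurable_cong_sets[OF lf_measuresD(1)[OF \<psi>] refl]) (simp add: marked_space_def)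
  then have f: "fst \<in> restrict_space \<psi> (UNIV \<times> {i}) \<rightarrow>\<^sub>M borel"
    by (rule measurable_restrict_space1)
  have "fst -` B \<inter> (UNIV \<times> {i}) = B \<times> {i}" by auto
  then have "emeasure (component \<psi> i) B = emeasure (restrict_space \<psi> (UNIV \<times> {i})) (B \<times> {i})"
    unfolding component_def by (subst emeasure_distr[OF f B]) (simp add: space_restrict_space)
  also have "\<dots> = emeasure \<psi> (B \<times> {i})"
    using U by (subst emeasure_restrict_space) auto
  finally show ?thesis .
qed

lemma sigma_finite_lf_measure:
  assumes \<psi>: "\<psi> \<in> lf_measures"
  shows "sigma_finite_measure \<psi>"
proof
  let ?A = "range (\<lambda>n::nat. cball (0::'a) (real n) \<times> (UNIV :: 2 set))"
  have "x \<in> \<Union>?A" for x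
    using real_arch_simple[of "norm (fst x)"] by (cases x) auto
  then have "\<Union>?A = space \<psi>" by (simp add: lf_measuresD[OF \<psi>] set_eq_iff)
  moreover have "?A \<subseteq> sets \<psi>"
    by (auto simp: lf_measuresD[OF \<psi>] Times_in_marked_space)
  moreover have "emeasure \<psi> a \<noteq> \<infinity>" if "a \<in> ?A" for a
    using \<psi> that by (auto simp: lf_measures_def less_top)
  moreover have "countable ?A" by simp
  ultimately show "\<exists>A. countable A \<and> A \<subseteq> sets \<psi> \<and> \<Union>A = space \<psi> \<and> (\<forall>a\<in>A. emeasure \<psi> a \<noteq> \<infinity>)"
    by (intro exI[of _ ?A] conjI ballI)
qed

text \<open>
  The \<open>k\<close>-th order moment measure lives on \<open>k\<close>-tuples, represented as extensional functions on
  \<open>{..<k}\<close>. It is the expectation of the \<open>k\<close>-fold product of the random measure; that this is a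
  measure, with the usual values on rectangles, is shown below.
\<close>

definition moment_measure ::
    "'w measure \<Rightarrow> ('w \<Rightarrow> ('a::euclidean_space \<times> 2) measure) \<Rightarrow> nat \<Rightarrow> (nat \<Rightarrow> 'a \<times> 2) measure" where
  "moment_measure M \<Psi> k =
     measure_of (space (\<Pi>\<^sub>M j\<in>{..<k}. marked_space)) (sets (\<Pi>\<^sub>M j\<in>{..<k}. marked_space))
       (\<lambda>A. \<integral>\<^sup>+\<omega>. emeasure (\<Pi>\<^sub>M j\<in>{..<k}. \<Psi> \<omega>) A \<partial>M)"

lemma sets_moment_measure [simp, measurable_cong]:
  "sets (moment_measure M \<Psi> k) = sets (\<Pi>\<^sub>M j\<in>{..<k}. marked_space)"
  by (simp add: moment_measure_def)

lemma emeasure_lf_product: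
  fixes k :: nat
  assumes \<psi>: "\<psi> \<in> lf_measures" and E: "\<And>j. j < k \<Longrightarrow> E j \<in> sets marked_space"
  shows "emeasure (\<Pi>\<^sub>M j\<in>{..<k}. \<psi>) (\<Pi>\<^sub>E j\<in>{..<k}. E j) = (\<Prod>j<k. emeasure \<psi> (E j))"
proof -
  interpret sigma_finite_measure \<psi> by (rule sigma_finite_lf_measure[OF \<psi>])
  interpret product_sigma_finite "\<lambda>_::nat. \<psi>" by unfold_locales
  show ?thesis using emeasure_PiM[of "{..<k}" E] by (simp add: lf_measuresD[OF \<psi>] E)
qed

lemma measurable_emeasure_lf_product:
  fixes k :: nat
  assumes A: "A \<in> sets (\<Pi>\<^sub>M j\<in>{..<k}. (marked_space :: ('a::euclidean_space \<times> 2) measure))"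
  shows "(\<lambda>\<psi>. emeasure (\<Pi>\<^sub>M j\<in>{..<k}. \<psi>) A) \<in> borel_measurable (lf_algebra :: ('a \<times> 2) measure measure)"
proof -
  let ?S = "\<Pi>\<^sub>M j\<in>{..<k}. (marked_space :: ('a \<times> 2) measure)"
  define C where "C = (\<lambda>n::nat. cball (0::'a) (real n) \<times> (UNIV :: 2 set))"
  define R where "R = (\<lambda>n. \<Pi>\<^sub>E j\<in>{..<k}. C n)"
  have C [measurable]: "C n \<in> sets marked_space" for n by (simp add: C_def Times_in_marked_space)
  have R [measurable]: "R n \<in> sets ?S" for n unfolding R_def by (intro sets_PiM_I_finite) auto
  have sets_eq: "sets (\<Pi>\<^sub>M j\<in>{..<k}. \<psi>) = sets ?S" if "\<psi> \<in> lf_measures" for \<psi> :: "('a \<times> 2) measure"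
    using lf_measuresD(1)[OF that] by (intro sets_PiM_cong) auto
  have fin: "emeasure (\<Pi>\<^sub>M j\<in>{..<k}. \<psi>) (R n) < \<infinity>" if \<psi>: "\<psi> \<in> lf_measures"
    for \<psi> :: "('a \<times> 2) measure" and n
  proof -
    have "emeasure \<psi> (C n) < \<infinity>" using \<psi> by (auto simp: lf_measures_def C_def)
    then show ?thesis
      unfolding R_def by (subst emeasure_lf_product[OF \<psi>]) (auto simp: power_less_top_ennreal)
  qed
  have loc: "(\<lambda>\<psi>. emeasure (\<Pi>\<^sub>M j\<in>{..<k}. \<psi>) (A \<inter> R n)) \<in> borel_measurable lf_algebra"
    if "A \<in> sets ?S" for A n
    using Int_stable_prod_algebra prod_algebra_sets_into_space that[unfolded sets_PiM]
  proof (induction rule: sigma_sets_induct_disjoint)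
    case (basic A)
    then obtain E where E: "A = (\<Pi>\<^sub>E j\<in>{..<k}. E j)" "E \<in> (\<Pi> j\<in>{..<k}. sets marked_space)"
      by (auto elim!: prod_algebraE_all)
    have [measurable]: "j < k \<Longrightarrow> E j \<inter> C n \<in> sets marked_space" for j using E(2) by auto
    have "A \<inter> R n = (\<Pi>\<^sub>E j\<in>{..<k}. E j \<inter> C n)" by (auto simp: E R_def PiE_iff)
    then have "emeasure (\<Pi>\<^sub>M j\<in>{..<k}. \<psi>) (A \<inter> R n) = (\<Prod>j<k. emeasure \<psi> (E j \<inter> C n))"
      if "\<psi> \<in> space lf_algebra" for \<psi> :: "('a \<times> 2) measure"
      using that by (simp add: emeasure_lf_product)
    then show ?case by (subst measurable_cong) (auto intro!: borel_measurable_prod)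
  next
    case empty
    show ?case by simp
  next
    case (compl A)
    then have A: "A \<in> sets ?S" by (simp add: sets_PiM)
    have "emeasure (\<Pi>\<^sub>M j\<in>{..<k}. \<psi>) ((space ?S - A) \<inter> R n) =
        emeasure (\<Pi>\<^sub>M j\<in>{..<k}. \<psi>) (R n) - emeasure (\<Pi>\<^sub>M j\<in>{..<k}. \<psi>) (A \<inter> R n)"
      if "\<psi> \<in> space lf_algebra" for \<psi> :: "('a \<times> 2) measure"
    proof -
      have \<psi>: "\<psi> \<in> lf_measures" using that by simp
      have "(space ?S - A) \<inter> R n = R n - A \<inter> R n" using sets.sets_into_space[OF R[of n]] by auto
      moreover have "emeasure (\<Pi>\<^sub>M j\<in>{..<k}. \<psi>) (A \<inter> R n) \<noteq> \<infinity>"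
        using fin[OF \<psi>, of n] emeasure_mono[of "A \<inter> R n" "R n" "\<Pi>\<^sub>M j\<in>{..<k}. \<psi>"] sets_eq[OF \<psi>] R[of n]
        by (auto simp: top_unique)
      ultimately show ?thesis
        using A R[of n] sets_eq[OF \<psi>] by (simp add: emeasure_Diff)
    qed
    note eq = this
    have "(\<lambda>\<psi>. emeasure (\<Pi>\<^sub>M j\<in>{..<k}. \<psi>) (R n)) \<in> borel_measurable (lf_algebra :: ('a \<times> 2) measure measure)"
      by (subst measurable_cong[where g = "\<lambda>\<psi>. \<Prod>j<k. emeasure \<psi> (C n)"])
         (auto simp: R_def emeasure_lf_product simp del: prod_constant intro!: borel_measurable_prod)
    then have "(\<lambda>\<psi>. emeasure (\<Pi>\<^sub>M j\<in>{..<k}. \<psi>) (R n) - emeasure (\<Pi>\<^sub>M j\<in>{..<k}. \<psi>) (A \<inter> R n))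
        \<in> borel_measurable lf_algebra"
      using compl.IH by (rule borel_measurable_minus_ennreal)
    with eq have "(\<lambda>\<psi>. emeasure (\<Pi>\<^sub>M j\<in>{..<k}. \<psi>) ((space ?S - A) \<inter> R n)) \<in> borel_measurable lf_algebra"
      by (rule measurable_cong[THEN iffD2])
    then show ?case by (simp add: space_PiM)
  next
    case (union F)
    then have F: "F i \<in> sets ?S" for i by (auto simp: sets_PiM)
    have "emeasure (\<Pi>\<^sub>M j\<in>{..<k}. \<psi>) ((\<Union>i. F i) \<inter> R n) = (\<Sum>i. emeasure (\<Pi>\<^sub>M j\<in>{..<k}. \<psi>) (F i \<inter> R n))"
      if "\<psi> \<in> space lf_algebra" for \<psi> :: "('a \<times> 2) measure"
    proof -
      have \<psi>: "\<psi> \<in> lf_measures" using that by simp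
      have "disjoint_family (\<lambda>i. F i \<inter> R n)" using union(1) by (auto simp: disjoint_family_on_def)
      then have "(\<Sum>i. emeasure (\<Pi>\<^sub>M j\<in>{..<k}. \<psi>) (F i \<inter> R n)) = emeasure (\<Pi>\<^sub>M j\<in>{..<k}. \<psi>) (\<Union>i. F i \<inter> R n)"
        using F R[of n] sets_eq[OF \<psi>] by (intro suminf_emeasure) auto
      then show ?thesis by (simp add: Int_UN_distrib2)
    qed
    moreover have "(\<lambda>\<psi>. \<Sum>i. emeasure (\<Pi>\<^sub>M j\<in>{..<k}. \<psi>) (F i \<inter> R n)) \<in> borel_measurable lf_algebra"
      using union.IH by (rule borel_measurable_suminf_order)
    ultimately show ?case by (rule measurable_cong[THEN iffD2])
  qed
  have "emeasure (\<Pi>\<^sub>M j\<in>{..<k}. \<psi>) A = (SUP n. emeasure (\<Pi>\<^sub>M j\<in>{..<k}. \<psi>) (A \<inter> R n))"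
    if "\<psi> \<in> space lf_algebra" for \<psi> :: "('a \<times> 2) measure"
  proof -
    have \<psi>: "\<psi> \<in> lf_measures" using that by simp
    have "C n \<subseteq> C (Suc n)" for n by (auto simp: C_def)
    then have "R n \<subseteq> R (Suc n)" for n unfolding R_def by (intro PiE_mono)
    then have inc: "incseq (\<lambda>n. A \<inter> R n)" by (intro incseq_SucI Int_mono) auto
    have "\<exists>n. x \<in> R n" if "x \<in> A" for x
    proof -
      have x: "x \<in> extensional {..<k}"
        using sets.sets_into_space[OF A] that by (auto simp: space_PiM PiE_def)
      obtain n :: nat where n: "(\<Sum>j<k. norm (fst (x j))) \<le> real n" using real_arch_simple by blast
      have "norm (fst (x j)) \<le> real n" if "j < k" for j
        using that n member_le_sum[of j "{..<k}" "\<lambda>j. norm (fst (x j))"] by auto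
      then show ?thesis using x by (intro exI[of _ n]) (auto simp: R_def C_def PiE_iff mem_Times_iff)
    qed
    then have "(\<Union>n. A \<inter> R n) = A" by auto
    moreover have "range (\<lambda>n. A \<inter> R n) \<subseteq> sets (\<Pi>\<^sub>M j\<in>{..<k}. \<psi>)"
      using A R unfolding sets_eq[OF \<psi>] by blast
    ultimately show ?thesis using SUP_emeasure_incseq[OF _ inc] by simp
  qed
  moreover have "(\<lambda>\<psi>. SUP n. emeasure (\<Pi>\<^sub>M j\<in>{..<k}. \<psi>) (A \<inter> R n)) \<in> borel_measurable lf_algebra"
    using loc[OF A] by (intro borel_measurable_SUP) auto
  ultimately show ?thesis by (rule measurable_cong[THEN iffD2])
qed

lemma emeasure_moment_measure:
  assumes "bivariate_random_measure M \<Psi>" and "A \<in> sets (\<Pi>\<^sub>M j\<in>{..<k}. marked_space)"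
  shows "emeasure (moment_measure M \<Psi> k) A = (\<integral>\<^sup>+\<omega>. emeasure (\<Pi>\<^sub>M j\<in>{..<k}. \<Psi> \<omega>) A \<partial>M)"
proof (rule emeasure_measure_of[OF moment_measure_def[of M \<Psi> k]])
  let ?S = "\<Pi>\<^sub>M j\<in>{..<k}. (marked_space :: ('b \<times> 2) measure)"
  have \<Psi>: "\<Psi> \<in> M \<rightarrow>\<^sub>M lf_algebra" using assms by (simp add: bivariate_random_measure_def)
  then have lf: "\<omega> \<in> space M \<Longrightarrow> \<Psi> \<omega> \<in> lf_measures" for \<omega>
    using measurable_space[OF \<Psi>] by simp
  show "countably_additive (sets (moment_measure M \<Psi> k)) (\<lambda>A. \<integral>\<^sup>+\<omega>. emeasure (\<Pi>\<^sub>M j\<in>{..<k}. \<Psi> \<omega>) A \<partial>M)"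
  proof (rule countably_additiveI)
    fix F :: "nat \<Rightarrow> (nat \<Rightarrow> 'b \<times> 2) set"
    assume F: "range F \<subseteq> sets (moment_measure M \<Psi> k)" "disjoint_family F"
    have m: "(\<lambda>\<omega>. emeasure (\<Pi>\<^sub>M j\<in>{..<k}. \<Psi> \<omega>) (F i)) \<in> borel_measurable M" for i
      using F(1) by (intro measurable_compose[OF \<Psi> measurable_emeasure_lf_product]) auto
    have s: "(\<Sum>i. emeasure (\<Pi>\<^sub>M j\<in>{..<k}. \<Psi> \<omega>) (F i)) = emeasure (\<Pi>\<^sub>M j\<in>{..<k}. \<Psi> \<omega>) (\<Union>i. F i)"
      if "\<omega> \<in> space M" for \<omega>
    proof (rule suminf_emeasure[OF _ F(2)])
      have "sets (\<Pi>\<^sub>M j\<in>{..<k}. \<Psi> \<omega>) = sets ?S"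
        using lf_measuresD(1)[OF lf[OF that]] by (intro sets_PiM_cong) auto
      then show "range F \<subseteq> sets (\<Pi>\<^sub>M j\<in>{..<k}. \<Psi> \<omega>)" using F(1) by simp
    qed
    show "(\<Sum>i. \<integral>\<^sup>+\<omega>. emeasure (\<Pi>\<^sub>M j\<in>{..<k}. \<Psi> \<omega>) (F i) \<partial>M) =
        (\<integral>\<^sup>+\<omega>. emeasure (\<Pi>\<^sub>M j\<in>{..<k}. \<Psi> \<omega>) (\<Union>i. F i) \<partial>M)"
      using m by (subst nn_integral_suminf[symmetric]) (auto intro!: nn_integral_cong simp: s)
  qed
  show "A \<in> sets (moment_measure M \<Psi> k)" using assms(2) by simp
  show "sets ?S \<subseteq> Pow (space ?S)" by (rule sets.space_closed)
  show "positive (sets (moment_measure M \<Psi> k)) (\<lambda>A. \<integral>\<^sup>+\<omega>. emeasure (\<Pi>\<^sub>M j\<in>{..<k}. \<Psi> \<omega>) A \<partial>M)"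
    by (simp add: positive_def)
qed

lemma emeasure_moment_measure_rectangle:
  assumes \<Psi>: "bivariate_random_measure M \<Psi>" and B: "\<And>j. j < k \<Longrightarrow> B j \<in> sets borel"
  shows "emeasure (moment_measure M \<Psi> k) (\<Pi>\<^sub>E j\<in>{..<k}. B j \<times> {i j}) =
    (\<integral>\<^sup>+\<omega>. (\<Prod>j<k. emeasure (component (\<Psi> \<omega>) (i j)) (B j)) \<partial>M)"
proof -
  have lf: "\<omega> \<in> space M \<Longrightarrow> \<Psi> \<omega> \<in> lf_measures" for \<omega>
    using \<Psi> measurable_space[of \<Psi> M lf_algebra] by (simp add: bivariate_random_measure_def)
  have "(\<Pi>\<^sub>E j\<in>{..<k}. B j \<times> {i j}) \<in> sets (\<Pi>\<^sub>M j\<in>{..<k}. marked_space)"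
    by (rule sets_PiM_I_finite) (simp_all add: B Times_in_marked_space)
  then have "emeasure (moment_measure M \<Psi> k) (\<Pi>\<^sub>E j\<in>{..<k}. B j \<times> {i j}) =
      (\<integral>\<^sup>+\<omega>. emeasure (\<Pi>\<^sub>M j\<in>{..<k}. \<Psi> \<omega>) (\<Pi>\<^sub>E j\<in>{..<k}. B j \<times> {i j}) \<partial>M)"
    by (rule emeasure_moment_measure[OF \<Psi>])
  also have "\<dots> = (\<integral>\<^sup>+\<omega>. (\<Prod>j<k. emeasure (component (\<Psi> \<omega>) (i j)) (B j)) \<partial>M)"
    by (rule nn_integral_cong)
       (simp add: emeasure_lf_product[OF lf] emeasure_component[OF lf] B Times_in_marked_space)
  finally show ?thesis .
qed

definition locally_finite_moments ::
    "'w measure \<Rightarrow> ('w \<Rightarrow> ('a::euclidean_space \<times> 2) measure) \<Rightarrow> nat \<Rightarrow> bool" where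
  "locally_finite_moments M \<Psi> k \<longleftrightarrow>
     (\<forall>B\<in>sets borel. bounded B \<longrightarrow>
        emeasure (moment_measure M \<Psi> k) (\<Pi>\<^sub>E j\<in>{..<k}. B \<times> UNIV) < \<infinity>)"

text \<open>
  Functions of a varying number of labelled points, such as the coverage functions \<open>p\<^sub>k\<close>, are
  functions on lists; \<open>p\<^sub>k\<close> is the restriction of \<open>p\<close> to lists of length \<open>k\<close>.
\<close>

definition tuple :: "nat \<Rightarrow> (nat \<Rightarrow> 'a) \<Rightarrow> (nat \<Rightarrow> 2) \<Rightarrow> ('a \<times> 2) list" where
  "tuple k x i = map (\<lambda>j. (x j, i j)) [0..<k]"

definition coverage_function ::
    "'w measure \<Rightarrow> ('w \<Rightarrow> ('a::euclidean_space \<times> 2) measure) \<Rightarrow> nat \<Rightarrow> (('a \<times> 2) list \<Rightarrow> real) \<Rightarrow> bool" where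
  "coverage_function M \<Psi> k p \<longleftrightarrow>
     (\<forall>zs. length zs = k \<longrightarrow> 0 \<le> p zs) \<and>
     (\<forall>i. (\<lambda>x. p (tuple k x i)) \<in> borel_measurable (\<Pi>\<^sub>M j\<in>{..<k}. lborel)) \<and>
     (\<forall>B i. (\<forall>j<k. B j \<in> sets borel) \<longrightarrow>
        emeasure (moment_measure M \<Psi> k) (\<Pi>\<^sub>E j\<in>{..<k}. B j \<times> {i j}) =
        (\<integral>\<^sup>+x\<in>(\<Pi>\<^sub>E j\<in>{..<k}. B j). ennreal (p (tuple k x i)) \<partial>(\<Pi>\<^sub>M j\<in>{..<k}. lborel)))"

text \<open>
  The defining relation is solved for its one-block term. For a set \<open>D\<close> of positions,
  \<open>nths zs D\<close> is the subtuple of \<open>zs\<close> at these positions, taken in increasing order. (The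
  densities are symmetric almost everywhere, so that the order does not matter.)
\<close>

function cumulant :: "(('a \<times> 2) list \<Rightarrow> real) \<Rightarrow> ('a \<times> 2) list \<Rightarrow> real" where
  "cumulant p zs =
     (if length zs \<le> 1 then 1
      else p zs / (\<Prod>z\<leftarrow>zs. p [z]) -
        (\<Sum>P\<in>{P. partition_on {..<length zs} P} - {{{..<length zs}}}. \<Prod>D\<in>P. cumulant p (nths zs D)))"
  by pat_completeness auto
termination
proof (relation "Wellfounded.measure (\<lambda>(p, zs). length zs)", goal_cases)
  case 1
  show ?case by simp
next
  case (2 p zs P D)
  then have P: "partition_on {..<length zs} P" "P \<noteq> {{..<length zs}}" and D: "D \<in> P" by auto
  have "D \<subseteq> {..<length zs}" using P(1) D by (auto simp: partition_on_def)
  moreover have "D \<noteq> {..<length zs}"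
  proof
    assume eq: "D = {..<length zs}"
    have "D' = D" if "D' \<in> P" for D'
    proof (rule ccontr)
      assume "D' \<noteq> D"
      then have "D' \<inter> D = {}" using P(1) D that by (auto simp: partition_on_def disjoint_def)
      moreover have "D' \<subseteq> D" "D' \<noteq> {}" using P(1) that eq by (auto simp: partition_on_def)
      ultimately show False by blast
    qed
    then show False using P(2) D eq by blast
  qed
  ultimately have "D \<subset> {..<length zs}" by blast
  then have "card D < length zs" using psubset_card_mono[of "{..<length zs}" D] by simp
  moreover have "{j. j < length zs \<and> j \<in> D} = D" using \<open>D \<subseteq> {..<length zs}\<close> by auto
  ultimately show ?case by (simp add: length_nths)
qed

declare cumulant.simps [simp del]

lemma cumulant_relation:
  assumes pos: "\<And>z. 0 < p [z]" and "zs \<noteq> []"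
  shows "p zs / (\<Prod>z\<leftarrow>zs. p [z]) =
    (\<Sum>P | partition_on {..<length zs} P. \<Prod>D\<in>P. cumulant p (nths zs D))"
proof (cases "length zs = 1")
  case True
  then obtain z where z: "zs = [z]" by (auto simp: length_Suc_conv)
  have "{P. partition_on {..<length zs} P} = {{{0}}}"
  proof (intro set_eqI iffI)
    fix P assume "P \<in> {P. partition_on {..<length zs} P}"
    then have P: "\<Union>P = {0}" "{} \<notin> P" using True by (auto simp: partition_on_def lessThan_Suc)
    then have "D = {0}" if "D \<in> P" for D using that P by (metis Sup_upper subset_singletonD)
    moreover have "P \<noteq> {}" using P(1) by auto
    ultimately have "P = {{0}}" by auto
    then show "P \<in> {{{0}}}" by simp
  next
    fix P :: "nat set set" assume "P \<in> {{{0}}}"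
    then show "P \<in> {P. partition_on {..<length zs} P}"
      using True by (auto simp: partition_on_def disjoint_def)
  qed
  moreover have "nths zs {0} = zs" by (simp add: z)
  moreover have "cumulant p zs = 1" using True by (simp add: cumulant.simps[of p zs])
  moreover have "p zs / (\<Prod>z\<leftarrow>zs. p [z]) = 1" using pos[of z] by (simp add: z)
  ultimately show ?thesis by simp
next
  case False
  let ?n = "{..<length zs}"
  have fin: "finite {P. partition_on ?n P}" by (rule finitely_many_partition_on) simp
  have mem: "{?n} \<in> {P. partition_on ?n P}" using assms(2) by (auto simp: partition_on_def disjoint_def)
  have "nths zs ?n = zs" by (rule nths_all) auto
  then have "(\<Sum>P | partition_on ?n P. \<Prod>D\<in>P. cumulant p (nths zs D)) = cumulant p zs +
      (\<Sum>P\<in>{P. partition_on ?n P} - {{?n}}. \<Prod>D\<in>P. cumulant p (nths zs D))"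
    using sum.remove[OF fin mem, of "\<lambda>P. \<Prod>D\<in>P. cumulant p (nths zs D)"] by simp
  moreover have "\<not> length zs \<le> 1" using False assms(2) by (cases zs) auto
  then have "cumulant p zs = p zs / (\<Prod>z\<leftarrow>zs. p [z]) -
      (\<Sum>P\<in>{P. partition_on ?n P} - {{?n}}. \<Prod>D\<in>P. cumulant p (nths zs D))"
    by (subst cumulant.simps) (simp only: if_False)
  ultimately show ?thesis by simp
qed

definition crm_stationary ::
    "'w measure \<Rightarrow> ('w \<Rightarrow> ('a::euclidean_space \<times> 2) measure) \<Rightarrow> (('a \<times> 2) list \<Rightarrow> real) \<Rightarrow> bool" where
  "crm_stationary M \<Psi> p \<longleftrightarrow>
     (\<forall>k\<ge>1. locally_finite_moments M \<Psi> k \<and> coverage_function M \<Psi> k p) \<and>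
     0 < (INF z. p [z]) \<and>
     (\<forall>k\<ge>1. \<forall>a i. AE x in (\<Pi>\<^sub>M j\<in>{..<k}. lborel).
        cumulant p (tuple k (\<lambda>j. x j + a) i) = cumulant p (tuple k x i))"

text \<open>
  \<open>cumulant_at_origin p i [(x\<^sub>1, i\<^sub>1), \<dots>, (x\<^sub>k, i\<^sub>k)]\<close> stands for
  \<open>\<xi>\<^bsub>k+1\<^esub>((0, i), (x\<^sub>1, i\<^sub>1), \<dots>, (x\<^sub>k, i\<^sub>k))\<close>. It is a choice of version of a function that is
  determined almost everywhere; the value of \<^const>\<open>cumulant\<close> at a tuple containing \<open>(0, i)\<close> would
  not do, as it depends on the version of the densities.
\<close>

definition cumulant_at_origin ::
    "(('a::euclidean_space \<times> 2) list \<Rightarrow> real) \<Rightarrow> 2 \<Rightarrow> ('a \<times> 2) list \<Rightarrow> real" where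
  "cumulant_at_origin p i = (SOME \<eta>. \<forall>k\<ge>1. \<forall>l.
     (\<lambda>x. \<eta> (tuple k x l)) \<in> borel_measurable (\<Pi>\<^sub>M j\<in>{..<k}. lborel) \<and>
     (AE (a, x) in lborel \<Otimes>\<^sub>M (\<Pi>\<^sub>M j\<in>{..<k}. lborel).
        \<eta> (tuple k x l) = cumulant p ((a, i) # tuple k (\<lambda>j. a + x j) l)))"

definition K12 :: "(('a::euclidean_space \<times> 2) list \<Rightarrow> real) \<Rightarrow> real \<Rightarrow> real" where
  "K12 p t = (LINT x:cball 0 t|lborel. 1 + cumulant_at_origin p 1 [(x, 2)])"

definition J12_term :: "(('a::euclidean_space \<times> 2) list \<Rightarrow> real) \<Rightarrow> real \<Rightarrow> nat \<Rightarrow> real" where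
  "J12_term p t k = (-1) ^ k / fact k *
     (LINT x:(\<Pi>\<^sub>E j\<in>{..<k}. cball 0 t)|(\<Pi>\<^sub>M j\<in>{..<k}. lborel).
        cumulant_at_origin p 1 (tuple k x (\<lambda>_. 2)))"

definition J12 :: "(('a::euclidean_space \<times> 2) list \<Rightarrow> real) \<Rightarrow> real \<Rightarrow> real" where
  "J12 p t = 1 + (\<Sum>k. J12_term p t (Suc k))"

text \<open>
  The functional is used for bounded \<open>u\<close> that vanish outside a bounded set, for which all inner
  integrals are finite.
\<close>

definition laplace ::
    "'w measure \<Rightarrow> ('w \<Rightarrow> ('a::euclidean_space \<times> 2) measure) \<Rightarrow> ('a \<times> 2 \<Rightarrow> real) \<Rightarrow> real" where
  "laplace M \<Psi> u =
     (\<integral>\<omega>. exp (- (\<Sum>i\<in>UNIV. \<integral>x. u (x, i) \<partial>component (\<Psi> \<omega>) i)) \<partial>M)"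

definition laplace_moment_term ::
    "'w measure \<Rightarrow> ('w \<Rightarrow> ('a::euclidean_space \<times> 2) measure) \<Rightarrow> ('a \<times> 2 \<Rightarrow> real) \<Rightarrow> nat \<Rightarrow> real" where
  "laplace_moment_term M \<Psi> u k =
     (-1) ^ k / fact k * (\<integral>z. (\<Prod>j<k. u (z j)) \<partial>moment_measure M \<Psi> k)"

definition ball_weight ::
    "(('a::euclidean_space \<times> 2) list \<Rightarrow> real) \<Rightarrow> real \<Rightarrow> 'a \<Rightarrow> 'a \<times> 2 \<Rightarrow> real" where
  "ball_weight p t a z = indicator (cball a t \<times> {2}) z / p [z]"

text \<open>
  \<open>Q z\<close> is the Palm distribution at the labelled point \<open>z\<close>, a distribution on the space of locally
  finite measures. The first moment measure lives on 1-tuples, whence the \<open>z 0\<close>.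
\<close>

definition palm_distributions ::
    "'w measure \<Rightarrow> ('w \<Rightarrow> ('a::euclidean_space \<times> 2) measure) \<Rightarrow>
      ('a \<times> 2 \<Rightarrow> ('a \<times> 2) measure measure) \<Rightarrow> bool" where
  "palm_distributions M \<Psi> Q \<longleftrightarrow>
     Q \<in> marked_space \<rightarrow>\<^sub>M prob_algebra lf_algebra \<and>
     (\<forall>g :: ('a \<times> 2) \<times> ('a \<times> 2) measure \<Rightarrow> ennreal.
        g \<in> borel_measurable (marked_space \<Otimes>\<^sub>M lf_algebra) \<longrightarrow>
        (\<integral>\<^sup>+\<omega>. (\<Sum>i\<in>UNIV. \<integral>\<^sup>+x. g ((x, i), \<Psi> \<omega>) \<partial>component (\<Psi> \<omega>) i) \<partial>M) =
        (\<integral>\<^sup>+z. (\<integral>\<^sup>+\<psi>. g (z 0, \<psi>) \<partial>Q (z 0)) \<partial>moment_measure M \<Psi> 1))"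

text \<open>
  That \<open>L\<^bsup>(a,1)\<^esup>(u\<^sub>t\<^sup>a)\<close> is almost everywhere constant in \<open>a\<close> is a consequence of the convergence
  of the moment expansion and of the series \<open>J12\<close>; the value is not fixed otherwise.
\<close>

definition palm_laplace_at_origin ::
    "('a::euclidean_space \<times> 2 \<Rightarrow> ('a \<times> 2) measure measure) \<Rightarrow> (('a \<times> 2) list \<Rightarrow> real) \<Rightarrow> real \<Rightarrow> real" where
  "palm_laplace_at_origin Q p t =
     (THE v. AE a in lborel. laplace (Q (a, 1)) (\<lambda>\<psi>. \<psi>) (ball_weight p t a) = v)"

definition erosion :: "'a::euclidean_space set \<Rightarrow> real \<Rightarrow> 'a set" where
  "erosion W t = {w \<in> W. cball w t \<subseteq> W}"

definition weighted_component ::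
    "(('a::euclidean_space \<times> 2) list \<Rightarrow> real) \<Rightarrow> ('a \<times> 2) measure \<Rightarrow> 2 \<Rightarrow> 'a measure" where
  "weighted_component p \<psi> i = density (component \<psi> i) (\<lambda>x. ennreal (1 / p [(x, i)]))"

definition L2_hat ::
    "(('a::euclidean_space \<times> 2) list \<Rightarrow> real) \<Rightarrow> 'a set \<Rightarrow> real \<Rightarrow> ('a \<times> 2) measure \<Rightarrow> real" where
  "L2_hat p W t \<psi> = 1 / measure lborel (erosion W t) *
     (LINT x:erosion W t|lborel. exp (- measure (weighted_component p \<psi> 2) (cball x t)))"

definition K12_hat ::
    "(('a::euclidean_space \<times> 2) list \<Rightarrow> real) \<Rightarrow> 'a set \<Rightarrow> real \<Rightarrow> ('a \<times> 2) measure \<Rightarrow> real" where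
  "K12_hat p W t \<psi> = 1 / measure lborel (erosion W t) *
     (LINT x:erosion W t|weighted_component p \<psi> 1. measure (weighted_component p \<psi> 2) (cball x t))"

definition L12_hat ::
    "(('a::euclidean_space \<times> 2) list \<Rightarrow> real) \<Rightarrow> 'a set \<Rightarrow> real \<Rightarrow> ('a \<times> 2) measure \<Rightarrow> real" where
  "L12_hat p W t \<psi> = 1 / measure lborel (erosion W t) *
     (LINT x:erosion W t|weighted_component p \<psi> 1.
        exp (- measure (weighted_component p \<psi> 2) (cball x t)))"

definition unbiased_estimator :: "'w measure \<Rightarrow> ('w \<Rightarrow> real) \<Rightarrow> real \<Rightarrow> bool" where
  "unbiased_estimator M X \<theta> \<longleftrightarrow> integrable M X \<and> (\<integral>\<omega>. X \<omega> \<partial>M) = \<theta>"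

end

theory Submission
  imports Defs
begin

text \<open>
  Dividing by \<open>p\<^sub>1\<close> turns the moment measures of \<open>\<Psi>\<close> into the reduced densities
  \<open>p\<^sub>k / (p\<^sub>1 \<cdots> p\<^sub>1)\<close>. These are sums over partitions of products of cumulant densities, so coverage-reweighted
  moment stationarity makes them translation invariant almost everywhere
  (\<open>reduced_density_shift\<close>). Write \<open>Z\<^sub>a = \<Phi>\<^sub>2(B(a,t))\<close>. Then all moments of \<open>Z\<^sub>a\<close>, both under the law of
  \<open>\<Psi>\<close> and under the Palm distribution at \<open>(a, 1)\<close>, do not depend on \<open>a\<close> (up to a null set in the second case), and
  the expectation of each estimator is an average over the eroded window of a quantity that is constant.

  For \<open>L\<^sub>2\<close>: the number \<open>m\<^sub>k = E Z\<^sub>a\<^sup>k\<close> is the integral of the \<open>k\<close>-th reduced density over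
  \<open>B(0,t)\<^sup>k\<close> (\<open>expectation_mass_power\<close>). Absolute convergence of the moment expansion says that
  \<open>m\<^sub>k / k!\<close> is summable, and then \<open>E e\<^bsup>-Z\<^esup>\<close> is the alternating sum of these numbers
  (\<open>integral_exp_minus_of_moments\<close>), whatever \<open>a\<close> is. The rest is Fubini's theorem.

  For \<open>K\<^sub>1\<^sub>2\<close> and \<open>L\<^sub>1\<^sub>2\<close>: the expectation of the integral of \<open>Z\<^sub>x\<^sup>k\<close> over \<open>x \<in> A\<close> with respect to \<open>\<Phi>\<^sub>1\<close> equals
  \<open>c\<^sub>k \<ell>(A)\<close>, where \<open>c\<^sub>k\<close> is the integral over \<open>B(0,t)\<^sup>k\<close> of the \<open>(k+1)\<close>-st reduced density with
  first point \<open>(0, 1)\<close> (\<open>expectation_weighted_mass_power\<close>). The case \<open>k = 1\<close> is the claim about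
  \<open>K\<^sub>1\<^sub>2\<close>. By the defining property of Palm distributions \<open>c\<^sub>k\<close> is also the \<open>k\<close>-th moment of \<open>Z\<^sub>x\<close> under
  \<open>P\<^bsup>(x,1)\<^esup>\<close>, for almost all \<open>x\<close>. Sorting the partitions of the \<open>k + 1\<close> points by the block that
  contains the first point gives
  \<open>c\<^sub>k = (\<Sum>D. I\<^bsub>card D\<^esub> m\<^bsub>k - card D\<^esub>)\<close>, the sum over all sets \<open>D\<close> of positions of the other points, with
  \<open>I\<^sub>j\<close> the integral of \<open>\<xi>\<^bsub>j+1\<^esub>((0,1),\<dots>)\<close> that occurs in \<open>J\<^sub>1\<^sub>2\<close> (\<open>moment12_eq\<close>). Hence \<open>c\<^sub>k / k!\<close> is the Cauchy
  product of \<open>I\<^sub>k / k!\<close> and \<open>m\<^sub>k / k!\<close>, both absolutely summable by hypothesis. So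
  \<open>L\<^bsup>(x,1)\<^esup>(u\<^sub>t\<^sup>x)\<close> is, for almost all \<open>x\<close>, the alternating sum of the \<open>c\<^sub>k / k!\<close>, and the Palm identity applied to
  \<open>e\<^bsup>-Z\<^esup>\<close> finishes the proof.
\<close>

section \<open>Finite powers of a sigma-finite measure\<close>

text \<open>
  Tuples of length \<open>k\<close> are extensional functions on \<open>{..<k}\<close>; the restriction makes the longer tuple
  extensional, too.
\<close>

definition glue :: "nat \<Rightarrow> 'b \<Rightarrow> (nat \<Rightarrow> 'b) \<Rightarrow> nat \<Rightarrow> 'b" where
  "glue k a x = (\<lambda>j\<in>{..<Suc k}. case_nat a x j)"

lemma measurable_glue:
  assumes a: "a \<in> L \<rightarrow>\<^sub>M N" and x: "\<And>j. j < k \<Longrightarrow> (\<lambda>\<omega>. x \<omega> j) \<in> L \<rightarrow>\<^sub>M N"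
  shows "(\<lambda>\<omega>. glue k (a \<omega>) (x \<omega>)) \<in> L \<rightarrow>\<^sub>M (\<Pi>\<^sub>M j\<in>{..<Suc k}. N)"
  unfolding glue_def
proof (rule measurable_restrict)
  fix j assume "j \<in> {..<Suc k}"
  then show "(\<lambda>\<omega>. case_nat (a \<omega>) (x \<omega>) j) \<in> L \<rightarrow>\<^sub>M N" using a x by (cases j) simp_all
qed

lemma all_less_Suc_case: "(\<forall>j. j < Suc k \<longrightarrow> P j) \<longleftrightarrow> P 0 \<and> (\<forall>j<k. P (Suc j))"
  by (auto simp: less_Suc_eq_0_disj)

lemma nn_integral_PiM_Suc:
  fixes N :: "'b measure" and k :: nat
  assumes N: "sigma_finite_measure N"
    and f: "f \<in> borel_measurable (\<Pi>\<^sub>M j\<in>{..<Suc k}. N)"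
  shows "(\<integral>\<^sup>+x. f x \<partial>(\<Pi>\<^sub>M j\<in>{..<Suc k}. N)) =
    (\<integral>\<^sup>+a. \<integral>\<^sup>+x. f (glue k a x) \<partial>(\<Pi>\<^sub>M j\<in>{..<k}. N) \<partial>N)"
proof -
  let ?P = "\<lambda>k. \<Pi>\<^sub>M j\<in>{..<k::nat}. N"
  let ?T = "\<lambda>(a, x). glue k a x"
  interpret N: sigma_finite_measure N by fact
  interpret product_sigma_finite "\<lambda>_::nat. N" by unfold_locales
  interpret Pk: sigma_finite_measure "?P k" by (rule sigma_finite) simp
  interpret pair_sigma_finite N "?P k"
    by (intro pair_sigma_finite.intro N sigma_finite) simp
  have T [measurable]: "?T \<in> N \<Otimes>\<^sub>M ?P k \<rightarrow>\<^sub>M ?P (Suc k)"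
    unfolding case_prod_beta' by (rule measurable_glue) simp_all
  have "distr (N \<Otimes>\<^sub>M ?P k) (?P (Suc k)) ?T = ?P (Suc k)"
  proof (rule PiM_eqI)
    fix A assume "\<And>i. i \<in> {..<Suc k} \<Longrightarrow> A i \<in> sets N"
    then have A: "i < Suc k \<Longrightarrow> A i \<in> sets N" for i by simp
    have "?T -` (\<Pi>\<^sub>E j\<in>{..<Suc k}. A j) \<inter> space (N \<Otimes>\<^sub>M ?P k) = A 0 \<times> (\<Pi>\<^sub>E j\<in>{..<k}. A (Suc j))"
      (is "?L = ?R")
    proof (rule set_eqI)
      fix z :: "'b \<times> (nat \<Rightarrow> 'b)"
      obtain a y where z: "z = (a, y)" by (cases z)
      have sub: "j < Suc k \<Longrightarrow> x \<in> A j \<Longrightarrow> x \<in> space N" for j x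
        using A[THEN sets.sets_into_space] by blast
      show "z \<in> ?L \<longleftrightarrow> z \<in> ?R"
        using sub[of 0] sub[of "Suc _"]
        by (auto simp: z glue_def PiE_iff space_pair_measure space_PiM Ball_def all_less_Suc_case)
    qed
    moreover have "(\<Pi>\<^sub>E j\<in>{..<Suc k}. A j) \<in> sets (?P (Suc k))"
      "(\<Pi>\<^sub>E j\<in>{..<k}. A (Suc j)) \<in> sets (?P k)"
      by (rule sets_PiM_I_finite; use A in auto)+
    moreover have "emeasure (?P k) (\<Pi>\<^sub>E j\<in>{..<k}. A (Suc j)) = (\<Prod>j<k. emeasure N (A (Suc j)))"
      by (rule emeasure_PiM) (use A in auto)
    moreover have "emeasure (N \<Otimes>\<^sub>M ?P k) (A 0 \<times> (\<Pi>\<^sub>E j\<in>{..<k}. A (Suc j))) =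
        emeasure N (A 0) * emeasure (?P k) (\<Pi>\<^sub>E j\<in>{..<k}. A (Suc j))"
      by (rule Pk.emeasure_pair_measure_Times) (use A calculation in auto)
    ultimately show "emeasure (distr (N \<Otimes>\<^sub>M ?P k) (?P (Suc k)) ?T) (Pi\<^sub>E {..<Suc k} A) =
        (\<Prod>i<Suc k. emeasure N (A i))"
      using A[of 0] by (subst emeasure_distr[OF T])
        (simp_all add: prod.lessThan_Suc_shift del: prod.lessThan_Suc)
  qed simp_all
  then have "(\<integral>\<^sup>+x. f x \<partial>?P (Suc k)) = (\<integral>\<^sup>+x. f (?T x) \<partial>(N \<Otimes>\<^sub>M ?P k))"
    using nn_integral_distr[OF T, of f] f by simp
  also have "\<dots> = (\<integral>\<^sup>+a. \<integral>\<^sup>+x. f (?T (a, x)) \<partial>?P k \<partial>N)"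
    by (rule Pk.nn_integral_fst[symmetric]) (rule measurable_compose[OF T f])
  finally show ?thesis by simp
qed

lemma distr_PiM_bij_betw:
  fixes N :: "'b measure" and I :: "'i set" and J :: "'j set"
  assumes N: "sigma_finite_measure N" and fin: "finite J" and f: "bij_betw f I J"
  shows "distr (\<Pi>\<^sub>M j\<in>J. N) (\<Pi>\<^sub>M i\<in>I. N) (\<lambda>x. \<lambda>i\<in>I. x (f i)) = (\<Pi>\<^sub>M i\<in>I. N)"
proof -
  interpret N: sigma_finite_measure N by fact
  interpret I: product_sigma_finite "\<lambda>_::'i. N" by unfold_locales
  interpret J: product_sigma_finite "\<lambda>_::'j. N" by unfold_locales
  have fI: "i \<in> I \<Longrightarrow> f i \<in> J" for i using f by (auto simp: bij_betw_def)
  have T: "(\<lambda>x. \<lambda>i\<in>I. x (f i)) \<in> (\<Pi>\<^sub>M j\<in>J. N) \<rightarrow>\<^sub>M (\<Pi>\<^sub>M i\<in>I. N)"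
    by (intro measurable_restrict measurable_component_singleton fI)
  show ?thesis
  proof (rule I.PiM_eqI)
    show finI: "finite I" using fin f bij_betw_finite by blast
    fix A assume A: "\<And>i. i \<in> I \<Longrightarrow> A i \<in> sets N"
    define g where "g = the_inv_into I f"
    have g: "i \<in> I \<Longrightarrow> g (f i) = i" for i
      unfolding g_def using f by (intro the_inv_into_f_f) (auto simp: bij_betw_def)
    have gJ: "j \<in> J \<Longrightarrow> g j \<in> I \<and> f (g j) = j" for j
      unfolding g_def using f
      by (metis bij_betw_def f_the_inv_into_f_bij_betw the_inv_into_onto image_eqI)
    have *: "(\<lambda>x. \<lambda>i\<in>I. x (f i)) -` (\<Pi>\<^sub>E i\<in>I. A i) \<inter> space (\<Pi>\<^sub>M j\<in>J. N) = (\<Pi>\<^sub>E j\<in>J. A (g j))"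
    proof (intro set_eqI iffI)
      fix x assume x: "x \<in> (\<lambda>x. \<lambda>i\<in>I. x (f i)) -` (\<Pi>\<^sub>E i\<in>I. A i) \<inter> space (\<Pi>\<^sub>M j\<in>J. N)"
      then have "\<And>i. i \<in> I \<Longrightarrow> x (f i) \<in> A i" by (auto simp: PiE_iff)
      then show "x \<in> (\<Pi>\<^sub>E j\<in>J. A (g j))" using x gJ by (auto simp: PiE_iff space_PiM) (metis)
    next
      fix x assume x: "x \<in> (\<Pi>\<^sub>E j\<in>J. A (g j))"
      then have "x (f i) \<in> A i" if "i \<in> I" for i using that g[OF that] fI[OF that] by (auto simp: PiE_iff)
      moreover have "x j \<in> space N" if "j \<in> J" for j
        using x that gJ[OF that] sets.sets_into_space[OF A, of "g j"] by (auto simp: PiE_iff)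
      ultimately show "x \<in> (\<lambda>x. \<lambda>i\<in>I. x (f i)) -` (\<Pi>\<^sub>E i\<in>I. A i) \<inter> space (\<Pi>\<^sub>M j\<in>J. N)"
        using x by (auto simp: PiE_iff space_PiM)
    qed
    have "emeasure (distr (\<Pi>\<^sub>M j\<in>J. N) (\<Pi>\<^sub>M i\<in>I. N) (\<lambda>x. \<lambda>i\<in>I. x (f i))) (\<Pi>\<^sub>E i\<in>I. A i) =
        emeasure (\<Pi>\<^sub>M j\<in>J. N) (\<Pi>\<^sub>E j\<in>J. A (g j))"
      by (subst emeasure_distr[OF T]) (auto simp: * intro!: sets_PiM_I_finite finI A)
    also have "\<dots> = (\<Prod>j\<in>J. emeasure N (A (g j)))"
      using gJ by (intro J.emeasure_PiM fin A) blast
    also have "\<dots> = (\<Prod>i\<in>I. emeasure N (A i))"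
      using prod.reindex_bij_betw[OF f, of "\<lambda>j. emeasure N (A (g j))"] by (simp add: g)
    finally show "emeasure (distr (\<Pi>\<^sub>M j\<in>J. N) (\<Pi>\<^sub>M i\<in>I. N) (\<lambda>x. \<lambda>i\<in>I. x (f i))) (\<Pi>\<^sub>E i\<in>I. A i) =
        (\<Prod>i\<in>I. emeasure N (A i))" .
  qed simp
qed

text \<open>
  The subtuple at the positions in \<open>js\<close>, renumbered from zero, so that it is again a point of a power
  indexed by an initial segment.
\<close>

definition pick :: "nat list \<Rightarrow> (nat \<Rightarrow> 'b) \<Rightarrow> nat \<Rightarrow> 'b" where
  "pick js x = (\<lambda>j\<in>{..<length js}. x (js ! j))"

lemma measurable_pick:
  assumes "set js \<subseteq> I"
  shows "pick js \<in> (\<Pi>\<^sub>M j\<in>I. N) \<rightarrow>\<^sub>M (\<Pi>\<^sub>M j\<in>{..<length js}. N)"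
  unfolding pick_def using assms
  by (intro measurable_restrict measurable_component_singleton) auto

lemma pick_in_PiE_iff: "pick js x \<in> (\<Pi>\<^sub>E j\<in>{..<length js}. A) \<longleftrightarrow> (\<forall>i\<in>set js. x i \<in> A)"
  by (simp add: pick_def PiE_iff Ball_def in_set_conv_nth) blast

text \<open>
  Disjoint sets of coordinates are independent: the two subtuples are distributed as the product of
  the corresponding powers. The lemma serves to show that a null set of subtuples pulls back to a null
  set of tuples, and that the integral of a product over a partition of the coordinates into two parts factorises.
\<close>

lemma distr_pick:
  fixes N :: "'b measure"
  assumes N: "sigma_finite_measure N" and d: "distinct js" "distinct ls"
    and disj: "set js \<inter> set ls = {}"
  shows "distr (\<Pi>\<^sub>M j\<in>set js \<union> set ls. N) ((\<Pi>\<^sub>M j\<in>{..<length js}. N) \<Otimes>\<^sub>M (\<Pi>\<^sub>M j\<in>{..<length ls}. N))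
      (\<lambda>x. (pick js x, pick ls x)) =
    (\<Pi>\<^sub>M j\<in>{..<length js}. N) \<Otimes>\<^sub>M (\<Pi>\<^sub>M j\<in>{..<length ls}. N)"
proof (rule pair_measure_eqI[symmetric])
  interpret N: sigma_finite_measure N by fact
  interpret product_sigma_finite "\<lambda>_::nat. N" by unfold_locales
  let ?P = "\<lambda>I. \<Pi>\<^sub>M j\<in>I. N"
  show "sigma_finite_measure (?P {..<length js})" "sigma_finite_measure (?P {..<length ls})"
    by (rule sigma_finite; simp)+
  have [measurable]: "pick js \<in> ?P (set js) \<rightarrow>\<^sub>M ?P {..<length js}"
    "pick ls \<in> ?P (set ls) \<rightarrow>\<^sub>M ?P {..<length ls}"
    "pick js \<in> ?P (set js \<union> set ls) \<rightarrow>\<^sub>M ?P {..<length js}"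
    "pick ls \<in> ?P (set js \<union> set ls) \<rightarrow>\<^sub>M ?P {..<length ls}"
    by (intro measurable_pick; auto)+
  have D: "distr (?P (set js)) (?P {..<length js}) (pick js) = ?P {..<length js}" if "distinct js" for js
    unfolding pick_def using that by (intro distr_PiM_bij_betw N bij_betw_nth) auto
  fix A B assume A [measurable]: "A \<in> sets (?P {..<length js})" and B [measurable]: "B \<in> sets (?P {..<length ls})"
  have T: "(\<lambda>x. (pick js x, pick ls x)) \<in> ?P (set js \<union> set ls) \<rightarrow>\<^sub>M ?P {..<length js} \<Otimes>\<^sub>M ?P {..<length ls}"
    by measurable
  have m: "pick js (merge (set js) (set ls) (x, y)) = pick js x"
    "pick ls (merge (set js) (set ls) (x, y)) = pick ls y" for x y
    using disj by (auto simp: pick_def merge_def restrict_def fun_eq_iff)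
  have "emeasure (distr (?P (set js \<union> set ls)) (?P {..<length js} \<Otimes>\<^sub>M ?P {..<length ls})
      (\<lambda>x. (pick js x, pick ls x))) (A \<times> B) =
    (\<integral>\<^sup>+z. indicator (A \<times> B) z \<partial>distr (?P (set js \<union> set ls)) (?P {..<length js} \<Otimes>\<^sub>M ?P {..<length ls})
      (\<lambda>x. (pick js x, pick ls x)))" by simp
  also have "\<dots> = (\<integral>\<^sup>+x. indicator A (pick js x) * indicator B (pick ls x) \<partial>?P (set js \<union> set ls))"
    by (subst nn_integral_distr[OF T]) (auto simp: indicator_times)
  also have "\<dots> = (\<integral>\<^sup>+x. \<integral>\<^sup>+y. indicator A (pick js x) * indicator B (pick ls y) \<partial>?P (set ls) \<partial>?P (set js))"
    using disj by (subst product_nn_integral_fold) (auto simp: m)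
  also have "\<dots> = (\<integral>\<^sup>+x. indicator A (pick js x) \<partial>?P (set js)) * (\<integral>\<^sup>+y. indicator B (pick ls y) \<partial>?P (set ls))"
    by (simp add: nn_integral_cmult nn_integral_multc)
  also have "(\<integral>\<^sup>+x. indicator A (pick js x) \<partial>?P (set js)) = emeasure (?P {..<length js}) A"
    using D[OF d(1)] nn_integral_distr[of "pick js" "?P (set js)" "?P {..<length js}" "indicator A"] by simp
  also have "(\<integral>\<^sup>+x. indicator B (pick ls x) \<partial>?P (set ls)) = emeasure (?P {..<length ls}) B"
    using D[OF d(2)] nn_integral_distr[of "pick ls" "?P (set ls)" "?P {..<length ls}" "indicator B"] by simp
  finally show "emeasure (?P {..<length js}) A * emeasure (?P {..<length ls}) B =
    emeasure (distr (?P (set js \<union> set ls)) (?P {..<length js} \<Otimes>\<^sub>M ?P {..<length ls})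
      (\<lambda>x. (pick js x, pick ls x))) (A \<times> B)" by simp
qed simp

lemma AE_pick:
  fixes N :: "'b measure"
  assumes N: "sigma_finite_measure N" and js: "distinct js" "set js \<subseteq> {..<k}"
    and P: "AE y in (\<Pi>\<^sub>M j\<in>{..<length js}. N). P y"
  shows "AE x in (\<Pi>\<^sub>M j\<in>{..<k}. N). P (pick js x)"
proof -
  let ?P = "\<lambda>I. \<Pi>\<^sub>M j\<in>I. N"
  define ls where "ls = sorted_list_of_set ({..<k} - set js)"
  have ls: "distinct ls" "set ls = {..<k} - set js" by (auto simp: ls_def)
  then have U: "set js \<union> set ls = {..<k}" using js by auto
  interpret N: sigma_finite_measure N by fact
  interpret product_sigma_finite "\<lambda>_::nat. N" by unfold_locales
  interpret ls: sigma_finite_measure "?P {..<length ls}" by (rule sigma_finite) simp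
  have "set js \<inter> set ls = {}" using ls by auto
  note D = distr_pick[OF N js(1) ls(1) this, unfolded U]
  obtain C where C: "{y\<in>space (?P {..<length js}). \<not> P y} \<subseteq> C" "C \<in> null_sets (?P {..<length js})"
    using P by (auto simp: eventually_ae_filter)
  then have "C \<times> space (?P {..<length ls}) \<in> null_sets (?P {..<length js} \<Otimes>\<^sub>M ?P {..<length ls})"
    by (auto simp: null_sets_def ls.emeasure_pair_measure_Times)
  then have "AE z in ?P {..<length js} \<Otimes>\<^sub>M ?P {..<length ls}. z \<notin> C \<times> space (?P {..<length ls})"
    by (rule AE_not_in)
  then have "AE z in ?P {..<length js} \<Otimes>\<^sub>M ?P {..<length ls}. P (fst z)"
    using AE_space by eventually_elim (use C(1) in \<open>auto simp: space_pair_measure\<close>)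
  then have "AE z in distr (?P {..<k}) (?P {..<length js} \<Otimes>\<^sub>M ?P {..<length ls}) (\<lambda>x. (pick js x, pick ls x)). P (fst z)"
    unfolding D .
  then have "AE x in ?P {..<k}. P (fst (pick js x, pick ls x))"
    by (rule AE_distrD[rotated]) (use js ls in \<open>auto intro!: measurable_Pair measurable_pick\<close>)
  then show ?thesis by simp
qed

lemma integral_pick_mult:
  fixes f g :: "(nat \<Rightarrow> 'b) \<Rightarrow> real"
  assumes N: "sigma_finite_measure N" and d: "distinct js" "distinct ls"
    and disj: "set js \<inter> set ls = {}" and U: "set js \<union> set ls = {..<k}"
    and f: "integrable (\<Pi>\<^sub>M j\<in>{..<length js}. N) f" and g: "integrable (\<Pi>\<^sub>M j\<in>{..<length ls}. N) g"
  shows "integrable (\<Pi>\<^sub>M j\<in>{..<k}. N) (\<lambda>x. f (pick js x) * g (pick ls x))"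
    and "(\<integral>x. f (pick js x) * g (pick ls x) \<partial>(\<Pi>\<^sub>M j\<in>{..<k}. N)) =
      (\<integral>x. f x \<partial>(\<Pi>\<^sub>M j\<in>{..<length js}. N)) * (\<integral>x. g x \<partial>(\<Pi>\<^sub>M j\<in>{..<length ls}. N))"
proof -
  let ?P = "\<lambda>I. \<Pi>\<^sub>M j\<in>I. N"
  interpret N: sigma_finite_measure N by fact
  interpret product_sigma_finite "\<lambda>_::nat. N" by unfold_locales
  interpret pair_sigma_finite "?P {..<length js}" "?P {..<length ls}"
    by (intro pair_sigma_finite.intro sigma_finite) auto
  note [measurable] = borel_measurable_integrable[OF f] borel_measurable_integrable[OF g]
  have T: "(\<lambda>x. (pick js x, pick ls x)) \<in> ?P {..<k} \<rightarrow>\<^sub>M ?P {..<length js} \<Otimes>\<^sub>M ?P {..<length ls}"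
    using U by (auto intro!: measurable_Pair measurable_pick)
  have D: "distr (?P {..<k}) (?P {..<length js} \<Otimes>\<^sub>M ?P {..<length ls}) (\<lambda>x. (pick js x, pick ls x)) =
      ?P {..<length js} \<Otimes>\<^sub>M ?P {..<length ls}"
    using distr_pick[OF N d disj] U by simp
  have m: "(\<lambda>z. f (fst z) * g (snd z)) \<in> borel_measurable (?P {..<length js} \<Otimes>\<^sub>M ?P {..<length ls})"
    by measurable
  have i: "integrable (?P {..<length js} \<Otimes>\<^sub>M ?P {..<length ls}) (\<lambda>z. f (fst z) * g (snd z))"
    by (rule Fubini_integrable[OF m]) (use f g in \<open>auto simp: abs_mult\<close>)
  have "integrable (distr (?P {..<k}) (?P {..<length js} \<Otimes>\<^sub>M ?P {..<length ls}) (\<lambda>x. (pick js x, pick ls x)))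
      (\<lambda>z. f (fst z) * g (snd z))"
    unfolding D by (rule i)
  from integrable_distr[OF T this]
  show "integrable (?P {..<k}) (\<lambda>x. f (pick js x) * g (pick ls x))" by simp
  have "(\<integral>x. f (pick js x) * g (pick ls x) \<partial>?P {..<k}) =
      (\<integral>z. f (fst z) * g (snd z) \<partial>(?P {..<length js} \<Otimes>\<^sub>M ?P {..<length ls}))"
    using integral_distr[OF T m] unfolding D by simp
  also have "\<dots> = (\<integral>x. f x \<partial>?P {..<length js}) * (\<integral>x. g x \<partial>?P {..<length ls})"
    unfolding integral_fst'[OF i, symmetric] by simp
  finally show "(\<integral>x. f (pick js x) * g (pick ls x) \<partial>?P {..<k}) =
      (\<integral>x. f x \<partial>?P {..<length js}) * (\<integral>x. g x \<partial>?P {..<length ls})" .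
qed

section \<open>Translations of Lebesgue measure\<close>

lemma sigma_finite_PiM_lborel:
  "sigma_finite_measure (\<Pi>\<^sub>M j\<in>{..<k::nat}. (lborel :: 'a::euclidean_space measure))"
proof -
  interpret product_sigma_finite "\<lambda>_::nat. lborel :: 'a measure" by unfold_locales
  show ?thesis by (rule sigma_finite) simp
qed

lemma AE_lborel_ex:
  assumes "S \<in> sets lborel" "emeasure lborel S \<noteq> 0" "AE a in lborel. a \<in> S \<longrightarrow> P a"
  shows "\<exists>a\<in>S. P a"
proof (rule ccontr)
  assume "\<not> (\<exists>a\<in>S. P a)"
  then have "AE a in lborel. a \<notin> S" using assms(3) by (auto elim: eventually_mono)
  then have "S \<in> null_sets lborel" using AE_iff_null_sets[OF assms(1)] by simp
  then show False using assms(2) by (simp add: null_sets_def)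
qed

lemma nn_integral_lborel_shift:
  fixes a :: "'a::euclidean_space"
  assumes "h \<in> borel_measurable borel"
  shows "(\<integral>\<^sup>+b. h (a + b) \<partial>lborel) = (\<integral>\<^sup>+b. h b \<partial>lborel)"
proof -
  have "(\<integral>\<^sup>+b. h b \<partial>distr lborel borel ((+) a)) = (\<integral>\<^sup>+b. h (a + b) \<partial>lborel)"
    using assms by (subst nn_integral_distr) auto
  then show ?thesis by (simp add: lborel_distr_plus)
qed

lemma PiM_lborel_shift:
  fixes a :: "'a::euclidean_space" and k :: nat
  shows "distr (\<Pi>\<^sub>M j\<in>{..<k}. lborel) (\<Pi>\<^sub>M j\<in>{..<k}. lborel) (\<lambda>x. \<lambda>j\<in>{..<k}. a + x j) =
    (\<Pi>\<^sub>M j\<in>{..<k}. lborel)"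
proof -
  interpret product_sigma_finite "\<lambda>_::nat. lborel :: 'a measure" by unfold_locales
  have T: "(\<lambda>x. \<lambda>j\<in>{..<k}. a + x j) \<in> (\<Pi>\<^sub>M j\<in>{..<k}. lborel) \<rightarrow>\<^sub>M (\<Pi>\<^sub>M j\<in>{..<k}. lborel)"
    by measurable
  show ?thesis
  proof (rule PiM_eqI)
    fix A assume "\<And>i. i \<in> {..<k} \<Longrightarrow> A i \<in> sets (lborel :: 'a measure)"
    then have A: "i < k \<Longrightarrow> A i \<in> sets borel" for i by simp
    have s: "(+) a -` A i \<in> sets borel" if "i < k" for i
      using measurable_sets[of "(+) a" borel borel "A i"] A[OF that] by simp
    have "(\<lambda>x. \<lambda>j\<in>{..<k}. a + x j) -` (\<Pi>\<^sub>E i\<in>{..<k}. A i) \<inter> space (\<Pi>\<^sub>M j\<in>{..<k}. lborel) =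
        (\<Pi>\<^sub>E i\<in>{..<k}. (+) a -` A i)"
      by (auto simp: space_PiM PiE_iff)
    moreover have "emeasure (\<Pi>\<^sub>M j\<in>{..<k}. lborel) (\<Pi>\<^sub>E i\<in>{..<k}. (+) a -` A i) =
        (\<Prod>i<k. emeasure lborel ((+) a -` A i))"
      by (rule emeasure_PiM) (use s in auto)
    ultimately have "emeasure (distr (\<Pi>\<^sub>M j\<in>{..<k}. lborel) (\<Pi>\<^sub>M j\<in>{..<k}. lborel) (\<lambda>x. \<lambda>j\<in>{..<k}. a + x j))
        (\<Pi>\<^sub>E i\<in>{..<k}. A i) = (\<Prod>i<k. emeasure lborel ((+) a -` A i))"
      using A by (subst emeasure_distr[OF T]) (auto intro!: sets_PiM_I_finite)
    also have "\<dots> = (\<Prod>i<k. emeasure lborel (A i))"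
    proof (rule prod.cong)
      fix i assume "i \<in> {..<k}"
      then have "emeasure (distr lborel borel ((+) a)) (A i) = emeasure lborel ((+) a -` A i)"
        using A by (subst emeasure_distr) auto
      then show "emeasure lborel ((+) a -` A i) = emeasure lborel (A i)" by (simp add: lborel_distr_plus)
    qed simp
    finally show "emeasure (distr (\<Pi>\<^sub>M j\<in>{..<k}. lborel) (\<Pi>\<^sub>M j\<in>{..<k}. lborel) (\<lambda>x. \<lambda>j\<in>{..<k}. a + x j))
        (\<Pi>\<^sub>E i\<in>{..<k}. A i) = (\<Prod>i<k. emeasure lborel (A i))" .
  qed simp_all
qed

lemma nn_integral_PiM_lborel_shift:
  fixes a :: "'a::euclidean_space"
  assumes f: "f \<in> borel_measurable (\<Pi>\<^sub>M j\<in>{..<k}. lborel)"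
  shows "(\<integral>\<^sup>+x. f (\<lambda>j\<in>{..<k}. a + x j) \<partial>(\<Pi>\<^sub>M j\<in>{..<k::nat}. lborel)) = (\<integral>\<^sup>+x. f x \<partial>(\<Pi>\<^sub>M j\<in>{..<k}. lborel))"
proof -
  have "(\<lambda>x. \<lambda>j\<in>{..<k}. a + x j) \<in> (\<Pi>\<^sub>M j\<in>{..<k}. lborel) \<rightarrow>\<^sub>M (\<Pi>\<^sub>M j\<in>{..<k}. lborel)" by measurable
  from nn_integral_distr[OF this, of f] f show ?thesis unfolding PiM_lborel_shift by simp
qed

text \<open>
  Lebesgue measure is translation invariant, so the other points may be described relative to the first one. In
  these coordinates a translation invariant integrand is independent of the first point.
\<close>

lemma nn_integral_PiM_Suc_centred:
  fixes f :: "(nat \<Rightarrow> 'a::euclidean_space) \<Rightarrow> ennreal"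
  assumes f: "f \<in> borel_measurable (\<Pi>\<^sub>M j\<in>{..<Suc k}. lborel)"
  shows "(\<integral>\<^sup>+x. f x \<partial>(\<Pi>\<^sub>M j\<in>{..<Suc k}. lborel)) =
    (\<integral>\<^sup>+a. \<integral>\<^sup>+x. f (glue k a (\<lambda>j. a + x j)) \<partial>(\<Pi>\<^sub>M j\<in>{..<k}. lborel) \<partial>lborel)"
proof -
  have "(\<integral>\<^sup>+x. f (glue k a (\<lambda>j. a + x j)) \<partial>(\<Pi>\<^sub>M j\<in>{..<k}. lborel)) =
      (\<integral>\<^sup>+x. f (glue k a x) \<partial>(\<Pi>\<^sub>M j\<in>{..<k}. lborel))" for a
  proof -
    have "(\<lambda>x. glue k a x) \<in> (\<Pi>\<^sub>M j\<in>{..<k}. lborel) \<rightarrow>\<^sub>M (\<Pi>\<^sub>M j\<in>{..<Suc k}. lborel)"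
      by (rule measurable_glue) auto
    from measurable_compose[OF this f] have "(\<lambda>x. f (glue k a x)) \<in> borel_measurable (\<Pi>\<^sub>M j\<in>{..<k}. lborel)" .
    from nn_integral_PiM_lborel_shift[OF this, of a]
    have "(\<integral>\<^sup>+x. f (glue k a (\<lambda>j\<in>{..<k}. a + x j)) \<partial>(\<Pi>\<^sub>M j\<in>{..<k}. lborel)) =
      (\<integral>\<^sup>+x. f (glue k a x) \<partial>(\<Pi>\<^sub>M j\<in>{..<k}. lborel))" .
    moreover have "glue k a (\<lambda>j\<in>{..<k}. a + x j) = glue k a (\<lambda>j. a + x j)" for x
      by (auto simp: glue_def fun_eq_iff restrict_def split: nat.split)
    ultimately show ?thesis by simp
  qed
  then show ?thesis
    using nn_integral_PiM_Suc[OF sigma_finite_lborel f] by simp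
qed

text \<open>
  The hypothesis gives, for each shift separately, an exceptional null set. Let \<open>e a c\<close> be the measure of
  the set of those \<open>x\<close> for which the function seen from \<open>a\<close> and the function seen from \<open>c\<close> differ at \<open>x\<close>. Then
  the integral of \<open>e a (a + b)\<close> over \<open>a\<close> vanishes for every \<open>b\<close>, hence so does the double integral of \<open>e\<close>, and by
  Fubini's theorem some single \<open>b\<close> works against almost every \<open>a\<close>.
\<close>

lemma translation_invariant_version:
  fixes g :: "(nat \<Rightarrow> 'a::euclidean_space) \<Rightarrow> real"
  assumes g: "g \<in> borel_measurable (\<Pi>\<^sub>M j\<in>{..<Suc k}. lborel)"
    and inv: "\<And>b. AE z in (\<Pi>\<^sub>M j\<in>{..<Suc k}. lborel). g (\<lambda>j\<in>{..<Suc k}. z j + b) = g z"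
  shows "\<exists>b. AE (a, x) in lborel \<Otimes>\<^sub>M (\<Pi>\<^sub>M j\<in>{..<k}. lborel).
    g (glue k b (\<lambda>j. b + x j)) = g (glue k a (\<lambda>j. a + x j))"
proof -
  let ?P = "\<Pi>\<^sub>M j\<in>{..<k}. (lborel :: 'a measure)"
  interpret P: sigma_finite_measure ?P by (rule sigma_finite_PiM_lborel)
  interpret L: pair_sigma_finite "lborel :: 'a measure" ?P by unfold_locales
  define f where "f a x = g (glue k a (\<lambda>j. a + x j))" for a x
  have f: "(\<lambda>\<omega>. f (a \<omega>) (x \<omega>)) \<in> borel_measurable L" if "a \<in> L \<rightarrow>\<^sub>M borel" "x \<in> L \<rightarrow>\<^sub>M ?P" for a x and L :: "'z measure"
  proof -
    have "(\<lambda>\<omega>. glue k (a \<omega>) (\<lambda>j. a \<omega> + x \<omega> j)) \<in> L \<rightarrow>\<^sub>M (\<Pi>\<^sub>M j\<in>{..<Suc k}. lborel)"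
    proof (rule measurable_glue)
      show "a \<in> L \<rightarrow>\<^sub>M lborel" using that by simp
      fix j assume "j < k"
      then have "(\<lambda>\<omega>. x \<omega> j) \<in> L \<rightarrow>\<^sub>M lborel"
        using measurable_compose[OF that(2) measurable_component_singleton[of j "{..<k}" "\<lambda>_. lborel"]] by simp
      then show "(\<lambda>\<omega>. a \<omega> + x \<omega> j) \<in> L \<rightarrow>\<^sub>M lborel" using that(1) by simp
    qed
    from measurable_compose[OF this g] show ?thesis by (simp add: f_def)
  qed
  define e :: "'a \<Rightarrow> 'a \<Rightarrow> ennreal" where
    "e a c = (\<integral>\<^sup>+x. (if f a x = f c x then 0 else 1) \<partial>?P)" for a c
  have e: "(\<lambda>\<omega>. e (a \<omega>) (c \<omega>)) \<in> borel_measurable L" if [measurable]: "a \<in> L \<rightarrow>\<^sub>M borel" "c \<in> L \<rightarrow>\<^sub>M borel"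
    for a c and L :: "'z measure"
  proof -
    have [measurable]: "(\<lambda>z. f (a (fst z)) (snd z)) \<in> borel_measurable (L \<Otimes>\<^sub>M ?P)"
      "(\<lambda>z. f (c (fst z)) (snd z)) \<in> borel_measurable (L \<Otimes>\<^sub>M ?P)"
      by (rule f; measurable)+
    show ?thesis unfolding e_def by (rule P.borel_measurable_nn_integral) (simp add: case_prod_beta')
  qed
  have "(\<integral>\<^sup>+a. e a (a + b) \<partial>lborel) = 0" for b
  proof -
    let ?h = "\<lambda>z. (if g (\<lambda>j\<in>{..<Suc k}. z j + b) = g z then 0 else 1) :: ennreal"
    have [measurable]: "(\<lambda>z. g (\<lambda>j\<in>{..<Suc k}. z j + b)) \<in> borel_measurable (\<Pi>\<^sub>M j\<in>{..<Suc k}. lborel)"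
      by (rule measurable_compose[OF _ g]) measurable
    note [measurable] = g
    have h: "?h \<in> borel_measurable (\<Pi>\<^sub>M j\<in>{..<Suc k}. lborel)" by measurable
    have "(\<integral>\<^sup>+z. ?h z \<partial>(\<Pi>\<^sub>M j\<in>{..<Suc k}. lborel)) = 0"
      using inv[of b] by (subst nn_integral_0_iff_AE[OF h]) (auto elim: eventually_mono)
    then have "(\<integral>\<^sup>+a. \<integral>\<^sup>+x. ?h (glue k a (\<lambda>j. a + x j)) \<partial>?P \<partial>lborel) = 0"
      using nn_integral_PiM_Suc_centred[OF h] by simp
    moreover have "?h (glue k a (\<lambda>j. a + x j)) = (if f a x = f (a + b) x then 0 else 1)" for a x
    proof -
      have "(\<lambda>j\<in>{..<Suc k}. glue k a (\<lambda>j. a + x j) j + b) = glue k (a + b) (\<lambda>j. (a + b) + x j)"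
        by (auto simp: glue_def fun_eq_iff restrict_def ac_simps split: nat.split)
      then show ?thesis by (auto simp: f_def)
    qed
    ultimately show ?thesis by (simp add: e_def)
  qed
  then have "(\<integral>\<^sup>+b. \<integral>\<^sup>+a. e a (a + b) \<partial>lborel \<partial>lborel) = 0" by simp
  moreover have "(\<integral>\<^sup>+b. \<integral>\<^sup>+a. e a (a + b) \<partial>lborel \<partial>lborel) = (\<integral>\<^sup>+a. \<integral>\<^sup>+b. e a (a + b) \<partial>lborel \<partial>lborel)"
    by (rule lborel_pair.Fubini') (simp add: case_prod_beta', rule e; measurable)
  moreover have "(\<integral>\<^sup>+b. e a (a + b) \<partial>lborel) = (\<integral>\<^sup>+c. e a c \<partial>lborel)" for a
    by (rule nn_integral_lborel_shift) (rule e; measurable)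
  ultimately have z: "(\<integral>\<^sup>+a. \<integral>\<^sup>+c. e a c \<partial>lborel \<partial>lborel) = 0" by simp
  have "(\<lambda>a. \<integral>\<^sup>+c. e a c \<partial>lborel) \<in> borel_measurable lborel"
    by (rule lborel.borel_measurable_nn_integral) (simp add: case_prod_beta', rule e; measurable)
  then have "AE a in lborel. (\<integral>\<^sup>+c. e a c \<partial>lborel) = 0" using z by (simp add: nn_integral_0_iff_AE)
  then obtain b where b: "(\<integral>\<^sup>+c. e b c \<partial>lborel) = 0"
    using AE_lborel_ex[of UNIV] by auto
  let ?H = "\<lambda>z. (if f b (snd z) = f (fst z) (snd z) then 0 else 1) :: ennreal"
  have [measurable]: "(\<lambda>z. f b (snd z)) \<in> borel_measurable (lborel \<Otimes>\<^sub>M ?P)"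
    "(\<lambda>z. f (fst z) (snd z)) \<in> borel_measurable (lborel \<Otimes>\<^sub>M ?P)"
    by (rule f; measurable)+
  have H: "?H \<in> borel_measurable (lborel \<Otimes>\<^sub>M ?P)" by measurable
  have "(\<integral>\<^sup>+z. ?H z \<partial>(lborel \<Otimes>\<^sub>M ?P)) = 0"
    using b P.nn_integral_fst[OF H] by (simp add: e_def)
  then have "AE z in lborel \<Otimes>\<^sub>M ?P. f b (snd z) = f (fst z) (snd z)"
    by (subst (asm) nn_integral_0_iff_AE[OF H]) (auto elim: eventually_mono split: if_splits)
  then show ?thesis by (intro exI[of _ b]) (simp add: f_def case_prod_beta')
qed

section \<open>Sums over partitions and the cumulant recursion\<close>

lemma partition_block_neq:
  assumes "partition_on A P" "P \<noteq> {A}" "D \<in> P"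
  shows "D \<noteq> A"
proof
  assume eq: "D = A"
  have "B = A" if "B \<in> P" for B
  proof (rule ccontr)
    assume "B \<noteq> A"
    then have "B \<inter> A = {}" using disjointD[OF partition_onD2[OF assms(1)] that assms(3)] eq by simp
    moreover have "B \<subseteq> A" "B \<noteq> {}" using partition_onD1[OF assms(1)] partition_onD3[OF assms(1)] that by auto
    ultimately show False by blast
  qed
  then show False using assms(2,3) eq by blast
qed

text \<open>
  A partition of \<open>insert a A\<close> is determined by the block \<open>insert a D\<close> that contains \<open>a\<close> together with a
  partition of what is left.
\<close>

lemma sum_prod_partition_insert:
  fixes F :: "'b set \<Rightarrow> 'c::comm_semiring_1"
  assumes fin: "finite A" and a: "a \<notin> A"
  shows "(\<Sum>P | partition_on (insert a A) P. \<Prod>B\<in>P. F B) =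
    (\<Sum>D\<in>Pow A. F (insert a D) * (\<Sum>P | partition_on (A - D) P. \<Prod>B\<in>P. F B))"
proof -
  let ?S = "Sigma (Pow A) (\<lambda>D. {P. partition_on (A - D) P})"
  have blk: "\<exists>B\<in>P. a \<in> B \<and> (\<forall>B'\<in>P. a \<in> B' \<longrightarrow> B' = B)" if P: "partition_on (insert a A) P" for P
  proof -
    obtain B where "B \<in> P" "a \<in> B" using partition_onD1[OF P] by blast
    then show ?thesis using disjointD[OF partition_onD2[OF P], of B] by blast
  qed
  define blk where "blk P = (THE B. B \<in> P \<and> a \<in> B)" for P
  have blk: "blk P \<in> P" "a \<in> blk P" "B \<in> P \<Longrightarrow> a \<in> B \<Longrightarrow> B = blk P"
    if P: "partition_on (insert a A) P" for P B
  proof -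
    have "\<exists>!B. B \<in> P \<and> a \<in> B" using blk[OF P] by blast
    then have "blk P \<in> P \<and> a \<in> blk P" unfolding blk_def by (rule theI')
    then show "blk P \<in> P" "a \<in> blk P" "B \<in> P \<Longrightarrow> a \<in> B \<Longrightarrow> B = blk P"
      using blk[OF P] by blast+
  qed
  have rest: "disjnt (insert a D) (\<Union>P)" if "(D, P) \<in> ?S" for D P
    using that a by (auto simp: partition_on_def disjnt_def)
  have "(\<Sum>P | partition_on (insert a A) P. \<Prod>B\<in>P. F B) =
      (\<Sum>(D, P)\<in>?S. F (insert a D) * (\<Prod>B\<in>P. F B))"
  proof (rule sum.reindex_bij_witness[where j = "\<lambda>P. (blk P - {a}, P - {blk P})"
        and i = "\<lambda>(D, P). insert (insert a D) P"])
    fix P assume "P \<in> {P. partition_on (insert a A) P}"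
    then have P: "partition_on (insert a A) P" by simp
    note b = blk[OF P]
    show ins: "(case (blk P - {a}, P - {blk P}) of (D, P) \<Rightarrow> insert (insert a D) P) = P"
      using b(1,2) by (simp add: insert_absorb)
    have "disjnt (blk P) (\<Union>(P - {blk P}))"
      unfolding disjnt_Union2
    proof
      fix B assume "B \<in> P - {blk P}"
      then show "disjnt (blk P) B"
        using disjointD[OF partition_onD2[OF P] b(1), of B] unfolding disjnt_def by blast
    qed
    then have "partition_on (insert a A - blk P) (P - {blk P}) \<and> blk P \<subseteq> insert a A"
      using partition_on_insert[of "blk P" "P - {blk P}" "insert a A"] P b(1) by (simp add: insert_absorb)
    moreover have "insert a A - blk P = A - (blk P - {a})" using a b(2) by auto
    ultimately show "(blk P - {a}, P - {blk P}) \<in> ?S" using a by auto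
    have "finite P" using P fin finite_elements by blast
    then show "(case (blk P - {a}, P - {blk P}) of (D, P) \<Rightarrow> F (insert a D) * (\<Prod>B\<in>P. F B)) = (\<Prod>B\<in>P. F B)"
      using prod.remove[OF _ b(1), of F] b(2) by (simp add: insert_absorb)
  next
    fix z assume "z \<in> ?S"
    then obtain D P where z: "z = (D, P)" and D: "D \<subseteq> A" and P: "partition_on (A - D) P" by auto
    have dj: "disjnt (insert a D) (\<Union>P)" using rest[of D P] D P by auto
    have "insert a A - insert a D = A - D" using a by auto
    then have Q: "partition_on (insert a A) (insert (insert a D) P)"
      using partition_on_insert[OF dj, of "insert a A"] P D by auto
    then show "(case z of (D, P) \<Rightarrow> insert (insert a D) P) \<in> {P. partition_on (insert a A) P}" by (simp add: z)
    have bl: "insert a D = blk (insert (insert a D) P)" by (rule blk(3)[OF Q]) auto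
    have "insert a D \<notin> P" using dj by (auto simp: disjnt_def)
    then show "(case case z of (D, P) \<Rightarrow> insert (insert a D) P of P \<Rightarrow> (blk P - {a}, P - {blk P})) = z"
      using D a by (auto simp: z bl[symmetric])
  qed
  also have "\<dots> = (\<Sum>D\<in>Pow A. \<Sum>P | partition_on (A - D) P. F (insert a D) * (\<Prod>B\<in>P. F B))"
    by (rule sum.Sigma[symmetric]) (use fin in \<open>auto intro: finitely_many_partition_on\<close>)
  finally show ?thesis by (simp add: sum_distrib_left)
qed

lemma sum_prod_partition_reindex:
  fixes F :: "'b set \<Rightarrow> 'c::comm_semiring_1" and f :: "'d \<Rightarrow> 'b"
  assumes fin: "finite A" and f: "inj_on f A"
  shows "(\<Sum>P | partition_on (f ` A) P. \<Prod>B\<in>P. F B) = (\<Sum>P | partition_on A P. \<Prod>B\<in>P. F (f ` B))"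
proof -
  have im: "partition_on (h ` C) ((`) h ` P)" if "partition_on C P" "inj_on h C"
    for h :: "'e \<Rightarrow> 'g" and C P
    using partition_on_inj_image[OF that] partition_onD3[OF that(1)] by (simp add: image_iff) 
  have inj: "inj_on ((`) f) P" if "partition_on A P" for P
    using f that partition_onD1[OF that]
    by (intro inj_onI) (metis Sup_upper inj_on_image_eq_iff)
  define g where "g = the_inv_into A f"
  have g: "inj_on g (f ` A)" "g ` f ` A = A" using f by (auto simp: g_def inj_on_the_inv_into the_inv_into_onto)
  have gf: "g ` f ` B = B" if "B \<subseteq> A" for B
    using that f by (force simp: g_def the_inv_into_f_f image_iff subset_eq)
  have fg: "f ` g ` B = B" if "B \<subseteq> f ` A" for B
    using that f by (force simp: g_def f_the_inv_into_f image_iff subset_eq)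
  show ?thesis
  proof (rule sum.reindex_bij_witness[where i = "(`) ((`) f)" and j = "(`) ((`) g)"])
    fix P assume "P \<in> {P. partition_on (f ` A) P}"
    then have P: "partition_on (f ` A) P" by simp
    have B: "B \<in> P \<Longrightarrow> f ` g ` B = B" for B using partition_onD1[OF P] by (intro fg) auto
    show "(`) f ` (`) g ` P = P" using B by (simp add: image_image)
    show 1: "(`) g ` P \<in> {P. partition_on A P}" using im[OF P g(1)] g(2) by simp
    have "(\<Prod>B\<in>P. F B) = (\<Prod>B\<in>(`) f ` (`) g ` P. F B)" using B by (simp add: image_image)
    also have "\<dots> = (\<Prod>B\<in>(`) g ` P. F (f ` B))"
      using inj[of "(`) g ` P"] 1 by (subst prod.reindex) auto
    finally show "(\<Prod>B\<in>(`) g ` P. F (f ` B)) = (\<Prod>B\<in>P. F B)" by simp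
  next
    fix P assume "P \<in> {P. partition_on A P}"
    then have P: "partition_on A P" by simp
    have "B \<in> P \<Longrightarrow> g ` f ` B = B" for B using partition_onD1[OF P] by (intro gf) auto
    then show "(`) g ` (`) f ` P = P" by (simp add: image_image)
    show "(`) f ` P \<in> {P. partition_on (f ` A) P}" using im[OF P f] by simp
  qed
qed

text \<open>
  The increasing enumeration of \<open>D \<inter> {..<k}\<close>. It expresses \<^const>\<open>nths\<close>, which \<^const>\<open>cumulant\<close> is
  defined by, through \<^const>\<open>pick\<close>.
\<close>

definition positions :: "nat \<Rightarrow> nat set \<Rightarrow> nat list" where
  "positions k D = nths [0..<k] D"

lemma positions:
  shows "distinct (positions k D)" "set (positions k D) = D \<inter> {..<k}"
    "length (positions k D) = card (D \<inter> {..<k})"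
proof -
  show d: "distinct (positions k D)" by (simp add: positions_def)
  show s: "set (positions k D) = D \<inter> {..<k}" unfolding positions_def set_nths
    by auto (metis add_0 diff_zero nth_upt)
  show "length (positions k D) = card (D \<inter> {..<k})" using distinct_card[OF d] s by simp
qed

lemma length_positions: "D \<subseteq> {..<k} \<Longrightarrow> length (positions k D) = card D"
  by (simp add: positions Int_absorb2)

lemma card_complement: "D \<subseteq> {..<k} \<Longrightarrow> card ({..<k} - D) = k - card D"
  by (simp add: card_Diff_subset finite_subset[of D "{..<k}"])

lemma nths_positions: "nths zs D = map ((!) zs) (positions (length zs) D)"
  unfolding positions_def by (subst (1) map_nth[symmetric]) (rule nths_map)

lemma nths_image_positions:
  assumes "B \<subseteq> {..<length (positions (length zs) E)}"
  shows "nths (nths zs E) B = nths zs ((!) (positions (length zs) E) ` B)"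
proof -
  let ?js = "positions (length zs) E"
  have "nths ?js B = positions (length zs) ((!) ?js ` B)"
  proof (rule sorted_distinct_set_unique)
    show "set (nths ?js B) = set (positions (length zs) ((!) ?js ` B))"
      using assms positions(2)[of "length zs" E] nth_mem[of _ ?js] by (auto simp: set_nths positions(2))
  qed (auto simp: positions positions_def intro!: sorted_nths)
  then show ?thesis by (simp add: nths_positions[of zs] nths_map)
qed

lemma tuple_cong: "(\<And>j. j < k \<Longrightarrow> x j = y j) \<Longrightarrow> (\<And>j. j < k \<Longrightarrow> i j = l j) \<Longrightarrow> tuple k x i = tuple k y l"
  by (auto simp: tuple_def)

lemma length_tuple [simp]: "length (tuple k x i) = k"
  by (simp add: tuple_def)

lemma tuple_Suc: "tuple (Suc k) x i = (x 0, i 0) # tuple k (\<lambda>j. x (Suc j)) (\<lambda>j. i (Suc j))"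
  by (simp add: tuple_def map_upt_Suc del: upt_Suc)

lemma tuple_glue: "tuple (Suc k) (glue k a x) (case_nat i l) = (a, i) # tuple k x l"
  unfolding tuple_Suc by (auto simp: glue_def intro!: tuple_cong)

lemma nths_tuple:
  "nths (tuple k x i) D = tuple (length (positions k D)) (pick (positions k D) x) (\<lambda>j. i (positions k D ! j))"
proof -
  have "nths (tuple k x i) D = map (\<lambda>j. (x j, i j)) (positions k D)"
    unfolding tuple_def positions_def by (rule nths_map)
  also have "\<dots> = map (\<lambda>j. (x j, i j)) (map ((!) (positions k D)) [0..<length (positions k D)])"
    by (simp only: map_nth)
  finally show ?thesis by (simp add: tuple_def pick_def)
qed

lemma nths_tuple_map:
  "nths (tuple k (\<lambda>j. h (x j)) i) D = tuple (length (positions k D)) (\<lambda>j. h (pick (positions k D) x j)) (\<lambda>j. i (positions k D ! j))"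
  unfolding nths_tuple by (rule tuple_cong) (auto simp: pick_def)

text \<open>
  The left-hand side of the recursion for the cumulant densities. The value at the empty tuple is set to
  one, which is the empty product and makes the expansions below hold for empty blocks.
\<close>

definition reduced_density :: "(('a \<times> 2) list \<Rightarrow> real) \<Rightarrow> ('a \<times> 2) list \<Rightarrow> real" where
  "reduced_density p zs = (if zs = [] then 1 else p zs / (\<Prod>z\<leftarrow>zs. p [z]))"

lemma reduced_density_nths:
  assumes pos: "\<And>z. 0 < p [z]" and E: "E \<subseteq> {..<length zs}"
  shows "reduced_density p (nths zs E) = (\<Sum>P | partition_on E P. \<Prod>B\<in>P. cumulant p (nths zs B))"
proof (cases "nths zs E = []")
  case True
  then have "card E = 0" using E by (metis length_nths length_0_conv Collect_conj_eq Collect_mem_eq inf.absorb_iff2 inf_commute lessThan_def)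
  then have "E = {}" using E finite_subset[OF E] by simp
  then show ?thesis by (simp add: reduced_density_def partition_on_empty)
next
  case False
  let ?js = "positions (length zs) E"
  have len: "length (nths zs E) = length ?js" by (simp add: nths_positions)
  have inj: "inj_on ((!) ?js) {..<length ?js}" by (intro inj_on_nth) (auto simp: positions)
  have im: "(!) ?js ` {..<length ?js} = E" using E positions(2)[of "length zs" E]
    by (metis inf.absorb1 atLeast0LessThan list.set_map map_nth set_upt)
  have "reduced_density p (nths zs E) =
      (\<Sum>P | partition_on {..<length ?js} P. \<Prod>D\<in>P. cumulant p (nths (nths zs E) D))"
    using False cumulant_relation[of p "nths zs E", OF pos False] len by (simp add: reduced_density_def)
  also have "\<dots> = (\<Sum>P | partition_on {..<length ?js} P. \<Prod>D\<in>P. cumulant p (nths zs ((!) ?js ` D)))"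
  proof (intro sum.cong prod.cong refl arg_cong[where f = "cumulant p"] nths_image_positions)
    fix P D assume "P \<in> {P. partition_on {..<length ?js} P}" "D \<in> P"
    then show "D \<subseteq> {..<length ?js}" using partition_onD1[of "{..<length ?js}" P] by auto
  qed
  also have "\<dots> = (\<Sum>P | partition_on E P. \<Prod>B\<in>P. cumulant p (nths zs B))"
    using sum_prod_partition_reindex[OF _ inj, of "\<lambda>B. cumulant p (nths zs B)"] im by simp
  finally show ?thesis .
qed

text \<open>
  Partitions are sorted by the block that contains the first point; the partitions of the remaining points
  add up to a reduced density again. Each term has only two factors, so its integral factorises by
  splitting the points into two groups.
\<close>

lemma reduced_density_Cons:
  assumes pos: "\<And>z. 0 < p [z]"
  shows "reduced_density p (z # ws) = (\<Sum>D\<in>Pow {..<length ws}.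
    cumulant p (z # nths ws D) * reduced_density p (nths ws ({..<length ws} - D)))"
proof -
  let ?zs = "z # ws" and ?n = "length ws" and ?\<xi> = "\<lambda>B. cumulant p (nths (z # ws) B)"
  have up: "{..<length ?zs} = insert 0 (Suc ` {..<?n})" by (auto simp: image_iff less_Suc_eq_0_disj)
  have "reduced_density p ?zs = reduced_density p (nths ?zs {..<length ?zs})" by (simp add: nths_all del: nths_upt_eq_take)
  also have "\<dots> = (\<Sum>P | partition_on (insert 0 (Suc ` {..<?n})) P. \<Prod>B\<in>P. ?\<xi> B)"
    unfolding up[symmetric] by (rule reduced_density_nths[where zs = ?zs]) (use pos in auto)
  also have "\<dots> = (\<Sum>D\<in>Pow (Suc ` {..<?n}). ?\<xi> (insert 0 D) *
      (\<Sum>P | partition_on (Suc ` {..<?n} - D) P. \<Prod>B\<in>P. ?\<xi> B))"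
    by (rule sum_prod_partition_insert) auto
  also have "\<dots> = (\<Sum>D\<in>Pow (Suc ` {..<?n}). ?\<xi> (insert 0 D) *
      reduced_density p (nths ?zs (Suc ` {..<?n} - D)))"
  proof -
    have "reduced_density p (nths ?zs (Suc ` {..<?n} - D)) =
        (\<Sum>P | partition_on (Suc ` {..<?n} - D) P. \<Prod>B\<in>P. ?\<xi> B)" for D
      by (rule reduced_density_nths[where zs = ?zs]) (use pos in auto)
    then show ?thesis by (simp only:)
  qed
  also have "Pow (Suc ` {..<?n}) = (`) Suc ` Pow {..<?n}" by (rule image_Pow_surj[symmetric]) simp
  also have "(\<Sum>D\<in>(`) Suc ` Pow {..<?n}. ?\<xi> (insert 0 D) * reduced_density p (nths ?zs (Suc ` {..<?n} - D))) =
      (\<Sum>D\<in>Pow {..<?n}. ?\<xi> (insert 0 (Suc ` D)) * reduced_density p (nths ?zs (Suc ` {..<?n} - Suc ` D)))"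
    by (subst sum.reindex) (auto intro!: inj_on_image)
  also have "\<dots> = (\<Sum>D\<in>Pow {..<?n}. cumulant p (z # nths ws D) * reduced_density p (nths ws ({..<?n} - D)))"
  proof (intro sum.cong refl)
    fix D
    have "{j. Suc j \<in> insert 0 (Suc ` D)} = D" "{j. Suc j \<in> Suc ` {..<?n} - Suc ` D} = {..<?n} - D" by auto
    then show "?\<xi> (insert 0 (Suc ` D)) * reduced_density p (nths ?zs (Suc ` {..<?n} - Suc ` D)) =
        cumulant p (z # nths ws D) * reduced_density p (nths ws ({..<?n} - D))"
      by (simp add: nths_Cons)
  qed
  finally show ?thesis .
qed

section \<open>Exponential series of moments\<close>

lemma sum_Pow_card:
  fixes f :: "nat \<Rightarrow> real"
  shows "(\<Sum>D\<in>Pow {..<k}. f (card D)) = (\<Sum>j\<le>k. real (k choose j) * f j)"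
proof -
  have "(\<Sum>D\<in>Pow {..<k}. f (card D)) = (\<Sum>j\<le>k. \<Sum>D\<in>{D \<in> Pow {..<k}. card D = j}. f (card D))"
    by (rule sum.group[symmetric]) (auto dest: card_mono[rotated])
  also have "\<dots> = (\<Sum>j\<le>k. real (card {D. D \<subseteq> {..<k} \<and> card D = j}) * f j)"
    by (intro sum.cong) auto
  finally show ?thesis by (simp add: n_subsets)
qed

text \<open>
  The exponential generating function of a binomial convolution is the product of those of its factors.
\<close>

lemma summable_binomial_convolution:
  fixes a b :: "nat \<Rightarrow> real"
  assumes a: "summable (\<lambda>k. \<bar>a k\<bar> / fact k)" and b: "summable (\<lambda>k. \<bar>b k\<bar> / fact k)"
  shows "summable (\<lambda>k. (\<Sum>D\<in>Pow {..<k}. a (card D) * b (k - card D)) / fact k)"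
proof -
  have "summable (\<lambda>k. \<Sum>j\<le>k. (a j / fact j) * (b (k - j) / fact (k - j)))"
    by (rule summable_Cauchy_product) (use a b in simp_all)
  moreover have "(\<Sum>D\<in>Pow {..<k}. a (card D) * b (k - card D)) / fact k =
      (\<Sum>j\<le>k. (a j / fact j) * (b (k - j) / fact (k - j)))" for k
    unfolding sum_Pow_card[of "\<lambda>j. a j * b (k - j)"] sum_divide_distrib
    by (intro sum.cong refl) (simp add: binomial_fact)
  ultimately show ?thesis by simp
qed

text \<open>
  Summability of \<open>m k / k!\<close> dominates the exponential series of \<open>- Z\<close>, so that expectation and
  sum may be interchanged.
\<close>

lemma integral_exp_minus_of_moments:
  fixes Z :: "'b \<Rightarrow> real" and m :: "nat \<Rightarrow> real"
  assumes Z [measurable]: "Z \<in> borel_measurable M" and Z0: "\<And>x. 0 \<le> Z x"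
    and m: "\<And>k. (\<integral>\<^sup>+x. ennreal (Z x ^ k) \<partial>M) = ennreal (m k)" "\<And>k. 0 \<le> m k"
    and sm: "summable (\<lambda>k. m k / fact k)"
  shows "(\<integral>x. exp (- Z x) \<partial>M) = (\<Sum>k. (-1) ^ k / fact k * m k)"
proof -
  have int: "integrable M (\<lambda>x. Z x ^ k)" for k
    by (rule integrableI_nn_integral_finite[OF _ _ m(1)]) (use Z0 m(2) in auto)
  have val: "(\<integral>x. Z x ^ k \<partial>M) = m k" for k
    using m Z0 by (subst integral_eq_nn_integral) (auto simp: enn2real_ennreal)
  define f where "f k x = (-1) ^ k / fact k * Z x ^ k" for k x
  have sf: "summable (\<lambda>k. norm (f k x))" for x
    using summable_exp[of "Z x"] Z0 by (simp add: f_def abs_mult power_abs divide_inverse mult.commute)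
  have nf: "\<bar>f k x\<bar> = Z x ^ k / fact k" for k x using Z0[of x] by (simp add: f_def abs_mult power_abs)
  have "(\<integral>x. (\<Sum>k. f k x) \<partial>M) = (\<Sum>k. \<integral>x. f k x \<partial>M)"
  proof (rule integral_suminf)
    show "integrable M (f k)" for k unfolding f_def by (intro integrable_mult_right int)
    show "AE x in M. summable (\<lambda>k. norm (f k x))" using sf by simp
    show "summable (\<lambda>k. \<integral>x. norm (f k x) \<partial>M)" using sm by (simp add: nf val)
  qed
  moreover have "(\<Sum>k. f k x) = exp (- Z x)" for x
    unfolding f_def exp_def by (intro suminf_cong) (simp add: power_minus[of "Z x"] divide_inverse mult.commute)
  moreover have "(\<integral>x. f k x \<partial>M) = (-1) ^ k / fact k * m k" for k
    unfolding f_def by (simp add: val)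
  ultimately show ?thesis by simp
qed

section \<open>Integration against locally finite measures\<close>

text \<open>
  An exhaustion of the space by bounded sets, on which locally finite measures are finite.
\<close>

definition box :: "nat \<Rightarrow> ('a::euclidean_space \<times> 2) set" where
  "box n = cball 0 (real n) \<times> UNIV"

lemma sets_box [measurable]: "box n \<in> sets marked_space"
  by (simp add: box_def Times_in_marked_space)

lemma incseq_box: "incseq box"
  by (auto simp: incseq_def box_def)

lemma UN_box: "(\<Union>n. box n) = UNIV"
  using real_arch_simple by (fastforce simp: box_def)

lemma emeasure_box_finite: "\<psi> \<in> lf_measures \<Longrightarrow> emeasure \<psi> (box n) < \<infinity>"
  by (simp add: lf_measures_def box_def)

lemma SUP_indicator_box: "(SUP n. f z * indicator (box n) z) = (f z :: ennreal)"
proof -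
  obtain n where n: "z \<in> box n" using UN_box by blast
  show ?thesis
  proof (rule antisym)
    show "(SUP n. f z * indicator (box n) z) \<le> f z" by (rule SUP_least) (auto split: split_indicator)
    show "f z \<le> (SUP n. f z * indicator (box n) z)" using n by (intro SUP_upper2[of n]) auto
  qed
qed

lemma borel_measurable_lf:
  "\<psi> \<in> lf_measures \<Longrightarrow> f \<in> borel_measurable marked_space \<Longrightarrow> f \<in> borel_measurable \<psi>"
  by (subst measurable_cong_sets[OF lf_measuresD(1) refl])

text \<open>
  Restricted to a bounded set and divided by one plus its mass there, \<open>L x\<close> becomes a kernel of subprobability
  measures, which integrates measurable functions to measurable functions; monotone convergence over the boxes removes
  the restriction.
\<close>

lemma measurable_nn_integral_lf:
  fixes f :: "'b \<Rightarrow> ('a::euclidean_space \<times> 2) \<Rightarrow> ennreal"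
  assumes f: "(\<lambda>(x, z). f x z) \<in> borel_measurable (N \<Otimes>\<^sub>M marked_space)"
    and L: "L \<in> N \<rightarrow>\<^sub>M lf_algebra"
  shows "(\<lambda>x. \<integral>\<^sup>+z. f x z \<partial>L x) \<in> borel_measurable N"
proof -
  note [measurable] = f L
  have lf: "L x \<in> lf_measures" if "x \<in> space N" for x using measurable_space[OF L that] by simp
  have em [measurable]: "(\<lambda>x. emeasure (L x) A) \<in> borel_measurable N" if "A \<in> sets marked_space" for A
    using measurable_compose[OF L measurable_emeasure_lf_algebra[OF that]] .
  have fx: "f x \<in> borel_measurable (L x)" if "x \<in> space N" for x
    using measurable_compose[OF measurable_Pair1'[OF that] f] by (intro borel_measurable_lf[OF lf[OF that]]) simp
  \<comment> \<open>adding one keeps the divisor positive where the box has no mass\<close>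
  define c where "c n x = 1 + emeasure (L x) (box n)" for n x
  have c [measurable]: "c n \<in> borel_measurable N" for n unfolding c_def by measurable
  have c0: "0 < c n x" "c n x < \<infinity>" if "x \<in> space N" for n x
    using emeasure_box_finite[OF lf[OF that]] by (auto simp: c_def add_pos_nonneg)
  define K where "K n x = density (L x) (\<lambda>z. indicator (box n) z / c n x)" for n x
  have mi: "(\<lambda>z. indicator (box n) z / c n x) \<in> borel_measurable (L x)" if "x \<in> space N" for n x
    by (intro borel_measurable_lf[OF lf[OF that]]) measurable
  have emK: "emeasure (K n x) A = emeasure (L x) (A \<inter> box n) / c n x"
    if "x \<in> space N" "A \<in> sets marked_space" for n x A
  proof -
    have "emeasure (K n x) A = (\<integral>\<^sup>+z. indicator (A \<inter> box n) z * (1 / c n x) \<partial>L x)"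
      unfolding K_def using that lf_measuresD[OF lf[OF that(1)]]
      by (subst emeasure_density[OF mi]) (auto intro!: nn_integral_cong split: split_indicator simp: divide_ennreal_def)
    also have "\<dots> = emeasure (L x) (A \<inter> box n) * (1 / c n x)"
      using that lf_measuresD[OF lf[OF that(1)]] by (subst nn_integral_multc) auto
    finally show ?thesis by (simp add: divide_ennreal_def)
  qed
  have K: "K n \<in> N \<rightarrow>\<^sub>M subprob_algebra marked_space" for n
  proof (rule measurable_subprob_algebra)
    fix x assume x: "x \<in> space N"
    show "sets (K n x) = sets marked_space" by (simp add: K_def lf_measuresD[OF lf[OF x]])
    show "subprob_space (K n x)"
    proof (rule subprob_spaceI)
      have "emeasure (K n x) (space (K n x)) = emeasure (L x) (box n) / c n x"
        using emK[OF x, of UNIV] by (simp add: K_def lf_measuresD[OF lf[OF x]] sets.top[of marked_space, simplified])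
      also have "\<dots> \<le> c n x / c n x" by (rule divide_right_mono_ennreal) (simp add: c_def)
      also have "\<dots> = 1" using c0[OF x, of n] by (intro ennreal_divide_self) auto
      finally show "emeasure (K n x) (space (K n x)) \<le> 1" .
      show "space (K n x) \<noteq> {}" by (simp add: K_def lf_measuresD[OF lf[OF x]])
    qed
  next
    fix A assume [measurable]: "A \<in> sets (marked_space :: ('a \<times> 2) measure)"
    show "(\<lambda>x. emeasure (K n x) A) \<in> borel_measurable N"
      by (subst measurable_cong[OF emK]) auto
  qed
  have "(\<integral>\<^sup>+z. f x z \<partial>L x) = (SUP n. c n x * (\<integral>\<^sup>+z. f x z \<partial>K n x))" if x: "x \<in> space N" for x
  proof -
    have sb: "box n \<in> sets (L x)" for n by (simp add: lf_measuresD[OF lf[OF x]])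
    have "(\<integral>\<^sup>+z. f x z \<partial>L x) = (\<integral>\<^sup>+z. (SUP n. f x z * indicator (box n) z) \<partial>L x)"
      by (simp add: SUP_indicator_box)
    also have "\<dots> = (SUP n. \<integral>\<^sup>+z. f x z * indicator (box n) z \<partial>L x)"
    proof (rule nn_integral_monotone_convergence_SUP)
      show "incseq (\<lambda>n z. f x z * indicator (box n) z)"
        using incseq_box by (auto simp: incseq_def le_fun_def split: split_indicator)
      show "(\<lambda>z. f x z * indicator (box n) z) \<in> borel_measurable (L x)" for n
        using fx[OF x] sb by measurable
    qed
    also have "\<dots> = (SUP n. c n x * (\<integral>\<^sup>+z. f x z \<partial>K n x))"
    proof (intro SUP_cong refl)
      fix n
      have "c n x * (\<integral>\<^sup>+z. f x z \<partial>K n x) = c n x * (\<integral>\<^sup>+z. (f x z * indicator (box n) z) * (1 / c n x) \<partial>L x)"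
        unfolding K_def using fx[OF x] by (subst nn_integral_density[OF mi[OF x]])
          (auto intro!: nn_integral_cong arg_cong[where f = "times (c n x)"] split: split_indicator simp: divide_ennreal_def mult.commute)
      also have "\<dots> = (\<integral>\<^sup>+z. f x z * indicator (box n) z \<partial>L x) * (c n x * (1 / c n x))"
        using fx[OF x] sb by (subst nn_integral_multc) (auto simp: ac_simps)
      also have "c n x * (1 / c n x) = 1"
        using c0[OF x, of n] by (simp add: ennreal_times_divide)
      finally show "(\<integral>\<^sup>+z. f x z * indicator (box n) z \<partial>L x) = c n x * (\<integral>\<^sup>+z. f x z \<partial>K n x)" by simp
    qed
    finally show ?thesis .
  qed
  moreover have "(\<lambda>x. SUP n. c n x * (\<integral>\<^sup>+z. f x z \<partial>K n x)) \<in> borel_measurable N"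
    by (intro borel_measurable_SUP borel_measurable_times_ennreal c nn_integral_measurable_subprob_algebra2[OF f K]) simp
  ultimately show ?thesis by (rule measurable_cong[THEN iffD2])
qed

lemma measurable_fst_marked [measurable]: "fst \<in> marked_space \<rightarrow>\<^sub>M borel"
  by (simp add: marked_space_def)

lemma measurable_snd_marked [measurable]: "snd \<in> marked_space \<rightarrow>\<^sub>M count_space UNIV"
  by (simp add: marked_space_def)

lemma nn_integral_component:
  assumes \<psi>: "\<psi> \<in> lf_measures" and f: "f \<in> borel_measurable borel"
  shows "(\<integral>\<^sup>+x. f x \<partial>component \<psi> i) = (\<integral>\<^sup>+z. f (fst z) * indicator {i} (snd z) \<partial>\<psi>)"
proof -
  have S: "UNIV \<times> {i} \<in> sets \<psi>" by (simp add: lf_measuresD[OF \<psi>] Times_in_marked_space)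
  have fst: "fst \<in> \<psi> \<rightarrow>\<^sub>M borel"
    by (subst measurable_cong_sets[OF lf_measuresD(1)[OF \<psi>] refl]) simp
  have "(\<integral>\<^sup>+x. f x \<partial>component \<psi> i) = (\<integral>\<^sup>+z. f (fst z) \<partial>restrict_space \<psi> (UNIV \<times> {i}))"
    unfolding component_def using f
    by (subst nn_integral_distr) (auto intro: measurable_restrict_space1 fst)
  also have "\<dots> = (\<integral>\<^sup>+z. f (fst z) * indicator (UNIV \<times> {i}) z \<partial>\<psi>)"
    using S by (subst nn_integral_restrict_space) (auto simp: lf_measuresD[OF \<psi>])
  also have "\<dots> = (\<integral>\<^sup>+z. f (fst z) * indicator {i} (snd z) \<partial>\<psi>)"
    by (intro nn_integral_cong) (auto split: split_indicator)
  finally show ?thesis .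
qed

lemma sets_PiM_lf: "\<psi> \<in> lf_measures \<Longrightarrow> sets (\<Pi>\<^sub>M j\<in>{..<k::nat}. \<psi>) = sets (\<Pi>\<^sub>M j\<in>{..<k}. marked_space)"
  by (intro sets_PiM_cong refl lf_measuresD(1))

section \<open>Moment measures and reduced densities\<close>

locale crm_measure =
  fixes M :: "'w measure" and \<Psi> :: "'w \<Rightarrow> ('a::euclidean_space \<times> 2) measure"
    and p :: "('a \<times> 2) list \<Rightarrow> real"
  assumes rm: "bivariate_random_measure M \<Psi>" and st: "crm_stationary M \<Psi> p"

sublocale crm_measure \<subseteq> prob_space M
  using rm by (simp add: bivariate_random_measure_def)

context crm_measure
begin

abbreviation PiL :: "nat \<Rightarrow> (nat \<Rightarrow> 'a) measure" where
  "PiL k \<equiv> \<Pi>\<^sub>M j\<in>{..<k}. lborel"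

abbreviation PiS :: "nat \<Rightarrow> (nat \<Rightarrow> 'a \<times> 2) measure" where
  "PiS k \<equiv> \<Pi>\<^sub>M j\<in>{..<k}. marked_space"

abbreviation \<rho> :: "('a \<times> 2) list \<Rightarrow> real" where "\<rho> \<equiv> reduced_density p"

lemma \<Psi> [measurable]: "\<Psi> \<in> M \<rightarrow>\<^sub>M lf_algebra"
  using rm by (simp add: bivariate_random_measure_def)

lemma \<Psi>_lf: "\<omega> \<in> space M \<Longrightarrow> \<Psi> \<omega> \<in> lf_measures"
  using measurable_space[OF \<Psi>] by simp

lemma coverage: "1 \<le> k \<Longrightarrow> coverage_function M \<Psi> k p"
  and locally_finite: "1 \<le> k \<Longrightarrow> locally_finite_moments M \<Psi> k"
  using st by (auto simp: crm_stationary_def)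

lemma p_nonneg: "zs \<noteq> [] \<Longrightarrow> 0 \<le> p zs"
  using coverage[of "length zs"] by (cases zs) (auto simp: coverage_function_def)

lemma p_lower_bound: "\<exists>c>0. \<forall>z. c \<le> p [z]"
proof (intro exI conjI allI)
  show "0 < (INF z. p [z])" using st by (simp add: crm_stationary_def)
  show "(INF z. p [z]) \<le> p [z]" for z
    by (rule cINF_lower) (auto intro!: bdd_belowI[of _ 0] p_nonneg)
qed

lemma p_pos: "0 < p [z]"
  using p_lower_bound less_le_trans by blast

lemma measurable_p: "1 \<le> k \<Longrightarrow> (\<lambda>x. p (tuple k x i)) \<in> borel_measurable (PiL k)"
  using coverage[of k] by (simp add: coverage_function_def)

lemma measurable_p_single [measurable]: "(\<lambda>z. p [z]) \<in> borel_measurable marked_space"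
proof -
  have "(\<lambda>x. p [(x, i)]) \<in> borel_measurable borel" for i
  proof -
    have "(\<lambda>x. \<lambda>j\<in>{..<1::nat}. x) \<in> borel \<rightarrow>\<^sub>M PiL 1" by (intro measurable_restrict) simp
    from measurable_compose[OF this measurable_p[of 1 "\<lambda>_. i"]] show ?thesis by (simp add: tuple_def)
  qed
  then have "(\<lambda>z. p [(fst z, snd z)]) \<in> borel_measurable (marked_space :: ('a \<times> 2) measure)"
    by (intro measurable_compose_countable'[where f = "\<lambda>i z. p [(fst z, i)]" and g = snd and I = UNIV])
      (auto intro: measurable_compose[OF measurable_fst_marked])
  then show ?thesis by simp
qed

lemma measurable_p_pair [measurable]: "(\<lambda>x. p [(x, i)]) \<in> borel_measurable borel"
proof -
  have "(\<lambda>x. (x, i)) \<in> borel \<rightarrow>\<^sub>M marked_space" unfolding marked_space_def by simp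
  from measurable_compose[OF this measurable_p_single] show ?thesis by simp
qed

text \<open>
  Integrals against the \<open>k\<close>-th moment measure are expected integrals against the \<open>k\<close>-fold product of the
  random measure (Campbell's formula). Measurability is carried along in the induction because linearity and monotone
  convergence of the expectation depend on it.
\<close>

lemma nn_integral_moment_measure:
  assumes F: "F \<in> borel_measurable (PiS k)"
  shows "(\<lambda>\<omega>. \<integral>\<^sup>+z. F z \<partial>(\<Pi>\<^sub>M j\<in>{..<k}. \<Psi> \<omega>)) \<in> borel_measurable M \<and>
    (\<integral>\<^sup>+z. F z \<partial>moment_measure M \<Psi> k) = (\<integral>\<^sup>+\<omega>. \<integral>\<^sup>+z. F z \<partial>(\<Pi>\<^sub>M j\<in>{..<k}. \<Psi> \<omega>) \<partial>M)"
  using F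
proof (induction rule: borel_measurable_induct)
  case (cong f g)
  have sp: "space (\<Pi>\<^sub>M j\<in>{..<k}. \<Psi> \<omega>) = space (PiS k)" if "\<omega> \<in> space M" for \<omega>
    by (rule sets_eq_imp_space_eq[OF sets_PiM_lf[OF \<Psi>_lf[OF that]]])
  have "(\<integral>\<^sup>+z. f z \<partial>(\<Pi>\<^sub>M j\<in>{..<k}. \<Psi> \<omega>)) = (\<integral>\<^sup>+z. g z \<partial>(\<Pi>\<^sub>M j\<in>{..<k}. \<Psi> \<omega>))" if "\<omega> \<in> space M" for \<omega>
    by (intro nn_integral_cong) (use cong sp[OF that] in auto)
  moreover have "(\<integral>\<^sup>+z. f z \<partial>moment_measure M \<Psi> k) = (\<integral>\<^sup>+z. g z \<partial>moment_measure M \<Psi> k)"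
    using cong sets_eq_imp_space_eq[OF sets_moment_measure[of M \<Psi> k]] by (intro nn_integral_cong) auto
  ultimately show ?case using cong
    by (auto cong: measurable_cong nn_integral_cong)
next
  case (set A)
  have A: "A \<in> sets (\<Pi>\<^sub>M j\<in>{..<k}. \<Psi> \<omega>)" if "\<omega> \<in> space M" for \<omega>
    using set sets_PiM_lf[OF \<Psi>_lf[OF that]] by simp
  have "(\<lambda>\<omega>. emeasure (\<Pi>\<^sub>M j\<in>{..<k}. \<Psi> \<omega>) A) \<in> borel_measurable M"
    by (rule measurable_compose[OF \<Psi> measurable_emeasure_lf_product[OF set]])
  then show ?case
    using emeasure_moment_measure[OF rm set] A set by (auto cong: measurable_cong nn_integral_cong)
next
  case (mult u c)
  have u: "u \<in> borel_measurable (\<Pi>\<^sub>M j\<in>{..<k}. \<Psi> \<omega>)" if "\<omega> \<in> space M" for \<omega>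
    using mult(2) by (subst measurable_cong_sets[OF sets_PiM_lf[OF \<Psi>_lf[OF that]] refl])
  have "u \<in> borel_measurable (moment_measure M \<Psi> k)"
    using mult(2) by (subst measurable_cong_sets[OF sets_moment_measure refl])
  then have 1: "(\<integral>\<^sup>+z. c * u z \<partial>moment_measure M \<Psi> k) = c * (\<integral>\<^sup>+z. u z \<partial>moment_measure M \<Psi> k)"
    by (rule nn_integral_cmult)
  have 2: "(\<integral>\<^sup>+z. c * u z \<partial>(\<Pi>\<^sub>M j\<in>{..<k}. \<Psi> \<omega>)) = c * (\<integral>\<^sup>+z. u z \<partial>(\<Pi>\<^sub>M j\<in>{..<k}. \<Psi> \<omega>))"
    if "\<omega> \<in> space M" for \<omega> by (rule nn_integral_cmult[OF u[OF that]])
  have m: "(\<lambda>\<omega>. \<integral>\<^sup>+z. u z \<partial>(\<Pi>\<^sub>M j\<in>{..<k}. \<Psi> \<omega>)) \<in> borel_measurable M" using mult by blast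
  have "(\<lambda>\<omega>. \<integral>\<^sup>+z. c * u z \<partial>(\<Pi>\<^sub>M j\<in>{..<k}. \<Psi> \<omega>)) \<in> borel_measurable M"
    by (subst measurable_cong[OF 2]) (use m in auto)
  moreover have "(\<integral>\<^sup>+\<omega>. \<integral>\<^sup>+z. c * u z \<partial>(\<Pi>\<^sub>M j\<in>{..<k}. \<Psi> \<omega>) \<partial>M) =
      c * (\<integral>\<^sup>+\<omega>. \<integral>\<^sup>+z. u z \<partial>(\<Pi>\<^sub>M j\<in>{..<k}. \<Psi> \<omega>) \<partial>M)"
    unfolding nn_integral_cmult[OF m, symmetric] by (rule nn_integral_cong[OF 2])
  ultimately show ?case using 1 mult by simp
next
  case (add u v)
  have u: "u \<in> borel_measurable (\<Pi>\<^sub>M j\<in>{..<k}. \<Psi> \<omega>)" "v \<in> borel_measurable (\<Pi>\<^sub>M j\<in>{..<k}. \<Psi> \<omega>)"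
    if "\<omega> \<in> space M" for \<omega>
    using add by (auto simp: measurable_cong_sets[OF sets_PiM_lf[OF \<Psi>_lf[OF that]] refl])
  have "u \<in> borel_measurable (moment_measure M \<Psi> k)" "v \<in> borel_measurable (moment_measure M \<Psi> k)"
    using add by (auto simp: measurable_cong_sets[OF sets_moment_measure refl])
  then have 1: "(\<integral>\<^sup>+z. u z + v z \<partial>moment_measure M \<Psi> k) =
      (\<integral>\<^sup>+z. u z \<partial>moment_measure M \<Psi> k) + (\<integral>\<^sup>+z. v z \<partial>moment_measure M \<Psi> k)"
    by (rule nn_integral_add)
  have 2: "(\<integral>\<^sup>+z. u z + v z \<partial>(\<Pi>\<^sub>M j\<in>{..<k}. \<Psi> \<omega>)) =
      (\<integral>\<^sup>+z. u z \<partial>(\<Pi>\<^sub>M j\<in>{..<k}. \<Psi> \<omega>)) + (\<integral>\<^sup>+z. v z \<partial>(\<Pi>\<^sub>M j\<in>{..<k}. \<Psi> \<omega>))"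
    if "\<omega> \<in> space M" for \<omega> by (rule nn_integral_add[OF u[OF that]])
  have m: "(\<lambda>\<omega>. \<integral>\<^sup>+z. u z \<partial>(\<Pi>\<^sub>M j\<in>{..<k}. \<Psi> \<omega>)) \<in> borel_measurable M"
    "(\<lambda>\<omega>. \<integral>\<^sup>+z. v z \<partial>(\<Pi>\<^sub>M j\<in>{..<k}. \<Psi> \<omega>)) \<in> borel_measurable M" using add by blast+
  have "(\<lambda>\<omega>. \<integral>\<^sup>+z. u z + v z \<partial>(\<Pi>\<^sub>M j\<in>{..<k}. \<Psi> \<omega>)) \<in> borel_measurable M"
    by (subst measurable_cong[OF 2]) (use m in auto)
  moreover have "(\<integral>\<^sup>+\<omega>. \<integral>\<^sup>+z. u z + v z \<partial>(\<Pi>\<^sub>M j\<in>{..<k}. \<Psi> \<omega>) \<partial>M) =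
      (\<integral>\<^sup>+\<omega>. \<integral>\<^sup>+z. u z \<partial>(\<Pi>\<^sub>M j\<in>{..<k}. \<Psi> \<omega>) \<partial>M) + (\<integral>\<^sup>+\<omega>. \<integral>\<^sup>+z. v z \<partial>(\<Pi>\<^sub>M j\<in>{..<k}. \<Psi> \<omega>) \<partial>M)"
    unfolding nn_integral_add[OF m, symmetric] by (rule nn_integral_cong[OF 2])
  ultimately show ?case using 1 add by (simp add: add.commute)
next
  case (seq U)
  have U: "U i \<in> borel_measurable (\<Pi>\<^sub>M j\<in>{..<k}. \<Psi> \<omega>)" if "\<omega> \<in> space M" for \<omega> i
    using seq by (auto simp: measurable_cong_sets[OF sets_PiM_lf[OF \<Psi>_lf[OF that]] refl])
  have Um: "U i \<in> borel_measurable (moment_measure M \<Psi> k)" for i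
    using seq by (auto simp: measurable_cong_sets[OF sets_moment_measure refl])
  have S: "(SUP i. U i) = (\<lambda>x. SUP i. U i x)" by (intro ext SUP_apply)
  have eq: "(\<integral>\<^sup>+z. (SUP i. U i z) \<partial>(\<Pi>\<^sub>M j\<in>{..<k}. \<Psi> \<omega>)) = (SUP i. \<integral>\<^sup>+z. U i z \<partial>(\<Pi>\<^sub>M j\<in>{..<k}. \<Psi> \<omega>))"
    if "\<omega> \<in> space M" for \<omega>
    using U[OF that] seq by (intro nn_integral_monotone_convergence_SUP) auto
  have m: "(\<lambda>\<omega>. \<integral>\<^sup>+z. U i z \<partial>(\<Pi>\<^sub>M j\<in>{..<k}. \<Psi> \<omega>)) \<in> borel_measurable M" for i using seq by blast
  have "(\<integral>\<^sup>+z. (SUP i. U i z) \<partial>moment_measure M \<Psi> k) = (SUP i. \<integral>\<^sup>+z. U i z \<partial>moment_measure M \<Psi> k)"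
    using Um seq by (intro nn_integral_monotone_convergence_SUP) auto
  also have "\<dots> = (SUP i. \<integral>\<^sup>+\<omega>. \<integral>\<^sup>+z. U i z \<partial>(\<Pi>\<^sub>M j\<in>{..<k}. \<Psi> \<omega>) \<partial>M)" using seq by simp
  also have "\<dots> = (\<integral>\<^sup>+\<omega>. (SUP i. \<integral>\<^sup>+z. U i z \<partial>(\<Pi>\<^sub>M j\<in>{..<k}. \<Psi> \<omega>)) \<partial>M)"
    using \<open>incseq U\<close> by (intro nn_integral_monotone_convergence_SUP[symmetric] m)
      (auto simp: incseq_def le_fun_def intro!: nn_integral_mono)
  also have "\<dots> = (\<integral>\<^sup>+\<omega>. \<integral>\<^sup>+z. (SUP i. U i z) \<partial>(\<Pi>\<^sub>M j\<in>{..<k}. \<Psi> \<omega>) \<partial>M)"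
    by (intro nn_integral_cong eq[symmetric])
  finally have "(\<integral>\<^sup>+z. (SUP i. U i z) \<partial>moment_measure M \<Psi> k) =
    (\<integral>\<^sup>+\<omega>. \<integral>\<^sup>+z. (SUP i. U i z) \<partial>(\<Pi>\<^sub>M j\<in>{..<k}. \<Psi> \<omega>) \<partial>M)" .
  moreover have "(\<lambda>\<omega>. \<integral>\<^sup>+z. (SUP i. U i z) \<partial>(\<Pi>\<^sub>M j\<in>{..<k}. \<Psi> \<omega>)) \<in> borel_measurable M"
    by (subst measurable_cong[OF eq]) (auto intro: borel_measurable_SUP m)
  ultimately show ?case unfolding S by blast
qed

text \<open>
  Coverage functions are given through rectangles. The moment measure restricted to tuples with given
  labels and the image of the density under labelling agree on rectangles, hence everywhere.
\<close>

lemma nn_integral_moment_measure_labels: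
  assumes k: "1 \<le> k" and F: "F \<in> borel_measurable (PiS k)"
  shows "(\<integral>\<^sup>+z. F z * (\<Prod>j<k. indicator {i j} (snd (z j))) \<partial>moment_measure M \<Psi> k) =
    (\<integral>\<^sup>+x. F (\<lambda>j\<in>{..<k}. (x j, i j)) * ennreal (p (tuple k x i)) \<partial>PiL k)"
proof -
  define T :: "(nat \<Rightarrow> 'a) \<Rightarrow> nat \<Rightarrow> 'a \<times> 2" where "T x = (\<lambda>j\<in>{..<k}. (x j, i j))" for x
  define lab :: "(nat \<Rightarrow> 'a \<times> 2) \<Rightarrow> ennreal" where "lab z = (\<Prod>j<k. indicator {i j} (snd (z j)))" for z
  note [measurable] = measurable_p[OF k, of i] F
  have T [measurable]: "T \<in> PiL k \<rightarrow>\<^sub>M PiS k"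
    unfolding T_def marked_space_def by measurable
  have lab [measurable]: "lab \<in> borel_measurable (PiS k)"
    unfolding lab_def by measurable
  have lab': "lab \<in> borel_measurable (moment_measure M \<Psi> k)" by (simp add: measurable_cong_sets[OF sets_moment_measure refl])
  have F': "F \<in> borel_measurable (moment_measure M \<Psi> k)" by (simp add: measurable_cong_sets[OF sets_moment_measure refl])
  define D where "D = density (PiL k) (\<lambda>x. ennreal (p (tuple k x i)))"
  have TD: "T \<in> D \<rightarrow>\<^sub>M PiS k" unfolding D_def by simp
  have "density (moment_measure M \<Psi> k) lab = distr D (PiS k) T"
  proof (rule measure_eqI_PiM_finite)
    fix A :: "nat \<Rightarrow> ('a \<times> 2) set"
    assume "\<And>j. j \<in> {..<k} \<Longrightarrow> A j \<in> sets marked_space"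
    then have A: "\<And>j. j < k \<Longrightarrow> A j \<in> sets marked_space" by simp
    then have PA: "(\<Pi>\<^sub>E j\<in>{..<k}. A j) \<in> sets (PiS k)" by (intro sets_PiM_I_finite) auto
    \<comment> \<open>on tuples with the given labels a rectangle reduces to the sections of its sides\<close>
    define B where "B j = {x. (x, i j) \<in> A j}" for j
    have B: "B j \<in> sets borel" if "j < k" for j
    proof -
      have "(\<lambda>x. (x, i j)) \<in> borel \<rightarrow>\<^sub>M marked_space" unfolding marked_space_def by simp
      from measurable_sets[OF this A[OF that]] show ?thesis by (simp add: B_def vimage_def)
    qed
    have PB: "(\<Pi>\<^sub>E j\<in>{..<k}. B j) \<in> sets (PiL k)" using B by (intro sets_PiM_I_finite) auto
    have "emeasure (density (moment_measure M \<Psi> k) lab) (\<Pi>\<^sub>E j\<in>{..<k}. A j) =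
        (\<integral>\<^sup>+z. indicator (\<Pi>\<^sub>E j\<in>{..<k}. B j \<times> {i j}) z \<partial>moment_measure M \<Psi> k)"
      using PA
    proof (subst emeasure_density[OF lab'], simp, intro nn_integral_cong)
      fix z assume "z \<in> space (moment_measure M \<Psi> k)"
      then have z: "z \<in> extensional {..<k}"
        using sets_eq_imp_space_eq[OF sets_moment_measure[of M \<Psi> k]] by (simp add: space_PiM PiE_def)
      show "lab z * indicator (\<Pi>\<^sub>E j\<in>{..<k}. A j) z = indicator (\<Pi>\<^sub>E j\<in>{..<k}. B j \<times> {i j}) z"
      proof (cases "\<forall>j<k. snd (z j) = i j")
        case True
        then have "lab z = 1" unfolding lab_def by (intro prod.neutral) auto
        moreover have "z j \<in> A j \<longleftrightarrow> z j \<in> B j \<times> {i j}" if "j < k" for j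
          using True that by (cases "z j") (auto simp: B_def)
        ultimately show ?thesis using z by (auto simp: PiE_iff split: split_indicator)
      next
        case False
        then obtain j where j: "j < k" "snd (z j) \<noteq> i j" by blast
        then have "lab z = 0" unfolding lab_def by (intro prod_zero bexI[of _ j]) auto
        moreover have "z \<notin> (\<Pi>\<^sub>E j\<in>{..<k}. B j \<times> {i j})"
          using j by (auto simp: PiE_iff mem_Times_iff)
        ultimately show ?thesis by simp
      qed
    qed
    also have "\<dots> = emeasure (moment_measure M \<Psi> k) (\<Pi>\<^sub>E j\<in>{..<k}. B j \<times> {i j})"
      using B by (intro nn_integral_indicator) (auto intro!: sets_PiM_I_finite Times_in_marked_space)
    also have "\<dots> = (\<integral>\<^sup>+x\<in>(\<Pi>\<^sub>E j\<in>{..<k}. B j). ennreal (p (tuple k x i)) \<partial>PiL k)"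
      using coverage[OF k] B by (simp add: coverage_function_def)
    also have "\<dots> = emeasure D (\<Pi>\<^sub>E j\<in>{..<k}. B j)"
      unfolding D_def
      by (rule emeasure_density[OF _ PB, symmetric]) simp
    also have "(\<Pi>\<^sub>E j\<in>{..<k}. B j) = T -` (\<Pi>\<^sub>E j\<in>{..<k}. A j) \<inter> space D"
    proof (rule set_eqI)
      fix x
      have "T x \<in> (\<Pi>\<^sub>E j\<in>{..<k}. A j) \<longleftrightarrow> (\<forall>j<k. x j \<in> B j)"
        by (simp add: T_def B_def PiE_iff Ball_def)
      then show "x \<in> (\<Pi>\<^sub>E j\<in>{..<k}. B j) \<longleftrightarrow> x \<in> T -` (\<Pi>\<^sub>E j\<in>{..<k}. A j) \<inter> space D"
        by (simp add: D_def space_PiM PiE_iff Ball_def)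
    qed
    also have "emeasure D \<dots> = emeasure (distr D (PiS k) T) (\<Pi>\<^sub>E j\<in>{..<k}. A j)"
      by (rule emeasure_distr[OF TD PA, symmetric])
    finally show "emeasure (density (moment_measure M \<Psi> k) lab) (\<Pi>\<^sub>E j\<in>{..<k}. A j) =
      emeasure (distr D (PiS k) T) (\<Pi>\<^sub>E j\<in>{..<k}. A j)" .
  next
    let ?A = "\<lambda>n. \<Pi>\<^sub>E j\<in>{..<k}. (box n :: ('a \<times> 2) set)"
    show "range ?A \<subseteq> prod_algebra {..<k} (\<lambda>_. marked_space)"
      by (auto intro!: prod_algebraI_finite)
    have "\<exists>n. z \<in> ?A n" if z: "z \<in> extensional {..<k}" for z :: "nat \<Rightarrow> 'a \<times> 2"
    proof -
      obtain n :: nat where n: "(\<Sum>j<k. norm (fst (z j))) \<le> real n" using real_arch_simple by blast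
      have "norm (fst (z j)) \<le> real n" if "j < k" for j
        using that n member_le_sum[of j "{..<k}" "\<lambda>j. norm (fst (z j))"] by auto
      then show ?thesis using z by (intro exI[of _ n]) (auto simp: box_def PiE_iff mem_Times_iff)
    qed
    then show "(\<Union>n. ?A n) = space (PiS k)" by (auto simp: space_PiM PiE_iff)
    fix n
    have "emeasure (density (moment_measure M \<Psi> k) lab) (?A n) \<le> emeasure (moment_measure M \<Psi> k) (?A n)"
    proof -
      have "lab z \<le> 1" for z unfolding lab_def by (intro prod_le_1) (auto split: split_indicator)
      moreover have "?A n \<in> sets (moment_measure M \<Psi> k)" by (auto intro!: sets_PiM_I_finite)
      ultimately show ?thesis
        by (subst emeasure_density[OF lab'])
          (auto simp flip: nn_integral_indicator intro!: nn_integral_mono split: split_indicator)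
    qed
    also have "\<dots> < \<infinity>"
      using locally_finite[OF k] unfolding locally_finite_moments_def box_def by auto
    finally show "emeasure (density (moment_measure M \<Psi> k) lab) (?A n) \<noteq> \<infinity>" by simp
  qed (auto simp: D_def)
  then have "(\<integral>\<^sup>+z. F z \<partial>density (moment_measure M \<Psi> k) lab) = (\<integral>\<^sup>+z. F z \<partial>distr D (PiS k) T)" by simp
  also have "\<dots> = (\<integral>\<^sup>+x. F (T x) \<partial>D)" by (rule nn_integral_distr[OF TD]) simp
  also have "\<dots> = (\<integral>\<^sup>+x. ennreal (p (tuple k x i)) * F (T x) \<partial>PiL k)"
    unfolding D_def by (rule nn_integral_density) simp_all
  also have "(\<integral>\<^sup>+z. F z \<partial>density (moment_measure M \<Psi> k) lab) = (\<integral>\<^sup>+z. lab z * F z \<partial>moment_measure M \<Psi> k)"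
    by (rule nn_integral_density[OF lab' F'])
  finally show ?thesis by (simp only: T_def lab_def mult.commute)
qed

lemma reduced_density_tuple:
  assumes "1 \<le> k" shows "\<rho> (tuple k x i) = p (tuple k x i) / (\<Prod>j<k. p [(x j, i j)])"
proof -
  have "tuple k x i \<noteq> []" using assms by (simp add: tuple_def)
  then show ?thesis using prod.distinct_set_conv_list[of "[0..<k]" "\<lambda>j. p [(x j, i j)]"]
    by (simp add: reduced_density_def tuple_def comp_def atLeast0LessThan)
qed

lemma reduced_density_nonneg: "0 \<le> \<rho> zs"
proof -
  have "0 \<le> (\<Prod>z\<leftarrow>zs. p [z])" by (rule prod_list_nonneg) (auto intro: less_imp_le p_pos)
  then show ?thesis by (simp add: reduced_density_def p_nonneg)
qed

text \<open>
  Weighting each of the \<open>k\<close> points by \<open>1 / p\<^sub>1\<close> replaces the coverage function by the reduced density.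
  Moments of \<open>\<Phi>\<close> are computed with this formula.
\<close>

lemma expectation_reduced:
  assumes k: "1 \<le> k" and F: "F \<in> borel_measurable (PiS k)"
  shows "(\<integral>\<^sup>+\<omega>. \<integral>\<^sup>+z. F z * (\<Prod>j<k. indicator {i j} (snd (z j)) * ennreal (1 / p [z j]))
      \<partial>(\<Pi>\<^sub>M j\<in>{..<k}. \<Psi> \<omega>) \<partial>M) =
    (\<integral>\<^sup>+x. F (\<lambda>j\<in>{..<k}. (x j, i j)) * ennreal (\<rho> (tuple k x i)) \<partial>PiL k)"
proof -
  let ?w = "\<lambda>z. \<Prod>j<k. ennreal (1 / p [z j])"
  note [measurable] = F
  have [measurable]: "(\<lambda>z. p [z j]) \<in> borel_measurable (PiS k)"
    "(\<lambda>z. snd (z j)) \<in> PiS k \<rightarrow>\<^sub>M count_space UNIV" if "j \<in> {..<k}" for j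
    using measurable_compose[OF measurable_component_singleton[OF that, of "\<lambda>_. marked_space"] measurable_p_single]
      measurable_compose[OF measurable_component_singleton[OF that, of "\<lambda>_. marked_space"] measurable_snd_marked]
    by simp_all
  have m: "(\<lambda>z. F z * ?w z) \<in> borel_measurable (PiS k)" by measurable
  have "(\<integral>\<^sup>+\<omega>. \<integral>\<^sup>+z. F z * (\<Prod>j<k. indicator {i j} (snd (z j)) * ennreal (1 / p [z j]))
      \<partial>(\<Pi>\<^sub>M j\<in>{..<k}. \<Psi> \<omega>) \<partial>M) =
    (\<integral>\<^sup>+z. F z * (\<Prod>j<k. indicator {i j} (snd (z j)) * ennreal (1 / p [z j])) \<partial>moment_measure M \<Psi> k)"
    by (rule nn_integral_moment_measure[THEN conjunct2, symmetric]) measurable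
  also have "\<dots> = (\<integral>\<^sup>+z. (F z * ?w z) * (\<Prod>j<k. indicator {i j} (snd (z j))) \<partial>moment_measure M \<Psi> k)"
    by (simp add: prod.distrib ac_simps)
  also have "\<dots> = (\<integral>\<^sup>+x. (F (\<lambda>j\<in>{..<k}. (x j, i j)) * ?w (\<lambda>j\<in>{..<k}. (x j, i j))) * ennreal (p (tuple k x i)) \<partial>PiL k)"
    by (rule nn_integral_moment_measure_labels[OF k m])
  also have "\<dots> = (\<integral>\<^sup>+x. F (\<lambda>j\<in>{..<k}. (x j, i j)) * ennreal (\<rho> (tuple k x i)) \<partial>PiL k)"
  proof (rule nn_integral_cong)
    fix x :: "nat \<Rightarrow> 'a"
    have "tuple k x i \<noteq> []" using k by (simp add: tuple_def)
    then have "ennreal (\<rho> (tuple k x i)) = ?w (\<lambda>j\<in>{..<k}. (x j, i j)) * ennreal (p (tuple k x i))"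
      using p_pos p_nonneg[of "tuple k x i"]
      by (simp add: reduced_density_tuple[OF k] prod_ennreal prod_nonneg less_imp_le prod_dividef flip: ennreal_mult)
    then show "(F (\<lambda>j\<in>{..<k}. (x j, i j)) * ?w (\<lambda>j\<in>{..<k}. (x j, i j))) * ennreal (p (tuple k x i)) =
        F (\<lambda>j\<in>{..<k}. (x j, i j)) * ennreal (\<rho> (tuple k x i))" by (simp add: mult.assoc)
  qed
  finally show ?thesis .
qed

text \<open>
  The moment measures are locally finite and \<open>p\<^sub>1\<close> is bounded away from zero.
\<close>

lemma reduced_density_locally_finite:
  assumes k: "1 \<le> k"
  shows "(\<integral>\<^sup>+x. indicator (\<Pi>\<^sub>E j\<in>{..<k}. cball 0 R) x * ennreal (\<rho> (tuple k x i)) \<partial>PiL k) < \<infinity>"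
proof -
  obtain c where c: "0 < c" "\<And>z. c \<le> p [z]" using p_lower_bound by blast
  let ?B = "\<Pi>\<^sub>E j\<in>{..<k}. cball (0::'a) R"
  have B: "?B \<in> sets (PiL k)" by (intro sets_PiM_I_finite) auto
  have le: "\<rho> (tuple k x i) \<le> (1 / c ^ k) * p (tuple k x i)" for x
  proof -
    have "c ^ k \<le> (\<Prod>j<k. p [(x j, i j)])"
      using prod_mono[of "{..<k}" "\<lambda>_. c" "\<lambda>j. p [(x j, i j)]"] c by (simp add: less_imp_le)
    then have "p (tuple k x i) / (\<Prod>j<k. p [(x j, i j)]) \<le> p (tuple k x i) / c ^ k"
      using c(1) k by (intro divide_left_mono p_nonneg mult_pos_pos prod_pos) (auto simp: p_pos tuple_def)
    then show ?thesis by (simp add: reduced_density_tuple[OF k])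
  qed
  have "(\<integral>\<^sup>+x. indicator ?B x * ennreal (\<rho> (tuple k x i)) \<partial>PiL k) \<le>
      (\<integral>\<^sup>+x. ennreal (1 / c ^ k) * (ennreal (p (tuple k x i)) * indicator ?B x) \<partial>PiL k)"
    using c(1) le by (intro nn_integral_mono) (auto split: split_indicator simp flip: ennreal_mult' intro!: ennreal_leI)
  also have "\<dots> = ennreal (1 / c ^ k) * (\<integral>\<^sup>+x\<in>?B. ennreal (p (tuple k x i)) \<partial>PiL k)"
    using B measurable_p[OF k] by (intro nn_integral_cmult) auto
  also have "(\<integral>\<^sup>+x\<in>?B. ennreal (p (tuple k x i)) \<partial>PiL k) = emeasure (moment_measure M \<Psi> k) (\<Pi>\<^sub>E j\<in>{..<k}. cball 0 R \<times> {i j})"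
    using coverage[OF k] by (simp add: coverage_function_def)
  also have "ennreal (1 / c ^ k) * \<dots> \<le> ennreal (1 / c ^ k) * emeasure (moment_measure M \<Psi> k) (\<Pi>\<^sub>E j\<in>{..<k}. cball 0 R \<times> UNIV)"
    by (intro mult_left_mono emeasure_mono PiE_mono) (auto intro!: sets_PiM_I_finite Times_in_marked_space)
  also have "\<dots> < \<infinity>"
    using locally_finite[OF k] by (auto simp: locally_finite_moments_def ennreal_mult_less_top)
  finally show ?thesis .
qed

lemma measurable_reduced_density: "(\<lambda>x. \<rho> (tuple k x i)) \<in> borel_measurable (PiL k)"
proof (cases "1 \<le> k")
  case True
  have "(\<lambda>x. p [(x j, i j)]) \<in> borel_measurable (PiL k)" if "j \<in> {..<k}" for j
    using measurable_compose[OF measurable_component_singleton[OF that, of "\<lambda>_. lborel"], of "\<lambda>x. p [(x, i j)]" borel]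
      measurable_p_pair by simp
  then show ?thesis unfolding reduced_density_tuple[OF True]
    by (intro borel_measurable_divide measurable_p[OF True] borel_measurable_prod)
qed (simp add: tuple_def)

lemma measurable_cumulant: "(\<lambda>x. cumulant p (tuple k x i)) \<in> borel_measurable (PiL k)"
proof (induction k arbitrary: i rule: less_induct)
  case (less k)
  show ?case
  proof (cases "k \<le> 1")
    case False
    let ?S = "{P. partition_on {..<k} P} - {{{..<k}}}"
    have eq: "cumulant p (tuple k x i) = \<rho> (tuple k x i) - (\<Sum>P\<in>?S. \<Prod>D\<in>P. cumulant p (nths (tuple k x i) D))" for x
    proof -
      have "tuple k x i \<noteq> []" using False length_tuple[of k x i] by (metis list.size(3) le0)
      then show ?thesis using False
        by (subst cumulant.simps) (simp only: length_tuple if_False reduced_density_def)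
    qed
    have "(\<lambda>x. cumulant p (nths (tuple k x i) D)) \<in> borel_measurable (PiL k)" if P: "P \<in> ?S" and D: "D \<in> P" for P D
    proof -
      have "D \<subseteq> {..<k}" "D \<noteq> {..<k}"
        using P D partition_onD1[of "{..<k}" P] partition_block_neq[of "{..<k}" P D] by auto
      then have "D \<inter> {..<k} \<subset> {..<k}" by auto
      then have "length (positions k D) < k" using psubset_card_mono[of "{..<k}" "D \<inter> {..<k}"] by (simp add: positions)
      moreover have "pick (positions k D) \<in> PiL k \<rightarrow>\<^sub>M PiL (length (positions k D))"
        by (rule measurable_pick) (simp add: positions)
      ultimately show ?thesis unfolding nths_tuple by (intro measurable_compose[OF _ less.IH])
    qed
    then show ?thesis unfolding eq
      by (intro borel_measurable_diff measurable_reduced_density borel_measurable_sum borel_measurable_prod)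
  qed (simp add: cumulant.simps)
qed

lemma cumulant_singleton [simp]: "cumulant p [z] = 1"
  by (simp add: cumulant.simps)

lemma cumulant_shift:
  "1 \<le> k \<Longrightarrow> AE x in PiL k. cumulant p (tuple k (\<lambda>j. x j + a) i) = cumulant p (tuple k x i)"
  using st by (auto simp: crm_stationary_def)

text \<open>
  Each cumulant density in the partition sum is translation invariant, up to a null set of subtuples. There
  are finitely many of them.
\<close>

lemma reduced_density_shift:
  "AE x in PiL k. \<rho> (tuple k (\<lambda>j. x j + a) i) = \<rho> (tuple k x i)"
proof -
  have "AE x in PiL k. \<forall>D\<in>Pow {..<k} - {{}}. cumulant p (nths (tuple k (\<lambda>j. x j + a) i) D) = cumulant p (nths (tuple k x i) D)"
  proof (rule AE_finite_allI)
    fix D assume D: "D \<in> Pow {..<k} - {{}}"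
    let ?js = "positions k D"
    have "D \<inter> {..<k} \<noteq> {}" using D by auto
    then have "1 \<le> length ?js" by (simp add: positions Suc_le_eq card_gt_0_iff)
    from cumulant_shift[OF this, of a "\<lambda>j. i (?js ! j)"]
    have "AE x in PiL k. cumulant p (tuple (length ?js) (\<lambda>j. pick ?js x j + a) (\<lambda>j. i (?js ! j))) =
        cumulant p (tuple (length ?js) (pick ?js x) (\<lambda>j. i (?js ! j)))"
      by (intro AE_pick sigma_finite_lborel) (auto simp: positions)
    then show "AE x in PiL k. cumulant p (nths (tuple k (\<lambda>j. x j + a) i) D) = cumulant p (nths (tuple k x i) D)"
      unfolding nths_tuple_map[where h = "\<lambda>y. y + a"] nths_tuple[of k _ i] .
  qed simp
  then show ?thesis
  proof eventually_elim
    case (elim x)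
    have "\<rho> (tuple k y i) = (\<Sum>P | partition_on {..<k} P. \<Prod>D\<in>P. cumulant p (nths (tuple k y i) D))" for y
      using reduced_density_nths[of p "{..<k}" "tuple k y i"] p_pos by (simp add: nths_all)
    moreover have "(\<Prod>D\<in>P. cumulant p (nths (tuple k (\<lambda>j. x j + a) i) D)) = (\<Prod>D\<in>P. cumulant p (nths (tuple k x i) D))"
      if "partition_on {..<k} P" for P
      using elim partition_onD1[OF that] partition_onD3[OF that] by (intro prod.cong) auto
    ultimately show ?case by simp
  qed
qed

text \<open>
  The cumulant density seen from a suitable point \<open>b\<close> serves as the version at the origin. The
  choice of \<open>b\<close> depends on the number and the labels of the other points, which can be read off the list.
\<close>

lemma cumulant_at_origin_spec:
  assumes "1 \<le> k"
  shows "(\<lambda>x. cumulant_at_origin p i (tuple k x l)) \<in> borel_measurable (PiL k)"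
    and "AE (a, x) in lborel \<Otimes>\<^sub>M PiL k.
      cumulant_at_origin p i (tuple k x l) = cumulant p ((a, i) # tuple k (\<lambda>j. a + x j) l)"
proof -
  let ?Q = "\<lambda>\<eta>. \<forall>k\<ge>1. \<forall>l. (\<lambda>x. \<eta> (tuple k x l)) \<in> borel_measurable (PiL k) \<and>
     (AE (a, x) in lborel \<Otimes>\<^sub>M PiL k. \<eta> (tuple k x l) = cumulant p ((a, i) # tuple k (\<lambda>j. a + x j) l))"
  have "\<exists>b. AE (a, x) in lborel \<Otimes>\<^sub>M PiL (length ls).
      cumulant p ((b, i) # tuple (length ls) (\<lambda>j. b + x j) ((!) ls)) =
      cumulant p ((a, i) # tuple (length ls) (\<lambda>j. a + x j) ((!) ls))" for ls
  proof -
    let ?n = "length ls"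
    have "\<exists>b. AE (a, x) in lborel \<Otimes>\<^sub>M PiL ?n.
      cumulant p (tuple (Suc ?n) (glue ?n b (\<lambda>j. b + x j)) (case_nat i ((!) ls))) =
      cumulant p (tuple (Suc ?n) (glue ?n a (\<lambda>j. a + x j)) (case_nat i ((!) ls)))"
    proof (rule translation_invariant_version[OF measurable_cumulant])
      fix b :: 'a
      have "tuple (Suc ?n) (\<lambda>j\<in>{..<Suc ?n}. z j + b) (case_nat i ((!) ls)) =
          tuple (Suc ?n) (\<lambda>j. z j + b) (case_nat i ((!) ls))" for z :: "nat \<Rightarrow> 'a"
        by (rule tuple_cong) auto
      then show "AE z in PiL (Suc ?n). cumulant p (tuple (Suc ?n) (\<lambda>j\<in>{..<Suc ?n}. z j + b) (case_nat i ((!) ls))) =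
          cumulant p (tuple (Suc ?n) z (case_nat i ((!) ls)))"
        using cumulant_shift[of "Suc ?n" b "case_nat i ((!) ls)"] by simp
    qed
    then show ?thesis unfolding tuple_glue .
  qed
  note ex = this
  define b where "b ls = (SOME b. AE (a, x) in lborel \<Otimes>\<^sub>M PiL (length ls).
      cumulant p ((b, i) # tuple (length ls) (\<lambda>j. b + x j) ((!) ls)) =
      cumulant p ((a, i) # tuple (length ls) (\<lambda>j. a + x j) ((!) ls)))" for ls
  have b: "AE (a, x) in lborel \<Otimes>\<^sub>M PiL (length ls).
      cumulant p ((b ls, i) # tuple (length ls) (\<lambda>j. b ls + x j) ((!) ls)) =
      cumulant p ((a, i) # tuple (length ls) (\<lambda>j. a + x j) ((!) ls))" for ls
    unfolding b_def by (rule someI_ex[OF ex])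
  \<comment> \<open>one function for all lengths and labels, as the definition of the version at the origin demands\<close>
  define \<eta> where "\<eta> zs = cumulant p ((b (map snd zs), i) #
      tuple (length zs) (\<lambda>j. b (map snd zs) + fst (zs ! j)) ((!) (map snd zs)))" for zs
  have "?Q \<eta>"
  proof (intro allI impI)
    fix k :: nat and l :: "nat \<Rightarrow> 2" assume "1 \<le> k"
    let ?ls = "map l [0..<k]"
    have sn: "map snd (tuple k x l) = ?ls" for x by (simp add: tuple_def)
    have len: "length ?ls = k" by simp
    have tl: "tuple k y ((!) ?ls) = tuple k y l" for y by (rule tuple_cong) auto
    have "tuple k (\<lambda>j. b ?ls + fst (tuple k x l ! j)) ((!) ?ls) = tuple k (\<lambda>j. b ?ls + x j) l" for x
      by (rule tuple_cong) (auto simp: tuple_def)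
    then have \<eta>: "\<eta> (tuple k x l) = cumulant p ((b ?ls, i) # tuple k (\<lambda>j. b ?ls + x j) l)" for x
      unfolding \<eta>_def sn by simp
    have "(\<lambda>x. glue k (b ?ls) (\<lambda>j. b ?ls + x j)) \<in> PiL k \<rightarrow>\<^sub>M PiL (Suc k)"
      by (rule measurable_glue) auto
    from measurable_compose[OF this measurable_cumulant[of "Suc k" "case_nat i l"]]
    have "(\<lambda>x. \<eta> (tuple k x l)) \<in> borel_measurable (PiL k)" unfolding \<eta> tuple_glue .
    moreover have "AE (a, x) in lborel \<Otimes>\<^sub>M PiL k. \<eta> (tuple k x l) = cumulant p ((a, i) # tuple k (\<lambda>j. a + x j) l)"
      unfolding \<eta> using b[of ?ls, unfolded len tl] .
    ultimately show "(\<lambda>x. \<eta> (tuple k x l)) \<in> borel_measurable (PiL k) \<and>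
     (AE (a, x) in lborel \<Otimes>\<^sub>M PiL k. \<eta> (tuple k x l) = cumulant p ((a, i) # tuple k (\<lambda>j. a + x j) l))" by blast
  qed
  then have "?Q (cumulant_at_origin p i)" unfolding cumulant_at_origin_def by (rule someI[where P = ?Q])
  with assms show "(\<lambda>x. cumulant_at_origin p i (tuple k x l)) \<in> borel_measurable (PiL k)"
    "AE (a, x) in lborel \<Otimes>\<^sub>M PiL k.
      cumulant_at_origin p i (tuple k x l) = cumulant p ((a, i) # tuple k (\<lambda>j. a + x j) l)"
    by blast+
qed

end

section \<open>Integrals over products of balls\<close>

locale crm_ball = crm_measure M \<Psi> p
  for M :: "'w measure" and \<Psi> :: "'w \<Rightarrow> ('a::euclidean_space \<times> 2) measure"
    and p :: "('a \<times> 2) list \<Rightarrow> real" +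
  fixes t :: real
  assumes t: "0 \<le> t"
begin

definition ball_ind :: "nat \<Rightarrow> (nat \<Rightarrow> 'a) \<Rightarrow> real" where
  "ball_ind k x = indicator (\<Pi>\<^sub>E j\<in>{..<k}. cball 0 t) x"

definition reduced2 :: "nat \<Rightarrow> (nat \<Rightarrow> 'a) \<Rightarrow> real" where
  "reduced2 k x = \<rho> (tuple k x (\<lambda>_. 2))"

text \<open>
  The density \<open>\<xi>\<^bsub>k+1\<^esub>\<close> with first point \<open>(0, 1)\<close> and all other labels equal to 2, including
  \<open>\<xi>\<^sub>1 = 1\<close>.
\<close>

definition cumulant12 :: "nat \<Rightarrow> (nat \<Rightarrow> 'a) \<Rightarrow> real" where
  "cumulant12 k x = (if k = 0 then 1 else cumulant_at_origin p 1 (tuple k x (\<lambda>_. 2)))"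

text \<open>
  The version at the origin of the \<open>(k+1)\<close>-st reduced density with first point \<open>(0, 1)\<close>: the sum over
  the positions \<open>D\<close> of those points that share a block with the first one.
\<close>

definition reduced12 :: "nat \<Rightarrow> (nat \<Rightarrow> 'a) \<Rightarrow> real" where
  "reduced12 k x = (\<Sum>D\<in>Pow {..<k}. cumulant12 (card D) (pick (positions k D) x) *
     reduced2 (k - card D) (pick (positions k ({..<k} - D)) x))"

lemma measurable_ball_ind [measurable]: "ball_ind k \<in> borel_measurable (PiL k)"
  unfolding ball_ind_def by (intro borel_measurable_indicator sets_PiM_I_finite) auto

lemma measurable_reduced2 [measurable]: "reduced2 k \<in> borel_measurable (PiL k)"
  unfolding reduced2_def by (rule measurable_reduced_density)

lemma measurable_cumulant12 [measurable]: "cumulant12 k \<in> borel_measurable (PiL k)"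
proof (cases "k = 0")
  case False
  then show ?thesis unfolding cumulant12_def using cumulant_at_origin_spec(1)[of k] by simp
qed (simp add: cumulant12_def[abs_def])

lemma measurable_pick_subset:
  assumes f: "\<And>n. f n \<in> borel_measurable (PiL n)" and "D \<subseteq> {..<k}" "card D = n"
  shows "(\<lambda>x. f n (pick (positions k D) x)) \<in> borel_measurable (PiL k)"
proof -
  have "pick (positions k D) \<in> PiL k \<rightarrow>\<^sub>M PiL (length (positions k D))"
    using assms by (intro measurable_pick) (auto simp: positions)
  then have "pick (positions k D) \<in> PiL k \<rightarrow>\<^sub>M PiL n" using assms by (simp add: length_positions)
  from measurable_compose[OF this f] show ?thesis .
qed

lemma measurable_reduced12 [measurable]: "reduced12 k \<in> borel_measurable (PiL k)"
  unfolding reduced12_def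
  by (intro borel_measurable_sum borel_measurable_times measurable_pick_subset[where f = cumulant12]
      measurable_pick_subset[where f = reduced2] measurable_cumulant12 measurable_reduced2) (auto simp: card_complement)

lemma ball_ind_nonneg: "0 \<le> ball_ind k x"
  by (simp add: ball_ind_def)

lemma reduced2_nonneg: "0 \<le> reduced2 k x"
  by (simp add: reduced2_def reduced_density_nonneg)

text \<open>
  The product of balls factorises along any set of positions, so that restricting to it does not spoil
  the factorisation of integrals.
\<close>

lemma ball_ind_split:
  assumes D: "D \<subseteq> {..<k}" and x: "x \<in> space (PiL k)"
  shows "ball_ind k x = ball_ind (card D) (pick (positions k D) x) * ball_ind (k - card D) (pick (positions k ({..<k} - D)) x)"
proof -
  have *: "ball_ind (card E) (pick (positions k E) x) = indicator {x. \<forall>i\<in>E. x i \<in> cball 0 t} x" if "E \<subseteq> {..<k}" for E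
    using pick_in_PiE_iff[of "positions k E" x "cball 0 t"] that
    by (auto simp: ball_ind_def length_positions positions Int_absorb2 indicator_def)
  have "ball_ind k x = indicator {x. \<forall>i\<in>{..<k}. x i \<in> cball 0 t} x"
    using x by (auto simp: ball_ind_def PiE_iff space_PiM indicator_def)
  then show ?thesis
    using *[OF D] *[of "{..<k} - D"] D by (auto simp: card_complement indicator_def)
qed

text \<open>
  Seen from its first point the reduced density does not depend on this point: in the expansion by
  the block of the first point, the first factor is the cumulant density at the origin and the second
  factor is translation invariant.
\<close>

lemma reduced_density_expansion:
  "AE a in lborel. AE x in PiL k. \<rho> ((a, 1) # tuple k (\<lambda>j. a + x j) (\<lambda>_. 2)) = reduced12 k x"
proof -
  let ?ws = "\<lambda>a x. tuple k (\<lambda>j. a + x j) (\<lambda>_. 2 :: 2)"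
  let ?X = "\<lambda>D a x. cumulant p ((a, 1) # nths (?ws a x) D) = cumulant12 (card D) (pick (positions k D) x)"
  let ?R = "\<lambda>D a x. \<rho> (nths (?ws a x) D) = reduced2 (card D) (pick (positions k D) x)"
  have nth: "nths (?ws a x) D = tuple (card D) (\<lambda>j. a + pick (positions k D) x j) (\<lambda>_. 2)" if "D \<subseteq> {..<k}" for a :: 'a and x D
    unfolding nths_tuple_map[where h = "\<lambda>y. a + y"] length_positions[OF that] ..
  have AEp: "AE x in PiL k. P (pick (positions k D) x)" if "D \<subseteq> {..<k}" "AE y in PiL (card D). P y" for P D
    using that(2) unfolding length_positions[OF that(1), symmetric]
    by (intro AE_pick sigma_finite_lborel) (auto simp: positions)
  have X: "AE a in lborel. AE x in PiL k. ?X D a x" if D: "D \<subseteq> {..<k}" for D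
  proof (cases "card D = 0")
    case True
    then have "nths (?ws a x) D = []" for a :: 'a and x by (simp only: nth[OF D] True) (simp add: tuple_def)
    then show ?thesis using True by (simp add: cumulant12_def)
  next
    case False
    interpret P: sigma_finite_measure "PiL (card D)" by (rule sigma_finite_PiM_lborel)
    interpret L: pair_sigma_finite "lborel :: 'a measure" "PiL (card D)" by unfold_locales
    have "AE (a, y) in lborel \<Otimes>\<^sub>M PiL (card D).
        cumulant_at_origin p 1 (tuple (card D) y (\<lambda>_. 2)) = cumulant p ((a, 1) # tuple (card D) (\<lambda>j. a + y j) (\<lambda>_. 2))"
      using False by (intro cumulant_at_origin_spec(2)) simp
    from L.AE_pair[OF this] have "AE a in lborel. AE y in PiL (card D).
        cumulant_at_origin p 1 (tuple (card D) y (\<lambda>_. 2)) = cumulant p ((a, 1) # tuple (card D) (\<lambda>j. a + y j) (\<lambda>_. 2))"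
      by simp
    then show ?thesis
    proof eventually_elim
      case (elim a)
      from AEp[OF D elim] show ?case
        by eventually_elim (use False in \<open>simp add: nth[OF D] cumulant12_def\<close>)
    qed
  qed
  have R: "AE x in PiL k. ?R D a x" if D: "D \<subseteq> {..<k}" for D a
    using AEp[OF D reduced_density_shift[of "card D" a "\<lambda>_. 2"]] by (simp add: nth[OF D] reduced2_def add.commute)
  \<comment> \<open>there are finitely many \<open>D\<close>, so one null set serves them all\<close>
  have "AE a in lborel. \<forall>D\<in>Pow {..<k}. AE x in PiL k. ?X D a x" by (rule AE_finite_allI) (use X in auto)
  then show ?thesis
  proof eventually_elim
    case (elim a)
    have "AE x in PiL k. \<forall>D\<in>Pow {..<k}. ?X D a x" by (rule AE_finite_allI) (use elim in auto)
    moreover have "AE x in PiL k. \<forall>D\<in>Pow {..<k}. ?R ({..<k} - D) a x" by (rule AE_finite_allI) (use R in auto)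
    ultimately show ?case
    proof eventually_elim
      case (elim x)
      have "\<rho> ((a, 1) # ?ws a x) = (\<Sum>D\<in>Pow {..<k}. cumulant p ((a, 1) # nths (?ws a x) D) * \<rho> (nths (?ws a x) ({..<k} - D)))"
        using reduced_density_Cons[of p "(a, 1)" "?ws a x"] p_pos by simp
      also have "\<dots> = reduced12 k x"
        unfolding reduced12_def using elim by (intro sum.cong refl arg_cong2[where f = times]) (auto simp: card_complement)
      finally show ?case .
    qed
  qed
qed

lemma reduced12_nonneg: "AE x in PiL k. 0 \<le> reduced12 k x"
proof -
  have "AE a in lborel. a \<in> (UNIV :: 'a set) \<longrightarrow> (AE x in PiL k. \<rho> ((a, 1) # tuple k (\<lambda>j. a + x j) (\<lambda>_. 2)) = reduced12 k x)"
    using reduced_density_expansion by simp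
  from AE_lborel_ex[OF _ _ this] obtain a
    where "AE x in PiL k. \<rho> ((a, 1) # tuple k (\<lambda>j. a + x j) (\<lambda>_. 2)) = reduced12 k x" by auto
  then show ?thesis by eventually_elim (metis reduced_density_nonneg)
qed

lemma PiL_0: "PiL 0 = count_space {\<lambda>_. undefined}"
  by (simp add: PiM_empty)

lemma integrable_reduced2: "integrable (PiL k) (\<lambda>x. ball_ind k x * reduced2 k x)"
proof (cases "k = 0")
  case True
  show ?thesis unfolding True PiL_0 by (intro integrable_count_space) simp
next
  case False
  have "(\<integral>\<^sup>+x. ennreal (norm (ball_ind k x * reduced2 k x)) \<partial>PiL k) =
      (\<integral>\<^sup>+x. indicator (\<Pi>\<^sub>E j\<in>{..<k}. cball 0 t) x * ennreal (\<rho> (tuple k x (\<lambda>_. 2))) \<partial>PiL k)"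
    by (intro nn_integral_cong) (auto simp: ball_ind_def reduced2_def reduced_density_nonneg split: split_indicator)
  also have "\<dots> < \<infinity>" using False by (intro reduced_density_locally_finite) simp
  finally show ?thesis by (intro integrableI_bounded) measurable
qed

text \<open>
  By local finiteness the reduced density is integrable in \<open>(a, x)\<close> for \<open>a\<close> in the unit ball and \<open>x\<close> in
  \<open>B(0,t)\<^sup>k\<close>. So it is integrable in \<open>x\<close> for some \<open>a\<close> at which it also agrees with its version at the origin.
\<close>

lemma integrable_reduced12: "integrable (PiL k) (\<lambda>x. ball_ind k x * reduced12 k x)"
proof -
  let ?r = "\<lambda>a x. \<rho> ((a, 1) # tuple k (\<lambda>j. a + x j) (\<lambda>_. 2))"
  \<comment> \<open>the ball of radius \<open>1 + t\<close> contains \<open>a\<close> and \<open>a + x j\<close> if \<open>norm a \<le> 1\<close> and \<open>norm (x j) \<le> t\<close>\<close>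
  let ?F = "\<lambda>z. indicator (\<Pi>\<^sub>E j\<in>{..<Suc k}. cball 0 (1 + t)) z * ennreal (\<rho> (tuple (Suc k) z (case_nat 1 (\<lambda>_. 2))))"
  have F: "?F \<in> borel_measurable (PiL (Suc k))"
    by (intro borel_measurable_times_ennreal borel_measurable_indicator sets_PiM_I_finite
        measurable_compose[OF measurable_reduced_density measurable_ennreal]) auto
  have fin: "(\<integral>\<^sup>+a. \<integral>\<^sup>+x. ?F (glue k a (\<lambda>j. a + x j)) \<partial>PiL k \<partial>lborel) < \<infinity>"
    using reduced_density_locally_finite[of "Suc k" "1 + t" "case_nat 1 (\<lambda>_. 2)"] nn_integral_PiM_Suc_centred[OF F] by simp
  have meas: "(\<lambda>a. \<integral>\<^sup>+x. ?F (glue k a (\<lambda>j. a + x j)) \<partial>PiL k) \<in> borel_measurable lborel"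
  proof -
    interpret P: sigma_finite_measure "PiL k" by (rule sigma_finite_PiM_lborel)
    have "(\<lambda>z. glue k (fst z) (\<lambda>j. fst z + snd z j)) \<in> lborel \<Otimes>\<^sub>M PiL k \<rightarrow>\<^sub>M PiL (Suc k)"
    proof (rule measurable_glue)
      fix j assume "j < k"
      then have s: "(\<lambda>z. snd z j) \<in> borel_measurable ((lborel :: 'a measure) \<Otimes>\<^sub>M PiL k)"
        using measurable_compose[OF measurable_snd measurable_component_singleton[of j "{..<k}" "\<lambda>_. lborel"]] by simp
      have f: "fst \<in> borel_measurable ((lborel :: 'a measure) \<Otimes>\<^sub>M PiL k)"
        using measurable_fst[of "lborel :: 'a measure" "PiL k"] by simp
      show "(\<lambda>z. fst z + snd z j) \<in> lborel \<Otimes>\<^sub>M PiL k \<rightarrow>\<^sub>M lborel"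
        using borel_measurable_add[OF f s] by simp
    qed simp
    from measurable_compose[OF this F] show ?thesis
      by (intro P.borel_measurable_nn_integral) (simp add: case_prod_beta')
  qed
  have "AE a in lborel. (\<integral>\<^sup>+x. ?F (glue k a (\<lambda>j. a + x j)) \<partial>PiL k) \<noteq> \<infinity>"
    by (rule nn_integral_PInf_AE[OF meas]) (use fin in simp)
  with reduced_density_expansion[of k]
  have "AE a in lborel. a \<in> cball 0 1 \<longrightarrow> (\<integral>\<^sup>+x. ?F (glue k a (\<lambda>j. a + x j)) \<partial>PiL k) < \<infinity> \<and> (AE x in PiL k. ?r a x = reduced12 k x)"
    by eventually_elim (simp add: less_top)
  note ae = this
  have ne: "emeasure lborel (cball (0::'a) 1) \<noteq> 0"
    using content_cball_pos[of 1 "0::'a"] by (auto simp: measure_def)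
  from AE_lborel_ex[OF _ ne ae] obtain a where a: "norm a \<le> 1"
    "(\<integral>\<^sup>+x. ?F (glue k a (\<lambda>j. a + x j)) \<partial>PiL k) < \<infinity>" "AE x in PiL k. ?r a x = reduced12 k x"
    by auto
  have "(\<integral>\<^sup>+x. ennreal (norm (ball_ind k x * reduced12 k x)) \<partial>PiL k) \<le> (\<integral>\<^sup>+x. ?F (glue k a (\<lambda>j. a + x j)) \<partial>PiL k)"
  proof (rule nn_integral_mono_AE)
    show "AE x in PiL k. ennreal (norm (ball_ind k x * reduced12 k x)) \<le> ?F (glue k a (\<lambda>j. a + x j))"
      using a(3)
    proof eventually_elim
      case (elim x)
      have "?F (glue k a (\<lambda>j. a + x j)) = ennreal (reduced12 k x)" if "x \<in> (\<Pi>\<^sub>E j\<in>{..<k}. cball 0 t)"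
      proof -
        have "glue k a (\<lambda>j. a + x j) j \<in> cball 0 (1 + t)" if "j < Suc k" for j
          using that a(1) \<open>x \<in> _\<close> t
          by (cases j) (auto simp: glue_def PiE_iff intro!: norm_triangle_le add_mono)
        then have "glue k a (\<lambda>j. a + x j) \<in> (\<Pi>\<^sub>E j\<in>{..<Suc k}. cball 0 (1 + t))"
          by (auto simp: PiE_iff glue_def)
        then show ?thesis using elim by (simp add: tuple_glue)
      qed
      moreover have "0 \<le> reduced12 k x" using elim reduced_density_nonneg by metis
      ultimately show ?case by (cases "x \<in> (\<Pi>\<^sub>E j\<in>{..<k}. cball 0 t)") (simp_all add: ball_ind_def)
    qed
  qed
  also have "\<dots> < \<infinity>" by (rule a(2))
  finally show ?thesis by (intro integrableI_bounded) measurable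
qed

definition cumulant_integral :: "nat \<Rightarrow> real" where
  "cumulant_integral k = (\<integral>x. ball_ind k x * cumulant12 k x \<partial>PiL k)"

definition moment2 :: "nat \<Rightarrow> real" where
  "moment2 k = (\<integral>x. ball_ind k x * reduced2 k x \<partial>PiL k)"

definition moment12 :: "nat \<Rightarrow> real" where
  "moment12 k = (\<integral>x. ball_ind k x * reduced12 k x \<partial>PiL k)"

lemma integral_expansion_term:
  assumes D: "D \<subseteq> {..<k}" and int: "integrable (PiL (card D)) (\<lambda>x. ball_ind (card D) x * cumulant12 (card D) x)"
  shows "integrable (PiL k) (\<lambda>x. ball_ind k x * (cumulant12 (card D) (pick (positions k D) x) *
      reduced2 (k - card D) (pick (positions k ({..<k} - D)) x)))" (is "integrable _ ?f")
    and "(\<integral>x. ball_ind k x * (cumulant12 (card D) (pick (positions k D) x) *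
      reduced2 (k - card D) (pick (positions k ({..<k} - D)) x)) \<partial>PiL k) =
      cumulant_integral (card D) * moment2 (k - card D)"
proof -
  let ?js = "positions k D" and ?ls = "positions k ({..<k} - D)"
  have len: "length ?js = card D" "length ?ls = k - card D"
    using D by (simp_all add: length_positions card_complement)
  have eq: "?f x = (ball_ind (card D) (pick ?js x) * cumulant12 (card D) (pick ?js x)) *
      (ball_ind (k - card D) (pick ?ls x) * reduced2 (k - card D) (pick ?ls x))" if "x \<in> space (PiL k)" for x
    using ball_ind_split[OF D that] by simp
  have dj: "set ?js \<inter> set ?ls = {}" "set ?js \<union> set ?ls = {..<k}" using D by (auto simp: positions)
  note ip = integral_pick_mult[OF sigma_finite_lborel positions(1) positions(1) dj, unfolded len, OF int integrable_reduced2]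
  show "integrable (PiL k) ?f"
    by (rule Bochner_Integration.integrable_cong[OF refl eq, THEN iffD2]) (use ip(1) in auto)
  have "(\<integral>x. ?f x \<partial>PiL k) = (\<integral>x. (ball_ind (card D) (pick ?js x) * cumulant12 (card D) (pick ?js x)) *
      (ball_ind (k - card D) (pick ?ls x) * reduced2 (k - card D) (pick ?ls x)) \<partial>PiL k)"
    by (rule Bochner_Integration.integral_cong[OF refl eq])
  also have "\<dots> = cumulant_integral (card D) * moment2 (k - card D)"
    unfolding ip(2) cumulant_integral_def moment2_def ..
  finally show "(\<integral>x. ?f x \<partial>PiL k) = cumulant_integral (card D) * moment2 (k - card D)" .
qed

text \<open>
  In the expansion of the reduced density every term but one involves cumulant densities of lower order, so
  that the highest one is a difference of integrable functions.
\<close>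

lemma integrable_cumulant12: "integrable (PiL k) (\<lambda>x. ball_ind k x * cumulant12 k x)"
proof (induction k rule: less_induct)
  case (less k)
  let ?f = "\<lambda>D x. ball_ind k x * (cumulant12 (card D) (pick (positions k D) x) *
      reduced2 (k - card D) (pick (positions k ({..<k} - D)) x))"
  have eq: "ball_ind k x * cumulant12 k x = ball_ind k x * reduced12 k x - (\<Sum>D\<in>Pow {..<k} - {{..<k}}. ?f D x)"
    if x: "x \<in> space (PiL k)" for x
  proof -
    have "positions k {..<k} = [0..<k]" by (simp add: positions_def)
    then have "pick (positions k {..<k}) x = x"
      using x by (auto simp: pick_def space_PiM PiE_iff extensional_def fun_eq_iff)
    then have e: "?f {..<k} x = ball_ind k x * cumulant12 k x"
      by (simp add: reduced2_def tuple_def reduced_density_def)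
    have "ball_ind k x * reduced12 k x = (\<Sum>D\<in>Pow {..<k}. ?f D x)"
      by (simp add: reduced12_def sum_distrib_left)
    also have "\<dots> = ?f {..<k} x + (\<Sum>D\<in>Pow {..<k} - {{..<k}}. ?f D x)"
      by (rule sum.remove) auto
    finally show ?thesis unfolding e by simp
  qed
  have "integrable (PiL k) (\<lambda>x. ball_ind k x * reduced12 k x - (\<Sum>D\<in>Pow {..<k} - {{..<k}}. ?f D x))"
  proof (intro Bochner_Integration.integrable_diff integrable_reduced12 Bochner_Integration.integrable_sum integral_expansion_term(1))
    fix D assume D: "D \<in> Pow {..<k} - {{..<k}}"
    then have "card D < card {..<k}" by (intro psubset_card_mono) auto
    then show "integrable (PiL (card D)) (\<lambda>x. ball_ind (card D) x * cumulant12 (card D) x)"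
      by (intro less.IH) simp
    show "D \<subseteq> {..<k}" using D by auto
  qed
  then show ?case by (rule Bochner_Integration.integrable_cong[OF refl eq, THEN iffD2, rotated])
qed

text \<open>
  This binomial convolution brings in the integrals in the series \<open>J\<^sub>1\<^sub>2\<close>.
\<close>

lemma moment12_eq: "moment12 k = (\<Sum>D\<in>Pow {..<k}. cumulant_integral (card D) * moment2 (k - card D))"
proof -
  let ?f = "\<lambda>D x. ball_ind k x * (cumulant12 (card D) (pick (positions k D) x) *
      reduced2 (k - card D) (pick (positions k ({..<k} - D)) x))"
  have "moment12 k = (\<integral>x. (\<Sum>D\<in>Pow {..<k}. ?f D x) \<partial>PiL k)"
    by (simp add: moment12_def reduced12_def sum_distrib_left)
  also have "\<dots> = (\<Sum>D\<in>Pow {..<k}. \<integral>x. ?f D x \<partial>PiL k)"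
    by (rule Bochner_Integration.integral_sum) (auto intro!: integral_expansion_term(1) integrable_cumulant12)
  also have "\<dots> = (\<Sum>D\<in>Pow {..<k}. cumulant_integral (card D) * moment2 (k - card D))"
    by (intro sum.cong refl integral_expansion_term(2) integrable_cumulant12) auto
  finally show ?thesis .
qed

lemma moment2_0: "moment2 0 = 1"
  unfolding moment2_def PiL_0 by (simp add: lebesgue_integral_count_space_finite ball_ind_def reduced2_def tuple_def reduced_density_def)

lemma J12_term_Suc: "J12_term p t (Suc k) = (-1) ^ Suc k / fact (Suc k) * cumulant_integral (Suc k)"
  by (simp add: J12_term_def cumulant_integral_def set_lebesgue_integral_def ball_ind_def cumulant12_def)

lemma moment2_nonneg: "0 \<le> moment2 k"
  unfolding moment2_def by (intro integral_nonneg_AE AE_I2 mult_nonneg_nonneg ball_ind_nonneg reduced2_nonneg)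

lemma moment12_nonneg: "0 \<le> moment12 k"
  unfolding moment12_def using reduced12_nonneg[of k]
  by (intro integral_nonneg_AE, eventually_elim) (simp add: ball_ind_nonneg)

lemma nn_integral_moment2: "(\<integral>\<^sup>+x. ennreal (ball_ind k x) * ennreal (reduced2 k x) \<partial>PiL k) = ennreal (moment2 k)"
  unfolding moment2_def
  by (subst nn_integral_eq_integral[OF integrable_reduced2, symmetric])
    (auto simp: ball_ind_nonneg reduced2_nonneg ennreal_mult)

lemma nn_integral_moment12: "(\<integral>\<^sup>+x. ennreal (ball_ind k x) * ennreal (reduced12 k x) \<partial>PiL k) = ennreal (moment12 k)"
  unfolding moment12_def
  using reduced12_nonneg[of k]
  by (subst nn_integral_eq_integral[OF integrable_reduced12, symmetric])
    (auto elim!: eventually_mono intro!: nn_integral_cong simp: ball_ind_nonneg ennreal_mult')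

end

section \<open>Moments of the weighted mass of a ball\<close>

context crm_ball
begin

lemma nn_integral_weighted_component:
  assumes \<psi>: "\<psi> \<in> lf_measures" and f: "f \<in> borel_measurable borel"
  shows "(\<integral>\<^sup>+x. f x \<partial>weighted_component p \<psi> i) =
    (\<integral>\<^sup>+z. f (fst z) * (indicator {i} (snd z) * ennreal (1 / p [z])) \<partial>\<psi>)"
proof -
  note [measurable] = f
  have s: "sets (component \<psi> i) = sets borel" by (simp add: component_def)
  have "(\<integral>\<^sup>+x. f x \<partial>weighted_component p \<psi> i) = (\<integral>\<^sup>+x. ennreal (1 / p [(x, i)]) * f x \<partial>component \<psi> i)"
    unfolding weighted_component_def by (rule nn_integral_density; subst measurable_cong_sets[OF s refl]; measurable)
  also have "\<dots> = (\<integral>\<^sup>+z. (ennreal (1 / p [(fst z, i)]) * f (fst z)) * indicator {i} (snd z) \<partial>\<psi>)"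
    by (rule nn_integral_component[OF \<psi>]) measurable
  also have "\<dots> = (\<integral>\<^sup>+z. f (fst z) * (indicator {i} (snd z) * ennreal (1 / p [z])) \<partial>\<psi>)"
    by (rule nn_integral_cong) (auto split: split_indicator simp: mult.commute)
  finally show ?thesis .
qed

abbreviation wt :: "'a \<Rightarrow> 'a \<times> 2 \<Rightarrow> real" where "wt \<equiv> ball_weight p t"

text \<open>
  The random variable \<open>Z\<^sub>a = \<Phi>\<^sub>2(B(a,t))\<close> as a function of the realisation.
\<close>

definition mass :: "'a \<Rightarrow> ('a \<times> 2) measure \<Rightarrow> real" where
  "mass a \<psi> = measure (weighted_component p \<psi> 2) (cball a t)"

lemma mass_nonneg: "0 \<le> mass a \<psi>" by (simp add: mass_def)

lemma wt_nonneg: "0 \<le> wt a z"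
  using p_pos[of z] by (simp add: ball_weight_def less_imp_le)

lemma ennreal_wt: "ennreal (wt a z) = (if dist a (fst z) \<le> t then 1 else 0) * (indicator {2} (snd z) * ennreal (1 / p [z]))"
  by (cases z) (auto simp: ball_weight_def split: split_indicator)

lemma measurable_ennreal_wt:
  assumes [measurable]: "a \<in> N \<rightarrow>\<^sub>M borel" "z \<in> N \<rightarrow>\<^sub>M marked_space"
  shows "(\<lambda>x. ennreal (wt (a x) (z x))) \<in> borel_measurable N"
  unfolding ennreal_wt by measurable

lemma ennreal_mass:
  assumes \<psi>: "\<psi> \<in> lf_measures"
  shows "ennreal (mass a \<psi>) = (\<integral>\<^sup>+z. ennreal (wt a z) \<partial>\<psi>)"
proof -
  obtain c where c: "0 < c" "\<And>z. c \<le> p [z]" using p_lower_bound by blast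
  have "sets (weighted_component p \<psi> 2) = sets borel" by (simp add: weighted_component_def component_def)
  then have "emeasure (weighted_component p \<psi> 2) (cball a t) =
      (\<integral>\<^sup>+x. indicator (cball a t) x \<partial>weighted_component p \<psi> 2)" by simp
  also have "\<dots> = (\<integral>\<^sup>+z. indicator (cball a t) (fst z) * (indicator {2} (snd z) * ennreal (1 / p [z])) \<partial>\<psi>)"
    by (rule nn_integral_weighted_component[OF \<psi> borel_measurable_indicator]) simp
  also have "\<dots> = (\<integral>\<^sup>+z. ennreal (wt a z) \<partial>\<psi>)"
    by (rule nn_integral_cong) (auto simp: ennreal_wt split: split_indicator)
  finally have e: "emeasure (weighted_component p \<psi> 2) (cball a t) = (\<integral>\<^sup>+z. ennreal (wt a z) \<partial>\<psi>)" .
  have C: "cball a t \<times> UNIV \<in> sets \<psi>" by (simp add: lf_measuresD[OF \<psi>] Times_in_marked_space)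
  have "(\<integral>\<^sup>+z. ennreal (wt a z) \<partial>\<psi>) \<le> (\<integral>\<^sup>+z. ennreal (1 / c) * indicator (cball a t \<times> UNIV) z \<partial>\<psi>)"
  proof (rule nn_integral_mono)
    fix z
    have "1 / p [z] \<le> 1 / c" using c p_pos by (intro divide_left_mono) auto
    then show "ennreal (wt a z) \<le> ennreal (1 / c) * indicator (cball a t \<times> UNIV) z"
      by (cases z) (auto simp: ennreal_wt split: split_indicator intro!: ennreal_leI)
  qed
  also have "\<dots> = ennreal (1 / c) * emeasure \<psi> (cball a t \<times> UNIV)" by (rule nn_integral_cmult_indicator[OF C])
  also have "\<dots> < \<infinity>" using \<psi> by (auto simp: lf_measures_def ennreal_mult_less_top)
  finally have "emeasure (weighted_component p \<psi> 2) (cball a t) \<noteq> \<infinity>" by (simp add: e)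
  then show ?thesis unfolding mass_def by (metis e emeasure_eq_ennreal_measure infinity_ennreal_def)
qed

lemma measurable_mass:
  assumes a: "a \<in> N \<rightarrow>\<^sub>M borel" and L: "L \<in> N \<rightarrow>\<^sub>M lf_algebra"
  shows "(\<lambda>x. mass (a x) (L x)) \<in> borel_measurable N"
proof -
  have lf: "L x \<in> lf_measures" if "x \<in> space N" for x using measurable_space[OF L that] by simp
  have "(\<lambda>x. \<integral>\<^sup>+z. ennreal (wt (a x) z) \<partial>L x) \<in> borel_measurable N"
    using a by (intro measurable_nn_integral_lf L) (auto simp: case_prod_beta' intro!: measurable_ennreal_wt)
  then have "(\<lambda>x. enn2real (\<integral>\<^sup>+z. ennreal (wt (a x) z) \<partial>L x)) \<in> borel_measurable N" by simp
  moreover have "mass (a x) (L x) = enn2real (\<integral>\<^sup>+z. ennreal (wt (a x) z) \<partial>L x)" if "x \<in> space N" for x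
    using ennreal_mass[OF lf[OF that], symmetric] mass_nonneg by simp
  ultimately show ?thesis by (subst measurable_cong) auto
qed

lemma measurable_mass_pair: "(\<lambda>z. mass (fst z) (snd z)) \<in> borel_measurable (borel \<Otimes>\<^sub>M lf_algebra)"
  by (rule measurable_mass) auto

lemma measurable_mass_sets:
  "sets N = sets lf_algebra \<Longrightarrow> mass a \<in> borel_measurable N"
  using measurable_mass[of "\<lambda>_. a" lf_algebra "\<lambda>\<psi>. \<psi>"] by (simp add: measurable_cong_sets[of N lf_algebra borel borel])

lemma laplace_eq_mass:
  assumes L: "\<And>x. x \<in> space N \<Longrightarrow> L x \<in> lf_measures"
  shows "laplace N L (wt a) = (\<integral>x. exp (- mass a (L x)) \<partial>N)"
  unfolding laplace_def
proof (rule Bochner_Integration.integral_cong[OF refl])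
  fix x assume "x \<in> space N"
  then have lf: "L x \<in> lf_measures" by (rule L)
  have s: "sets (component (L x) 2) = sets borel" by (simp add: component_def)
  have [measurable]: "(\<lambda>y. ennreal (wt a (y, 2))) \<in> borel_measurable borel"
    by (rule measurable_ennreal_wt) (auto simp: marked_space_def)
  have "(\<lambda>y. enn2real (ennreal (wt a (y, 2)))) \<in> borel_measurable borel" by measurable
  then have m: "(\<lambda>y. wt a (y, 2)) \<in> borel_measurable (component (L x) 2)"
    by (simp add: wt_nonneg measurable_cong_sets[OF s refl])
  have "(\<integral>y. wt a (y, 2) \<partial>component (L x) 2) = enn2real (\<integral>\<^sup>+y. ennreal (wt a (y, 2)) \<partial>component (L x) 2)"
    by (rule integral_eq_nn_integral[OF m]) (simp add: wt_nonneg)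
  also have "(\<integral>\<^sup>+y. ennreal (wt a (y, 2)) \<partial>component (L x) 2) =
      (\<integral>\<^sup>+z. ennreal (wt a (fst z, 2)) * indicator {2} (snd z) \<partial>L x)"
    by (rule nn_integral_component[OF lf]) measurable
  also have "\<dots> = (\<integral>\<^sup>+z. ennreal (wt a z) \<partial>L x)"
    by (rule nn_integral_cong) (auto simp: ennreal_wt split: split_indicator)
  also have "enn2real \<dots> = mass a (L x)" using ennreal_mass[OF lf, symmetric] mass_nonneg by simp
  finally have "(\<integral>y. wt a (y, 2) \<partial>component (L x) 2) = mass a (L x)" .
  moreover have "wt a (y, 1) = 0" for y by (simp add: ball_weight_def)
  ultimately have "(\<Sum>i\<in>UNIV. \<integral>y. wt a (y, i) \<partial>component (L x) i) = mass a (L x)"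
    by (simp add: sum_2)
  then show "exp (- (\<Sum>i\<in>UNIV. \<integral>y. wt a (y, i) \<partial>component (L x) i)) = exp (- mass a (L x))" by simp
qed

lemma laplace_nonneg: "0 \<le> laplace N L u"
  by (simp add: laplace_def)

lemma measurable_prod_wt: "(\<lambda>z. ennreal (\<Prod>j<k. wt a (z j))) \<in> borel_measurable (PiS k)"
proof -
  have "(\<lambda>z. \<Prod>j<k. ennreal (wt a (z j))) \<in> borel_measurable (PiS k)"
    by (intro borel_measurable_prod_ennreal measurable_ennreal_wt measurable_component_singleton) auto
  then show ?thesis by (simp add: prod_ennreal wt_nonneg)
qed

lemma nn_integral_prod_wt:
  assumes \<psi>: "\<psi> \<in> lf_measures"
  shows "(\<integral>\<^sup>+z. ennreal (\<Prod>j<k. wt a (z j)) \<partial>(\<Pi>\<^sub>M j\<in>{..<k}. \<psi>)) = ennreal (mass a \<psi> ^ k)"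
proof -
  interpret sigma_finite_measure \<psi> by (rule sigma_finite_lf_measure[OF \<psi>])
  interpret product_sigma_finite "\<lambda>_::nat. \<psi>" by unfold_locales
  have m: "(\<lambda>z. ennreal (wt a z)) \<in> borel_measurable \<psi>"
    by (rule borel_measurable_lf[OF \<psi> measurable_ennreal_wt]) auto
  have "(\<integral>\<^sup>+z. ennreal (\<Prod>j<k. wt a (z j)) \<partial>(\<Pi>\<^sub>M j\<in>{..<k}. \<psi>)) =
      (\<integral>\<^sup>+z. (\<Prod>j<k. ennreal (wt a (z j))) \<partial>(\<Pi>\<^sub>M j\<in>{..<k}. \<psi>))"
    by (simp add: prod_ennreal wt_nonneg)
  also have "\<dots> = (\<Prod>j<k. \<integral>\<^sup>+z. ennreal (wt a z) \<partial>\<psi>)" by (rule product_nn_integral_prod) (use m in auto)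
  also have "\<dots> = ennreal (mass a \<psi> ^ k)" by (simp add: ennreal_mass[OF \<psi>, symmetric] ennreal_power mass_nonneg)
  finally show ?thesis .
qed

lemma measurable_fst_component: "j \<in> {..<k} \<Longrightarrow> (\<lambda>z. fst (z j)) \<in> PiS k \<rightarrow>\<^sub>M borel"
  using measurable_compose[OF measurable_component_singleton[of j "{..<k}" "\<lambda>_. marked_space"] measurable_fst_marked] .

lemma prod_ball_eq_ball_ind:
  assumes "x \<in> space (PiL k)"
  shows "(\<Prod>j<k. if dist a (a + x j) \<le> t then 1 else 0) = ennreal (ball_ind k x)"
proof (cases "\<forall>j<k. norm (x j) \<le> t")
  case True
  then have "ball_ind k x = 1" using assms by (simp add: ball_ind_def PiE_iff space_PiM)
  moreover have "(\<Prod>j<k. if dist a (a + x j) \<le> t then 1 else 0) = (1 :: ennreal)"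
    using True by (intro prod.neutral) (simp add: dist_norm)
  ultimately show ?thesis by simp
next
  case False
  then obtain j where j: "j < k" "\<not> norm (x j) \<le> t" by blast
  then have "x \<notin> (\<Pi>\<^sub>E j\<in>{..<k}. cball 0 t)" by (auto simp: PiE_iff)
  then have "ball_ind k x = 0" by (simp add: ball_ind_def)
  moreover have "(\<Prod>j<k. if dist a (a + x j) \<le> t then 1 else 0) = (0 :: ennreal)"
    using j by (intro prod_zero bexI[of _ j]) (auto simp: dist_norm)
  ultimately show ?thesis by simp
qed

text \<open>
  The \<open>k\<close>-th power of an integral is an integral against the \<open>k\<close>-fold product. After the shift by
  \<open>a\<close> translation invariance of the reduced density removes \<open>a\<close>.
\<close>

lemma expectation_mass_power: "(\<integral>\<^sup>+\<omega>. ennreal (mass a (\<Psi> \<omega>) ^ k) \<partial>M) = ennreal (moment2 k)"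
proof (cases "k = 0")
  case True
  then show ?thesis by (simp add: moment2_0 emeasure_space_1)
next
  case False
  define F :: "(nat \<Rightarrow> 'a \<times> 2) \<Rightarrow> ennreal" where "F z = (\<Prod>j<k. if dist a (fst (z j)) \<le> t then 1 else 0)" for z
  note [measurable] = measurable_fst_component
  have F: "F \<in> borel_measurable (PiS k)" unfolding F_def by measurable
  define f :: "(nat \<Rightarrow> 'a) \<Rightarrow> ennreal" where
    "f x = (\<Prod>j<k. if dist a (x j) \<le> t then 1 else 0) * ennreal (reduced2 k x)" for x
  have f: "f \<in> borel_measurable (PiL k)" unfolding f_def by measurable
  have "(\<integral>\<^sup>+\<omega>. ennreal (mass a (\<Psi> \<omega>) ^ k) \<partial>M) =
      (\<integral>\<^sup>+\<omega>. \<integral>\<^sup>+z. F z * (\<Prod>j<k. indicator {2} (snd (z j)) * ennreal (1 / p [z j])) \<partial>(\<Pi>\<^sub>M j\<in>{..<k}. \<Psi> \<omega>) \<partial>M)"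
  proof (rule nn_integral_cong)
    fix \<omega> assume "\<omega> \<in> space M"
    then have "ennreal (mass a (\<Psi> \<omega>) ^ k) = (\<integral>\<^sup>+z. (\<Prod>j<k. ennreal (wt a (z j))) \<partial>(\<Pi>\<^sub>M j\<in>{..<k}. \<Psi> \<omega>))"
      using nn_integral_prod_wt[OF \<Psi>_lf] by (simp add: prod_ennreal wt_nonneg)
    then show "ennreal (mass a (\<Psi> \<omega>) ^ k) = (\<integral>\<^sup>+z. F z * (\<Prod>j<k. indicator {2} (snd (z j)) * ennreal (1 / p [z j])) \<partial>(\<Pi>\<^sub>M j\<in>{..<k}. \<Psi> \<omega>))"
      by (simp only: ennreal_wt prod.distrib F_def)
  qed
  also have "\<dots> = (\<integral>\<^sup>+x. F (\<lambda>j\<in>{..<k}. (x j, 2)) * ennreal (\<rho> (tuple k x (\<lambda>_. 2))) \<partial>PiL k)"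
    using False by (intro expectation_reduced[OF _ F]) simp
  also have "\<dots> = (\<integral>\<^sup>+x. f x \<partial>PiL k)"
    by (intro nn_integral_cong) (simp add: F_def f_def reduced2_def)
  also have "\<dots> = (\<integral>\<^sup>+x. f (\<lambda>j\<in>{..<k}. a + x j) \<partial>PiL k)" by (rule nn_integral_PiM_lborel_shift[OF f, symmetric])
  also have "\<dots> = (\<integral>\<^sup>+x. ennreal (ball_ind k x) * ennreal (reduced2 k x) \<partial>PiL k)"
  proof (rule nn_integral_cong_AE)
    show "AE x in PiL k. f (\<lambda>j\<in>{..<k}. a + x j) = ennreal (ball_ind k x) * ennreal (reduced2 k x)"
      using reduced_density_shift[of k a "\<lambda>_. 2"] AE_space
    proof eventually_elim
      case (elim x)
      have "tuple k (\<lambda>j\<in>{..<k}. a + x j) (\<lambda>_. 2) = tuple k (\<lambda>j. x j + a) (\<lambda>_. 2)"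
        by (rule tuple_cong) (auto simp: add.commute)
      then have "reduced2 k (\<lambda>j\<in>{..<k}. a + x j) = reduced2 k x" using elim by (simp add: reduced2_def)
      moreover have "(\<Prod>j<k. if dist a ((\<lambda>j\<in>{..<k}. a + x j) j) \<le> t then 1 else 0) = ennreal (ball_ind k x)"
        using prod_ball_eq_ball_ind[OF elim(2), of a] by simp
      ultimately show ?case by (simp only: f_def)
    qed
  qed
  also have "\<dots> = ennreal (moment2 k)" by (rule nn_integral_moment2)
  finally show ?thesis .
qed

lemma laplace_moment_term_eq: "laplace_moment_term M \<Psi> (wt a) k = (-1) ^ k / fact k * moment2 k"
proof -
  have m: "(\<lambda>z. \<Prod>j<k. wt a (z j)) \<in> borel_measurable (moment_measure M \<Psi> k)"
  proof -
    have "(\<lambda>z. enn2real (ennreal (\<Prod>j<k. wt a (z j)))) \<in> borel_measurable (PiS k)"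
      using measurable_prod_wt by measurable
    then show ?thesis by (simp add: prod_nonneg wt_nonneg measurable_cong_sets[OF sets_moment_measure refl])
  qed
  have "(\<integral>z. (\<Prod>j<k. wt a (z j)) \<partial>moment_measure M \<Psi> k) =
      enn2real (\<integral>\<^sup>+z. ennreal (\<Prod>j<k. wt a (z j)) \<partial>moment_measure M \<Psi> k)"
    by (rule integral_eq_nn_integral[OF m]) (simp add: prod_nonneg wt_nonneg)
  also have "(\<integral>\<^sup>+z. ennreal (\<Prod>j<k. wt a (z j)) \<partial>moment_measure M \<Psi> k) =
      (\<integral>\<^sup>+\<omega>. \<integral>\<^sup>+z. ennreal (\<Prod>j<k. wt a (z j)) \<partial>(\<Pi>\<^sub>M j\<in>{..<k}. \<Psi> \<omega>) \<partial>M)"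
    using nn_integral_moment_measure[OF measurable_prod_wt] by blast
  also have "\<dots> = (\<integral>\<^sup>+\<omega>. ennreal (mass a (\<Psi> \<omega>) ^ k) \<partial>M)"
    by (intro nn_integral_cong nn_integral_prod_wt \<Psi>_lf)
  also have "\<dots> = ennreal (moment2 k)" by (rule expectation_mass_power)
  finally show ?thesis by (simp add: laplace_moment_term_def moment2_nonneg)
qed

text \<open>
  The point \<open>x\<close> and the \<open>k\<close> points in \<open>B(x,t)\<close> form a tuple of length \<open>k + 1\<close> with labels
  \<open>1, 2, \<dots>, 2\<close>. Seen from \<open>x\<close>, the density of the others is that at the origin.
\<close>

lemma expectation_weighted_mass_power:
  assumes A [measurable]: "A \<in> sets borel"
  shows "(\<integral>\<^sup>+\<omega>. \<integral>\<^sup>+x. ennreal (mass x (\<Psi> \<omega>) ^ k) * indicator A x \<partial>weighted_component p (\<Psi> \<omega>) 1 \<partial>M) =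
    ennreal (moment12 k) * emeasure lborel A"
proof -
  \<comment> \<open>position 0 is the centre, with label 1; the points of the ball around it have label 2\<close>
  let ?l = "case_nat (1::2) (\<lambda>_. 2)"
  define F :: "(nat \<Rightarrow> 'a \<times> 2) \<Rightarrow> ennreal" where
    "F z = indicator A (fst (z 0)) * (\<Prod>j<k. if dist (fst (z 0)) (fst (z (Suc j))) \<le> t then 1 else 0)" for z
  have [measurable]: "(\<lambda>z. fst (z j)) \<in> PiS (Suc k) \<rightarrow>\<^sub>M borel" if "j \<in> {..<Suc k}" for j
    using measurable_fst_component[OF that] .
  have [measurable]: "(\<lambda>z. fst (z (Suc j))) \<in> PiS (Suc k) \<rightarrow>\<^sub>M borel" if "j \<in> {..<k}" for j
    using measurable_fst_component[of "Suc j" "Suc k"] that by simp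
  have [measurable]: "(\<lambda>z. fst (z 0)) \<in> PiS (Suc k) \<rightarrow>\<^sub>M borel"
    using measurable_fst_component[of 0 "Suc k"] by simp
  have F: "F \<in> borel_measurable (PiS (Suc k))" unfolding F_def by measurable
  let ?w = "\<lambda>z. \<Prod>j<Suc k. indicator {?l j} (snd (z j)) * ennreal (1 / p [z j])"
  have w: "?w \<in> borel_measurable (PiS (Suc k))"
  proof (intro borel_measurable_prod_ennreal borel_measurable_times_ennreal)
    fix j assume j: "j \<in> {..<Suc k}"
    note c = measurable_component_singleton[OF j, of "\<lambda>_. marked_space"]
    show "(\<lambda>z. indicator {?l j} (snd (z j)) :: ennreal) \<in> borel_measurable (PiS (Suc k))"
      by (rule measurable_compose[OF measurable_compose[OF c measurable_snd_marked]]) simp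
    show "(\<lambda>z. ennreal (1 / p [z j])) \<in> borel_measurable (PiS (Suc k))"
      by (rule measurable_compose[OF c]) measurable
  qed
  have "(\<integral>\<^sup>+x. ennreal (mass x \<psi> ^ k) * indicator A x \<partial>weighted_component p \<psi> 1) =
      (\<integral>\<^sup>+z. F z * ?w z \<partial>(\<Pi>\<^sub>M j\<in>{..<Suc k}. \<psi>))" if \<psi>: "\<psi> \<in> lf_measures" for \<psi>
  proof -
    have c: "(\<lambda>_. \<psi>) \<in> borel \<rightarrow>\<^sub>M lf_algebra" by (rule measurable_const) (simp add: \<psi>)
    have [measurable]: "(\<lambda>x. mass x \<psi>) \<in> borel_measurable borel" by (rule measurable_mass[OF _ c]) simp
    have "(\<integral>\<^sup>+x. ennreal (mass x \<psi> ^ k) * indicator A x \<partial>weighted_component p \<psi> 1) =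
      (\<integral>\<^sup>+z. (ennreal (mass (fst z) \<psi> ^ k) * indicator A (fst z)) * (indicator {1} (snd z) * ennreal (1 / p [z])) \<partial>\<psi>)"
      by (rule nn_integral_weighted_component[OF \<psi>]) measurable
    also have "\<dots> = (\<integral>\<^sup>+z. \<integral>\<^sup>+y. F (glue k z y) * ?w (glue k z y) \<partial>(\<Pi>\<^sub>M j\<in>{..<k}. \<psi>) \<partial>\<psi>)"
    proof (rule nn_integral_cong)
      fix z
      let ?c = "indicator A (fst z) * (indicator {1} (snd z) * ennreal (1 / p [z])) :: ennreal"
      have m: "(\<lambda>y. ennreal (\<Prod>j<k. wt (fst z) (y j))) \<in> borel_measurable (\<Pi>\<^sub>M j\<in>{..<k}. \<psi>)"
        using measurable_prod_wt by (simp add: measurable_cong_sets[OF sets_PiM_lf[OF \<psi>] refl])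
      have "F (glue k z y) * ?w (glue k z y) =
          ?c * ennreal (\<Prod>j<k. wt (fst z) (y j))" for y
      proof -
        have "ennreal (\<Prod>j<k. wt (fst z) (y j)) = (\<Prod>j<k. ennreal (wt (fst z) (y j)))"
          by (simp add: prod_ennreal wt_nonneg)
        then show ?thesis
          by (simp add: F_def glue_def prod.lessThan_Suc_shift ennreal_wt prod.distrib ac_simps del: prod.lessThan_Suc)
      qed
      then have "(\<integral>\<^sup>+y. F (glue k z y) * ?w (glue k z y) \<partial>(\<Pi>\<^sub>M j\<in>{..<k}. \<psi>)) =
          ?c * ennreal (mass (fst z) \<psi> ^ k)"
        by (simp only: nn_integral_cmult[OF m] nn_integral_prod_wt[OF \<psi>])
      then show "(ennreal (mass (fst z) \<psi> ^ k) * indicator A (fst z)) * (indicator {1} (snd z) * ennreal (1 / p [z])) =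
        (\<integral>\<^sup>+y. F (glue k z y) * ?w (glue k z y) \<partial>(\<Pi>\<^sub>M j\<in>{..<k}. \<psi>))"
        by (simp only: ac_simps)
    qed
    also have "\<dots> = (\<integral>\<^sup>+z. F z * ?w z \<partial>(\<Pi>\<^sub>M j\<in>{..<Suc k}. \<psi>))"
    proof (rule nn_integral_PiM_Suc[OF sigma_finite_lf_measure[OF \<psi>], symmetric])
      show "(\<lambda>z. F z * ?w z) \<in> borel_measurable (\<Pi>\<^sub>M j\<in>{..<Suc k}. \<psi>)"
        using borel_measurable_times_ennreal[OF F w] by (simp only: measurable_cong_sets[OF sets_PiM_lf[OF \<psi>] refl])
    qed
    finally show ?thesis .
  qed
  then have "(\<integral>\<^sup>+\<omega>. \<integral>\<^sup>+x. ennreal (mass x (\<Psi> \<omega>) ^ k) * indicator A x \<partial>weighted_component p (\<Psi> \<omega>) 1 \<partial>M) =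
      (\<integral>\<^sup>+\<omega>. \<integral>\<^sup>+z. F z * ?w z \<partial>(\<Pi>\<^sub>M j\<in>{..<Suc k}. \<Psi> \<omega>) \<partial>M)"
    by (intro nn_integral_cong) (simp add: \<Psi>_lf)
  also have "\<dots> = (\<integral>\<^sup>+x. F (\<lambda>j\<in>{..<Suc k}. (x j, ?l j)) * ennreal (\<rho> (tuple (Suc k) x ?l)) \<partial>PiL (Suc k))"
    by (rule expectation_reduced[OF _ F]) simp
  also have "\<dots> = (\<integral>\<^sup>+a. \<integral>\<^sup>+x. F (\<lambda>j\<in>{..<Suc k}. (glue k a (\<lambda>j. a + x j) j, ?l j)) *
      ennreal (\<rho> (tuple (Suc k) (glue k a (\<lambda>j. a + x j)) ?l)) \<partial>PiL k \<partial>lborel)"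
  proof (rule nn_integral_PiM_Suc_centred)
    have "(\<lambda>x. \<lambda>j\<in>{..<Suc k}. (x j, ?l j)) \<in> PiL (Suc k) \<rightarrow>\<^sub>M PiS (Suc k)"
      unfolding marked_space_def by measurable
    from measurable_compose[OF this F] show "(\<lambda>x. F (\<lambda>j\<in>{..<Suc k}. (x j, ?l j)) * ennreal (\<rho> (tuple (Suc k) x ?l))) \<in> borel_measurable (PiL (Suc k))"
      by (intro borel_measurable_times_ennreal measurable_compose[OF measurable_reduced_density measurable_ennreal])
  qed
  also have "\<dots> = (\<integral>\<^sup>+a. ennreal (moment12 k) * indicator A a \<partial>lborel)"
  proof (rule nn_integral_cong_AE)
    show "AE a in lborel. (\<integral>\<^sup>+x. F (\<lambda>j\<in>{..<Suc k}. (glue k a (\<lambda>j. a + x j) j, ?l j)) *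
      ennreal (\<rho> (tuple (Suc k) (glue k a (\<lambda>j. a + x j)) ?l)) \<partial>PiL k) = ennreal (moment12 k) * indicator A a"
      using reduced_density_expansion[of k]
    proof eventually_elim
      case (elim a)
      have "(\<integral>\<^sup>+x. F (\<lambda>j\<in>{..<Suc k}. (glue k a (\<lambda>j. a + x j) j, ?l j)) *
          ennreal (\<rho> (tuple (Suc k) (glue k a (\<lambda>j. a + x j)) ?l)) \<partial>PiL k) =
        (\<integral>\<^sup>+x. indicator A a * (ennreal (ball_ind k x) * ennreal (reduced12 k x)) \<partial>PiL k)"
      proof (rule nn_integral_cong_AE)
        show "AE x in PiL k. F (\<lambda>j\<in>{..<Suc k}. (glue k a (\<lambda>j. a + x j) j, ?l j)) *
          ennreal (\<rho> (tuple (Suc k) (glue k a (\<lambda>j. a + x j)) ?l)) =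
          indicator A a * (ennreal (ball_ind k x) * ennreal (reduced12 k x))"
          using elim AE_space
        proof eventually_elim
          case (elim x)
          have "F (\<lambda>j\<in>{..<Suc k}. (glue k a (\<lambda>j. a + x j) j, ?l j)) = indicator A a * ennreal (ball_ind k x)"
            using prod_ball_eq_ball_ind[OF elim(2), of a] by (simp add: F_def glue_def)
          then show ?case using elim(1) by (simp add: tuple_glue mult.assoc)
        qed
      qed
      also have "\<dots> = indicator A a * ennreal (moment12 k)"
        unfolding nn_integral_moment12[symmetric] by (rule nn_integral_cmult) measurable
      finally show ?case by (simp add: mult.commute)
    qed
  qed
  also have "\<dots> = ennreal (moment12 k) * emeasure lborel A" by (simp add: nn_integral_cmult_indicator)
  finally show ?thesis .
qed

text \<open>
  For two points the reduced density is \<open>1 + \<xi>\<^sub>2\<close>.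
\<close>

lemma K12_eq_moment12: "K12 p t = moment12 1"
proof -
  let ?c = "\<lambda>x. cumulant_at_origin p 1 [(x, 2)]"
  interpret product_sigma_finite "\<lambda>_::nat. lborel :: 'a measure" by unfold_locales
  have t1: "tuple (Suc 0) x i = [(x 0, i 0)]" for x :: "nat \<Rightarrow> 'a" and i by (simp add: tuple_def)
  have "(\<lambda>x. \<lambda>j\<in>{..<1::nat}. x) \<in> borel \<rightarrow>\<^sub>M PiL 1" by (intro measurable_restrict) simp
  from measurable_compose[OF this cumulant_at_origin_spec(1)[of 1 1 "\<lambda>_. 2"]]
  have c: "?c \<in> borel_measurable borel" by (simp add: t1)
  have m: "(\<lambda>x. indicator (cball 0 t) x * (1 + ?c x) :: real) \<in> borel_measurable borel"
    by (intro borel_measurable_times borel_measurable_add borel_measurable_indicator borel_measurable_const c) simp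
  have "K12 p t = (\<integral>x. indicator (cball 0 t) x * (1 + ?c x) \<partial>lborel)"
    by (simp add: K12_def set_lebesgue_integral_def)
  also have "\<dots> = (\<integral>x. indicator (cball 0 t) (x 0) * (1 + ?c (x 0)) \<partial>PiL 1)"
    using m product_integral_singleton[of "\<lambda>x. indicator (cball 0 t) x * (1 + ?c x)" 0] by (simp add: lessThan_Suc)
  also have "\<dots> = (\<integral>x. ball_ind 1 x * reduced2 1 x + ball_ind 1 x * cumulant12 1 x \<partial>PiL 1)"
  proof (rule Bochner_Integration.integral_cong[OF refl])
    fix x assume "x \<in> space (PiL 1)"
    then have "ball_ind 1 x = indicator (cball 0 t) (x 0)" by (auto simp: ball_ind_def PiE_iff space_PiM indicator_def)
    moreover have "reduced2 1 x = 1" using p_pos by (simp add: reduced2_def t1 reduced_density_def less_imp_neq[symmetric])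
    ultimately show "indicator (cball 0 t) (x 0) * (1 + ?c (x 0)) = ball_ind 1 x * reduced2 1 x + ball_ind 1 x * cumulant12 1 x"
      by (simp add: cumulant12_def t1 distrib_left)
  qed
  also have "\<dots> = moment2 1 + cumulant_integral 1"
    using integrable_reduced2[of 1] integrable_cumulant12[of 1] by (simp add: moment2_def cumulant_integral_def)
  also have "cumulant_integral 0 = 1"
    unfolding cumulant_integral_def PiL_0 by (simp add: lebesgue_integral_count_space_finite ball_ind_def cumulant12_def)
  then have "moment2 1 + cumulant_integral 1 = moment12 1"
    unfolding moment12_eq sum_Pow_card[of "\<lambda>j. cumulant_integral j * moment2 (1 - j)"] by (simp add: moment2_0)
  finally show ?thesis .
qed

section \<open>Palm distributions\<close>

lemma nn_integral_PiL_1: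
  assumes f: "f \<in> borel_measurable borel"
  shows "(\<integral>\<^sup>+x. f (x 0) \<partial>PiL 1) = (\<integral>\<^sup>+x. f x \<partial>lborel)"
proof -
  interpret product_sigma_finite "\<lambda>_::nat. lborel :: 'a measure" by unfold_locales
  show ?thesis using product_nn_integral_singleton[of f 0] f by (simp add: lessThan_Suc)
qed

text \<open>
  The Palm identity for the label 1. Weighting by \<open>1 / p\<^sub>1\<close> cancels the density of the first moment
  measure, so that Lebesgue measure remains.
\<close>

lemma expectation_weighted_eq_palm:
  fixes H :: "'a \<Rightarrow> ('a \<times> 2) measure \<Rightarrow> ennreal"
  assumes Q: "palm_distributions M \<Psi> Q" and A [measurable]: "A \<in> sets borel"
    and H: "(\<lambda>z. H (fst z) (snd z)) \<in> borel_measurable (borel \<Otimes>\<^sub>M lf_algebra)"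
  shows "(\<integral>\<^sup>+\<omega>. \<integral>\<^sup>+x. H x (\<Psi> \<omega>) * indicator A x \<partial>weighted_component p (\<Psi> \<omega>) 1 \<partial>M) =
    (\<integral>\<^sup>+x. (\<integral>\<^sup>+\<psi>. H x \<psi> \<partial>Q (x, 1)) * indicator A x \<partial>lborel)"
proof -
  have Qm: "Q \<in> marked_space \<rightarrow>\<^sub>M subprob_algebra lf_algebra"
    using Q by (intro measurable_prob_algebraD) (simp add: palm_distributions_def)
  have Hc: "(\<lambda>x. H (f x) (L x)) \<in> borel_measurable N" if "f \<in> N \<rightarrow>\<^sub>M borel" "L \<in> N \<rightarrow>\<^sub>M lf_algebra"
    for f L and N :: "'z measure"
    using measurable_compose[OF measurable_Pair[OF that] H] by simp
  define v :: "'a \<times> 2 \<Rightarrow> ennreal" where "v z = indicator A (fst z) * (indicator {1} (snd z) * ennreal (1 / p [z]))" for z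
  have v [measurable]: "v \<in> borel_measurable marked_space" unfolding v_def by measurable
  define h where "h z = (\<integral>\<^sup>+\<psi>. H (fst z) \<psi> \<partial>Q z)" for z
  have h [measurable]: "h \<in> borel_measurable marked_space"
    unfolding h_def by (rule nn_integral_measurable_subprob_algebra2[OF _ Qm])
      (auto simp: case_prod_beta' intro!: Hc measurable_compose[OF measurable_fst])
  let ?g = "\<lambda>(z, \<psi>). v z * H (fst z) \<psi>"
  have g: "?g \<in> borel_measurable (marked_space \<Otimes>\<^sub>M lf_algebra)"
    by (auto simp: case_prod_beta' intro!: borel_measurable_times_ennreal Hc measurable_compose[OF measurable_fst])
  have "(\<integral>\<^sup>+\<omega>. \<integral>\<^sup>+x. H x (\<Psi> \<omega>) * indicator A x \<partial>weighted_component p (\<Psi> \<omega>) 1 \<partial>M) =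
      (\<integral>\<^sup>+\<omega>. (\<Sum>i\<in>UNIV. \<integral>\<^sup>+x. ?g ((x, i), \<Psi> \<omega>) \<partial>component (\<Psi> \<omega>) i) \<partial>M)"
  proof (rule nn_integral_cong)
    fix \<omega> assume "\<omega> \<in> space M"
    then have lf: "\<Psi> \<omega> \<in> lf_measures" by (rule \<Psi>_lf)
    have c: "(\<lambda>_. \<Psi> \<omega>) \<in> borel \<rightarrow>\<^sub>M lf_algebra" by (rule measurable_const) (simp add: lf)
    have [measurable]: "(\<lambda>x. H x (\<Psi> \<omega>)) \<in> borel_measurable borel" by (rule Hc[OF _ c]) simp
    have vp [measurable]: "(\<lambda>x. v (x, 1)) \<in> borel_measurable borel"
      by (rule measurable_compose[OF _ v]) (simp add: marked_space_def)
    have "(\<integral>\<^sup>+x. H x (\<Psi> \<omega>) * indicator A x \<partial>weighted_component p (\<Psi> \<omega>) 1) =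
        (\<integral>\<^sup>+z. (H (fst z) (\<Psi> \<omega>) * indicator A (fst z)) * (indicator {1} (snd z) * ennreal (1 / p [z])) \<partial>\<Psi> \<omega>)"
      by (rule nn_integral_weighted_component[OF lf]) measurable
    also have "\<dots> = (\<integral>\<^sup>+z. (v (fst z, 1) * H (fst z) (\<Psi> \<omega>)) * indicator {1} (snd z) \<partial>\<Psi> \<omega>)"
      by (rule nn_integral_cong) (auto simp: v_def mult_ac split: split_indicator)
    also have "\<dots> = (\<integral>\<^sup>+x. v (x, 1) * H x (\<Psi> \<omega>) \<partial>component (\<Psi> \<omega>) 1)"
      by (rule nn_integral_component[OF lf, symmetric]) measurable
    also have "\<dots> = (\<Sum>i\<in>UNIV. \<integral>\<^sup>+x. ?g ((x, i), \<Psi> \<omega>) \<partial>component (\<Psi> \<omega>) i)"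
      by (simp add: sum_2 v_def)
    finally show "(\<integral>\<^sup>+x. H x (\<Psi> \<omega>) * indicator A x \<partial>weighted_component p (\<Psi> \<omega>) 1) =
      (\<Sum>i\<in>UNIV. \<integral>\<^sup>+x. ?g ((x, i), \<Psi> \<omega>) \<partial>component (\<Psi> \<omega>) i)" .
  qed
  also have "\<dots> = (\<integral>\<^sup>+z. (\<integral>\<^sup>+\<psi>. ?g (z 0, \<psi>) \<partial>Q (z 0)) \<partial>moment_measure M \<Psi> 1)"
    using Q g unfolding palm_distributions_def by blast
  also have "\<dots> = (\<integral>\<^sup>+z. (v (z 0) * h (z 0)) * (\<Prod>j<1. indicator {1} (snd (z j))) \<partial>moment_measure M \<Psi> 1)"
  proof (rule nn_integral_cong)
    fix z :: "nat \<Rightarrow> 'a \<times> 2"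
    have s: "sets (Q (z 0)) = sets lf_algebra" using sets_kernel[OF Qm, of "z 0"] by simp
    have "(\<lambda>\<psi>. H (fst (z 0)) \<psi>) \<in> borel_measurable (Q (z 0))"
      unfolding measurable_cong_sets[OF s refl] by (rule Hc) auto
    then have "(\<integral>\<^sup>+\<psi>. ?g (z 0, \<psi>) \<partial>Q (z 0)) = v (z 0) * h (z 0)"
      by (simp add: h_def nn_integral_cmult)
    moreover have "v (z 0) * indicator {1} (snd (z 0)) = v (z 0)" by (auto simp: v_def split: split_indicator)
    then have "(v (z 0) * h (z 0)) * (\<Prod>j<1. indicator {1} (snd (z j))) = v (z 0) * h (z 0)"
      by (simp add: lessThan_Suc) (metis mult.assoc mult.commute)
    ultimately show "(\<integral>\<^sup>+\<psi>. ?g (z 0, \<psi>) \<partial>Q (z 0)) = (v (z 0) * h (z 0)) * (\<Prod>j<1. indicator {1} (snd (z j)))" by simp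
  qed
  also have "\<dots> = (\<integral>\<^sup>+x. (v ((\<lambda>j\<in>{..<1}. (x j, 1)) 0) * h ((\<lambda>j\<in>{..<1}. (x j, 1)) 0)) * ennreal (p (tuple 1 x (\<lambda>_. 1))) \<partial>PiL 1)"
  proof (rule nn_integral_moment_measure_labels)
    have c: "(\<lambda>z. z 0) \<in> PiS 1 \<rightarrow>\<^sub>M marked_space" by (rule measurable_component_singleton) simp
    show "(\<lambda>z. v (z 0) * h (z 0)) \<in> borel_measurable (PiS 1)"
      by (intro borel_measurable_times_ennreal measurable_compose[OF c v] measurable_compose[OF c h])
  qed simp
  also have "\<dots> = (\<integral>\<^sup>+x. (\<lambda>y. h (y, 1) * indicator A y) (x 0) \<partial>PiL 1)"
  proof (rule nn_integral_cong)
    fix x :: "nat \<Rightarrow> 'a"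
    have "(v ((\<lambda>j\<in>{..<1}. (x j, 1)) 0) * h ((\<lambda>j\<in>{..<1}. (x j, 1)) 0)) * ennreal (p (tuple 1 x (\<lambda>_. 1))) =
        (ennreal (1 / p [(x 0, 1)]) * ennreal (p [(x 0, 1)])) * (h (x 0, 1) * indicator A (x 0))"
      by (simp add: v_def tuple_def ac_simps)
    moreover have "ennreal (1 / p [(x 0, 1)]) * ennreal (p [(x 0, 1)]) = 1"
      using p_pos[of "(x 0, 1)"] by (simp flip: ennreal_mult')
    ultimately show "(v ((\<lambda>j\<in>{..<1}. (x j, 1)) 0) * h ((\<lambda>j\<in>{..<1}. (x j, 1)) 0)) * ennreal (p (tuple 1 x (\<lambda>_. 1))) =
      (\<lambda>y. h (y, 1) * indicator A y) (x 0)"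
      by (simp only: mult_1)
  qed
  also have "\<dots> = (\<integral>\<^sup>+x. h (x, 1) * indicator A x \<partial>lborel)"
  proof (rule nn_integral_PiL_1)
    have "(\<lambda>x. h (x, 1)) \<in> borel_measurable borel"
      by (rule measurable_compose[OF _ h]) (simp add: marked_space_def)
    then show "(\<lambda>x. h (x, 1) * indicator A x) \<in> borel_measurable borel" by measurable
  qed
  finally show ?thesis by (simp add: h_def)
qed

lemma palm_prob_space: "palm_distributions M \<Psi> Q \<Longrightarrow> prob_space (Q z) \<and> sets (Q z) = sets lf_algebra"
  using measurable_space[of Q marked_space "prob_algebra lf_algebra" z]
  by (simp add: palm_distributions_def space_prob_algebra)

text \<open>
  The Palm moments integrate over every Borel set \<open>A\<close> to the same value as the constant does.
\<close>

lemma palm_mass_power: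
  assumes Q: "palm_distributions M \<Psi> Q"
  shows "AE x in lborel. (\<integral>\<^sup>+\<psi>. ennreal (mass x \<psi> ^ k) \<partial>Q (x, 1)) = ennreal (moment12 k)"
proof (rule sigma_finite_measure.density_unique2[OF sigma_finite_lborel])
  note [measurable] = measurable_mass_pair
  have Qm: "Q \<in> marked_space \<rightarrow>\<^sub>M subprob_algebra lf_algebra"
    using Q by (intro measurable_prob_algebraD) (simp add: palm_distributions_def)
  have "(\<lambda>x. Q (x, 1)) \<in> borel \<rightarrow>\<^sub>M subprob_algebra lf_algebra"
    by (rule measurable_compose[OF _ Qm]) (simp add: marked_space_def)
  then have "(\<lambda>x. \<integral>\<^sup>+\<psi>. ennreal (mass x \<psi> ^ k) \<partial>Q (x, 1)) \<in> borel_measurable borel"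
    by (rule nn_integral_measurable_subprob_algebra2[rotated]) (simp add: case_prod_beta')
  then show "(\<lambda>x. \<integral>\<^sup>+\<psi>. ennreal (mass x \<psi> ^ k) \<partial>Q (x, 1)) \<in> borel_measurable lborel" by simp
  fix A :: "'a set" assume "A \<in> sets lborel"
  then have A: "A \<in> sets borel" by simp
  have "(\<integral>\<^sup>+x. (\<integral>\<^sup>+\<psi>. ennreal (mass x \<psi> ^ k) \<partial>Q (x, 1)) * indicator A x \<partial>lborel) =
      (\<integral>\<^sup>+\<omega>. \<integral>\<^sup>+x. ennreal (mass x (\<Psi> \<omega>) ^ k) * indicator A x \<partial>weighted_component p (\<Psi> \<omega>) 1 \<partial>M)"
    by (rule expectation_weighted_eq_palm[OF Q A, symmetric]) measurable
  also have "\<dots> = ennreal (moment12 k) * emeasure lborel A" by (rule expectation_weighted_mass_power[OF A])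
  also have "\<dots> = (\<integral>\<^sup>+x\<in>A. ennreal (moment12 k) \<partial>lborel)" using A by (simp add: nn_integral_cmult_indicator)
  finally show "(\<integral>\<^sup>+x\<in>A. (\<integral>\<^sup>+\<psi>. ennreal (mass x \<psi> ^ k) \<partial>Q (x, 1)) \<partial>lborel) = (\<integral>\<^sup>+x\<in>A. ennreal (moment12 k) \<partial>lborel)" .
qed simp

lemma summable_moment2:
  assumes "summable (\<lambda>k. \<bar>laplace_moment_term M \<Psi> (wt 0) (Suc k)\<bar>)"
  shows "summable (\<lambda>k. moment2 k / fact k)"
proof (subst summable_Suc_iff[symmetric])
  show "summable (\<lambda>k. moment2 (Suc k) / fact (Suc k))"
    using assms moment2_nonneg by (simp add: laplace_moment_term_eq abs_mult power_abs del: fact_Suc)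
qed

lemma summable_moment12:
  assumes m: "summable (\<lambda>k. moment2 k / fact k)" and J: "summable (\<lambda>k. \<bar>J12_term p t (Suc k)\<bar>)"
  shows "summable (\<lambda>k. moment12 k / fact k)"
  unfolding moment12_eq
proof (rule summable_binomial_convolution)
  have "summable (\<lambda>k. \<bar>cumulant_integral (Suc k)\<bar> / fact (Suc k))"
    using J by (simp add: J12_term_Suc abs_mult power_abs del: fact_Suc power_Suc)
  then show "summable (\<lambda>k. \<bar>cumulant_integral k\<bar> / fact k)"
    by (subst summable_Suc_iff[symmetric])
  show "summable (\<lambda>k. \<bar>moment2 k\<bar> / fact k)" using m moment2_nonneg by simp
qed

lemma laplace_const:
  assumes m: "summable (\<lambda>k. moment2 k / fact k)"
  shows "laplace M \<Psi> (wt a) = laplace M \<Psi> (wt 0)"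
proof -
  have "laplace M \<Psi> (wt a) = (\<Sum>k. (-1) ^ k / fact k * moment2 k)" for a
  proof -
    have [measurable]: "(\<lambda>\<omega>. mass a (\<Psi> \<omega>)) \<in> borel_measurable M" by (rule measurable_mass[OF _ \<Psi>]) simp
    have "laplace M \<Psi> (wt a) = (\<integral>\<omega>. exp (- mass a (\<Psi> \<omega>)) \<partial>M)" by (rule laplace_eq_mass) (rule \<Psi>_lf)
    also have "\<dots> = (\<Sum>k. (-1) ^ k / fact k * moment2 k)"
      by (rule integral_exp_minus_of_moments) (auto simp: mass_nonneg expectation_mass_power moment2_nonneg m)
    finally show ?thesis .
  qed
  then show ?thesis by simp
qed

text \<open>
  Outside one null set all Palm moments agree with the constants \<open>moment12 k\<close> simultaneously, and these
  determine the Laplace functional. Since Lebesgue measure is not zero, the almost sure value is unique.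
\<close>

lemma palm_laplace_const:
  assumes Q: "palm_distributions M \<Psi> Q" and m: "summable (\<lambda>k. moment12 k / fact k)"
  shows "AE a in lborel. laplace (Q (a, 1)) (\<lambda>\<psi>. \<psi>) (wt a) = palm_laplace_at_origin Q p t"
proof -
  define v where "v = (\<Sum>k. (-1) ^ k / fact k * moment12 k)"
  have "AE a in lborel. \<forall>k. (\<integral>\<^sup>+\<psi>. ennreal (mass a \<psi> ^ k) \<partial>Q (a, 1)) = ennreal (moment12 k)"
    unfolding AE_all_countable using palm_mass_power[OF Q] by blast
  then have v: "AE a in lborel. laplace (Q (a, 1)) (\<lambda>\<psi>. \<psi>) (wt a) = v"
  proof eventually_elim
    case (elim a)
    have s: "sets (Q (a, 1)) = sets lf_algebra" using palm_prob_space[OF Q] by blast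
    have "laplace (Q (a, 1)) (\<lambda>\<psi>. \<psi>) (wt a) = (\<integral>\<psi>. exp (- mass a \<psi>) \<partial>Q (a, 1))"
      by (rule laplace_eq_mass) (simp add: sets_eq_imp_space_eq[OF s])
    also have "\<dots> = v"
      unfolding v_def using elim
      by (intro integral_exp_minus_of_moments measurable_mass_sets s) (auto simp: mass_nonneg moment12_nonneg m)
    finally show ?case .
  qed
  have "palm_laplace_at_origin Q p t = v"
    unfolding palm_laplace_at_origin_def
  proof (rule the_equality)
    show "AE a in lborel. laplace (Q (a, 1)) (\<lambda>\<psi>. \<psi>) (wt a) = v" by (rule v)
    fix w assume "AE a in lborel. laplace (Q (a, 1)) (\<lambda>\<psi>. \<psi>) (wt a) = w"
    with v have "AE a in lborel. a \<in> (UNIV :: 'a set) \<longrightarrow> w = v" by eventually_elim auto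
    from AE_lborel_ex[OF _ _ this] show "w = v" by auto
  qed
  with v show ?thesis by simp
qed

end

section \<open>The estimators\<close>

lemma closed_erosion:
  assumes "closed W" shows "closed (erosion W t)"
proof -
  have "erosion W t = W \<inter> (\<Inter>v\<in>cball 0 t. (\<lambda>w. w + v) -` W)"
  proof (intro set_eqI iffI)
    fix w assume w: "w \<in> erosion W t"
    then have "w + v \<in> W" if "v \<in> cball 0 t" for v
      using that by (auto simp: erosion_def dist_norm subset_eq)
    then show "w \<in> W \<inter> (\<Inter>v\<in>cball 0 t. (\<lambda>w. w + v) -` W)" using w by (auto simp: erosion_def)
  next
    fix w assume w: "w \<in> W \<inter> (\<Inter>v\<in>cball 0 t. (\<lambda>w. w + v) -` W)"
    have "y \<in> W" if "y \<in> cball w t" for y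
    proof -
      have "y - w \<in> cball 0 t" using that by (simp add: dist_norm norm_minus_commute)
      then have "w + (y - w) \<in> W" using w by blast
      then show ?thesis by simp
    qed
    then show "w \<in> erosion W t" using w by (auto simp: erosion_def)
  qed
  moreover have "closed ((\<lambda>w. w + v) -` W)" for v
    using assms by (intro continuous_closed_vimage) auto
  ultimately show ?thesis using assms by (simp only:) (intro closed_Int closed_INT ballI)
qed

text \<open>
  The estimators are real integrals of non-negative functions, that is, the real values of extended ones. Their
  expectations can thus be computed in the extended non-negative reals; finiteness of the expectation gives integrability.
\<close>

lemma unbiased_estimatorI_nn:
  assumes Y: "Y \<in> borel_measurable M" and int: "(\<integral>\<^sup>+\<omega>. Y \<omega> \<partial>M) = ennreal (l * \<theta>)"
    and l: "0 < l" and \<theta>: "0 \<le> \<theta>" and X: "\<And>\<omega>. \<omega> \<in> space M \<Longrightarrow> X \<omega> = 1 / l * enn2real (Y \<omega>)"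
  shows "unbiased_estimator M X \<theta>"
proof -
  have "AE \<omega> in M. Y \<omega> \<noteq> \<infinity>" by (rule nn_integral_PInf_AE[OF Y]) (simp add: int)
  then have e: "(\<integral>\<^sup>+\<omega>. ennreal (enn2real (Y \<omega>)) \<partial>M) = ennreal (l * \<theta>)"
    unfolding int[symmetric] by (intro nn_integral_cong_AE) (auto elim!: eventually_mono simp: less_top)
  have i: "integrable M (\<lambda>\<omega>. enn2real (Y \<omega>))"
    by (rule integrableI_nn_integral_finite[OF _ _ e]) (use Y in auto)
  have "(\<integral>\<omega>. enn2real (Y \<omega>) \<partial>M) = l * \<theta>"
    using Y e l \<theta> by (subst integral_eq_nn_integral) auto
  then have v: "(\<integral>\<omega>. 1 / l * enn2real (Y \<omega>) \<partial>M) = \<theta>" using l by simp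
  have "integrable M (\<lambda>\<omega>. 1 / l * enn2real (Y \<omega>))" using i by simp
  then have "integrable M X" by (rule Bochner_Integration.integrable_cong[OF refl X, THEN iffD2, rotated])
  moreover have "(\<integral>\<omega>. X \<omega> \<partial>M) = \<theta>" unfolding v[symmetric] by (rule Bochner_Integration.integral_cong[OF refl X])
  ultimately show ?thesis by (simp add: unbiased_estimator_def)
qed

context crm_ball
begin

lemma set_integral_weighted_eq:
  assumes lf: "\<psi> \<in> lf_measures" and E: "E \<in> sets borel" and h: "h \<in> borel_measurable borel" "\<And>x. 0 \<le> h x"
  shows "(LINT x:E|weighted_component p \<psi> i. h x) =
    enn2real (\<integral>\<^sup>+x. ennreal (h x) * indicator E x \<partial>weighted_component p \<psi> i)"
proof -
  have s: "sets (weighted_component p \<psi> i) = sets borel" by (simp add: weighted_component_def component_def)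
  have "(\<lambda>x. indicator E x *\<^sub>R h x) \<in> borel_measurable borel" using E h(1) by measurable
  then have "(\<lambda>x. indicator E x *\<^sub>R h x) \<in> borel_measurable (weighted_component p \<psi> i)"
    by (simp add: measurable_cong_sets[OF s refl])
  then have "(LINT x:E|weighted_component p \<psi> i. h x) =
      enn2real (\<integral>\<^sup>+x. ennreal (indicator E x *\<^sub>R h x) \<partial>weighted_component p \<psi> i)"
    unfolding set_lebesgue_integral_def by (rule integral_eq_nn_integral) (simp add: h(2))
  also have "(\<integral>\<^sup>+x. ennreal (indicator E x *\<^sub>R h x) \<partial>weighted_component p \<psi> i) =
      (\<integral>\<^sup>+x. ennreal (h x) * indicator E x \<partial>weighted_component p \<psi> i)"
    by (rule nn_integral_cong) (auto split: split_indicator)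
  finally show ?thesis .
qed

text \<open>
  The random measure enters twice, as the integrating measure and in the integrand.
\<close>

lemma measurable_weighted_integral:
  assumes A [measurable]: "A \<in> sets borel"
    and H [measurable]: "(\<lambda>z. H (fst z) (snd z)) \<in> borel_measurable (borel \<Otimes>\<^sub>M lf_algebra)"
  shows "(\<lambda>\<omega>. \<integral>\<^sup>+x. H x (\<Psi> \<omega>) * indicator A x \<partial>weighted_component p (\<Psi> \<omega>) 1 :: ennreal) \<in> borel_measurable M"
proof -
  have Hc [measurable (raw)]: "(\<lambda>x. H (f x) (L x)) \<in> borel_measurable N" if "f \<in> N \<rightarrow>\<^sub>M borel" "L \<in> N \<rightarrow>\<^sub>M lf_algebra"
    for f L and N :: "'z measure"
    using measurable_compose[OF measurable_Pair[OF that] H] by simp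
  have "(\<integral>\<^sup>+x. H x (\<Psi> \<omega>) * indicator A x \<partial>weighted_component p (\<Psi> \<omega>) 1) =
      (\<integral>\<^sup>+z. (H (fst z) (\<Psi> \<omega>) * indicator A (fst z)) * (indicator {1} (snd z) * ennreal (1 / p [z])) \<partial>\<Psi> \<omega>)"
    if "\<omega> \<in> space M" for \<omega>
  proof (rule nn_integral_weighted_component[OF \<Psi>_lf[OF that]])
    have c: "(\<lambda>_. \<Psi> \<omega>) \<in> borel \<rightarrow>\<^sub>M lf_algebra" by (rule measurable_const) (simp add: \<Psi>_lf that)
    have "(\<lambda>x. H x (\<Psi> \<omega>)) \<in> borel_measurable borel" by (rule Hc[OF _ c]) simp
    then show "(\<lambda>x. H x (\<Psi> \<omega>) * indicator A x) \<in> borel_measurable borel" by measurable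
  qed
  moreover have "(\<lambda>\<omega>. \<integral>\<^sup>+z. (H (fst z) (\<Psi> \<omega>) * indicator A (fst z)) * (indicator {1} (snd z) * ennreal (1 / p [z])) \<partial>\<Psi> \<omega>)
      \<in> borel_measurable M"
  proof (rule measurable_nn_integral_lf[OF _ \<Psi>])
    have [measurable]: "(\<lambda>x. H (fst (snd x)) (\<Psi> (fst x))) \<in> borel_measurable (M \<Otimes>\<^sub>M marked_space)"
      by (rule Hc) measurable
    show "(\<lambda>(\<omega>, z). (H (fst z) (\<Psi> \<omega>) * indicator A (fst z)) * (indicator {1} (snd z) * ennreal (1 / p [z])))
        \<in> borel_measurable (M \<Otimes>\<^sub>M marked_space)"
      unfolding case_prod_beta' by measurable
  qed
  ultimately show ?thesis by (subst measurable_cong) auto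
qed

lemma nn_integral_exp_minus_mass:
  assumes "prob_space N" and L: "L \<in> N \<rightarrow>\<^sub>M lf_algebra"
  shows "(\<integral>\<^sup>+x. ennreal (exp (- mass a (L x))) \<partial>N) = ennreal (laplace N L (wt a))"
proof -
  interpret N: prob_space N by fact
  have [measurable]: "(\<lambda>x. mass a (L x)) \<in> borel_measurable N" by (rule measurable_mass[OF _ L]) simp
  have "integrable N (\<lambda>x. exp (- mass a (L x)))"
    by (rule N.integrable_const_bound[of _ 1]) (auto simp: mass_nonneg)
  then have "(\<integral>\<^sup>+x. ennreal (exp (- mass a (L x))) \<partial>N) = ennreal (\<integral>x. exp (- mass a (L x)) \<partial>N)"
    by (rule nn_integral_eq_integral) simp
  also have "(\<integral>x. exp (- mass a (L x)) \<partial>N) = laplace N L (wt a)"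
    using measurable_space[OF L] by (intro laplace_eq_mass[symmetric]) simp
  finally show ?thesis .
qed

lemma L2_hat_unbiased:
  assumes m: "summable (\<lambda>k. moment2 k / fact k)"
    and E: "erosion W t \<in> sets borel" "emeasure lborel (erosion W t) = ennreal (measure lborel (erosion W t))"
    and pos: "0 < measure lborel (erosion W t)"
  shows "unbiased_estimator M (\<lambda>\<omega>. L2_hat p W t (\<Psi> \<omega>)) (laplace M \<Psi> (wt 0))"
proof (rule unbiased_estimatorI_nn[OF _ _ pos laplace_nonneg])
  let ?E = "erosion W t"
  let ?Y = "\<lambda>\<omega>. \<integral>\<^sup>+x. ennreal (exp (- mass x (\<Psi> \<omega>))) * indicator ?E x \<partial>lborel"
  note [measurable] = E(1)
  interpret P: pair_sigma_finite M "lborel :: 'a measure" by unfold_locales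
  have [measurable]: "(\<lambda>z. mass (snd z) (\<Psi> (fst z))) \<in> borel_measurable (M \<Otimes>\<^sub>M borel)" by (rule measurable_mass) measurable
  have f: "(\<lambda>(\<omega>, x). ennreal (exp (- mass x (\<Psi> \<omega>))) * indicator ?E x) \<in> borel_measurable (M \<Otimes>\<^sub>M lborel)"
  proof -
    have "(\<lambda>(\<omega>, x). ennreal (exp (- mass x (\<Psi> \<omega>))) * indicator ?E x) \<in> borel_measurable (M \<Otimes>\<^sub>M borel)"
      unfolding case_prod_beta' by measurable
    then show ?thesis by (simp add: measurable_cong_sets[OF sets_pair_measure_cong[OF refl sets_lborel] refl])
  qed
  show "?Y \<in> borel_measurable M" using lborel.borel_measurable_nn_integral[OF f] by simp
  have "(\<integral>\<^sup>+\<omega>. ?Y \<omega> \<partial>M) = (\<integral>\<^sup>+x. \<integral>\<^sup>+\<omega>. ennreal (exp (- mass x (\<Psi> \<omega>))) * indicator ?E x \<partial>M \<partial>lborel)"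
    using P.Fubini'[OF f] by simp
  also have "\<dots> = (\<integral>\<^sup>+x. ennreal (laplace M \<Psi> (wt 0)) * indicator ?E x \<partial>lborel)"
  proof (rule nn_integral_cong)
    fix x
    have [measurable]: "(\<lambda>\<omega>. mass x (\<Psi> \<omega>)) \<in> borel_measurable M" by (rule measurable_mass) measurable
    show "(\<integral>\<^sup>+\<omega>. ennreal (exp (- mass x (\<Psi> \<omega>))) * indicator ?E x \<partial>M) = ennreal (laplace M \<Psi> (wt 0)) * indicator ?E x"
      using nn_integral_exp_minus_mass[OF prob_space_axioms \<Psi>, of x] laplace_const[OF m, of x]
      by (simp add: nn_integral_multc)
  qed
  also have "\<dots> = ennreal (laplace M \<Psi> (wt 0)) * emeasure lborel ?E"
    by (rule nn_integral_cmult_indicator) simp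
  also have "\<dots> = ennreal (measure lborel ?E * laplace M \<Psi> (wt 0))"
    by (simp add: E(2) laplace_nonneg ennreal_mult' mult.commute)
  finally show "(\<integral>\<^sup>+\<omega>. ?Y \<omega> \<partial>M) = ennreal (measure lborel ?E * laplace M \<Psi> (wt 0))" .
  fix \<omega> assume "\<omega> \<in> space M"
  then have lf: "\<Psi> \<omega> \<in> lf_measures" by (rule \<Psi>_lf)
  have c: "(\<lambda>_. \<Psi> \<omega>) \<in> borel \<rightarrow>\<^sub>M lf_algebra" by (rule measurable_const) (simp add: lf)
  have [measurable]: "(\<lambda>x. mass x (\<Psi> \<omega>)) \<in> borel_measurable borel" by (rule measurable_mass[OF _ c]) simp
  have "(LINT x:?E|lborel. exp (- mass x (\<Psi> \<omega>))) = enn2real (\<integral>\<^sup>+x. ennreal (indicator ?E x *\<^sub>R exp (- mass x (\<Psi> \<omega>))) \<partial>lborel)"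
    unfolding set_lebesgue_integral_def by (rule integral_eq_nn_integral) simp_all
  also have "(\<integral>\<^sup>+x. ennreal (indicator ?E x *\<^sub>R exp (- mass x (\<Psi> \<omega>))) \<partial>lborel) = ?Y \<omega>"
    by (rule nn_integral_cong) (auto split: split_indicator)
  finally show "L2_hat p W t (\<Psi> \<omega>) = 1 / measure lborel ?E * enn2real (?Y \<omega>)"
    by (simp add: L2_hat_def mass_def)
qed

lemma K12_hat_unbiased:
  assumes E: "erosion W t \<in> sets borel" "emeasure lborel (erosion W t) = ennreal (measure lborel (erosion W t))"
    and pos: "0 < measure lborel (erosion W t)"
  shows "unbiased_estimator M (\<lambda>\<omega>. K12_hat p W t (\<Psi> \<omega>)) (K12 p t)"
  unfolding K12_eq_moment12
proof (rule unbiased_estimatorI_nn[OF _ _ pos moment12_nonneg])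
  let ?E = "erosion W t"
  let ?Y = "\<lambda>\<omega>. \<integral>\<^sup>+x. ennreal (mass x (\<Psi> \<omega>)) * indicator ?E x \<partial>weighted_component p (\<Psi> \<omega>) 1"
  note [measurable] = measurable_mass_pair
  show "?Y \<in> borel_measurable M" by (rule measurable_weighted_integral[OF E(1)]) measurable
  show "(\<integral>\<^sup>+\<omega>. ?Y \<omega> \<partial>M) = ennreal (measure lborel ?E * moment12 1)"
    using expectation_weighted_mass_power[OF E(1), of 1] E(2) by (simp add: moment12_nonneg ennreal_mult' mult.commute)
  fix \<omega> assume "\<omega> \<in> space M"
  then have lf: "\<Psi> \<omega> \<in> lf_measures" by (rule \<Psi>_lf)
  have c: "(\<lambda>_. \<Psi> \<omega>) \<in> borel \<rightarrow>\<^sub>M lf_algebra" by (rule measurable_const) (simp add: lf)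
  have "(\<lambda>x. mass x (\<Psi> \<omega>)) \<in> borel_measurable borel" by (rule measurable_mass[OF _ c]) simp
  from set_integral_weighted_eq[OF lf E(1) this mass_nonneg, of 1]
  show "K12_hat p W t (\<Psi> \<omega>) = 1 / measure lborel ?E * enn2real (?Y \<omega>)"
    by (simp add: K12_hat_def mass_def)
qed

lemma L12_hat_unbiased:
  assumes Q: "palm_distributions M \<Psi> Q" and m: "summable (\<lambda>k. moment12 k / fact k)"
    and E: "erosion W t \<in> sets borel" "emeasure lborel (erosion W t) = ennreal (measure lborel (erosion W t))"
    and pos: "0 < measure lborel (erosion W t)"
  shows "unbiased_estimator M (\<lambda>\<omega>. L12_hat p W t (\<Psi> \<omega>)) (palm_laplace_at_origin Q p t)"
proof (rule unbiased_estimatorI_nn[OF _ _ pos])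
  let ?E = "erosion W t" and ?v = "palm_laplace_at_origin Q p t"
  let ?Y = "\<lambda>\<omega>. \<integral>\<^sup>+x. ennreal (exp (- mass x (\<Psi> \<omega>))) * indicator ?E x \<partial>weighted_component p (\<Psi> \<omega>) 1"
  note [measurable] = measurable_mass_pair
  note v = palm_laplace_const[OF Q m]
  have "AE a in lborel. a \<in> (UNIV :: 'a set) \<longrightarrow> 0 \<le> ?v" using v by eventually_elim (metis laplace_nonneg)
  from AE_lborel_ex[OF _ _ this] show v0: "0 \<le> ?v" by auto
  show "?Y \<in> borel_measurable M" by (rule measurable_weighted_integral[OF E(1)]) measurable
  have "(\<integral>\<^sup>+\<omega>. ?Y \<omega> \<partial>M) = (\<integral>\<^sup>+x. (\<integral>\<^sup>+\<psi>. ennreal (exp (- mass x \<psi>)) \<partial>Q (x, 1)) * indicator ?E x \<partial>lborel)"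
    by (rule expectation_weighted_eq_palm[OF Q E(1)]) measurable
  also have "\<dots> = (\<integral>\<^sup>+x. ennreal ?v * indicator ?E x \<partial>lborel)"
  proof (rule nn_integral_cong_AE)
    show "AE x in lborel. (\<integral>\<^sup>+\<psi>. ennreal (exp (- mass x \<psi>)) \<partial>Q (x, 1)) * indicator ?E x = ennreal ?v * indicator ?E x"
      using v
    proof eventually_elim
      case (elim x)
      have Qx: "prob_space (Q (x, 1))" "sets (Q (x, 1)) = sets lf_algebra" using palm_prob_space[OF Q] by blast+
      have "(\<lambda>\<psi>. \<psi>) \<in> Q (x, 1) \<rightarrow>\<^sub>M lf_algebra" by (rule measurable_ident_sets[OF Qx(2)])
      from nn_integral_exp_minus_mass[OF Qx(1) this, of x] elim show ?case by simp
    qed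
  qed
  also have "\<dots> = ennreal (measure lborel ?E * ?v)"
    using E v0 by (simp add: nn_integral_cmult_indicator ennreal_mult' mult.commute)
  finally show "(\<integral>\<^sup>+\<omega>. ?Y \<omega> \<partial>M) = ennreal (measure lborel ?E * ?v)" .
  fix \<omega> assume "\<omega> \<in> space M"
  then have lf: "\<Psi> \<omega> \<in> lf_measures" by (rule \<Psi>_lf)
  have c: "(\<lambda>_. \<Psi> \<omega>) \<in> borel \<rightarrow>\<^sub>M lf_algebra" by (rule measurable_const) (simp add: lf)
  have [measurable]: "(\<lambda>x. mass x (\<Psi> \<omega>)) \<in> borel_measurable borel" by (rule measurable_mass[OF _ c]) simp
  have "(\<lambda>x. exp (- mass x (\<Psi> \<omega>))) \<in> borel_measurable borel" by measurable
  from set_integral_weighted_eq[OF lf E(1) this, of 1]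
  show "L12_hat p W t (\<Psi> \<omega>) = 1 / measure lborel ?E * enn2real (?Y \<omega>)"
    by (simp add: L12_hat_def mass_def)
qed

end

theorem theorem10:
  fixes M :: "'w measure"
    and \<Psi> :: "'w \<Rightarrow> ('a::euclidean_space \<times> 2) measure"
    and p :: "('a \<times> 2) list \<Rightarrow> real"
    and Q :: "'a \<times> 2 \<Rightarrow> ('a \<times> 2) measure measure"
    and W :: "'a set"
    and t :: real
  assumes "bivariate_random_measure M \<Psi>"
    and "crm_stationary M \<Psi> p"
    and "palm_distributions M \<Psi> Q"
    and "compact W"
    and "0 \<le> t"
    and "0 < measure lborel (erosion W t)"
    and "summable (\<lambda>k. \<bar>laplace_moment_term M \<Psi> (ball_weight p t 0) (Suc k)\<bar>)"
    and "summable (\<lambda>k. \<bar>J12_term p t (Suc k)\<bar>)"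
  shows "unbiased_estimator M (\<lambda>\<omega>. L2_hat p W t (\<Psi> \<omega>)) (laplace M \<Psi> (ball_weight p t 0))
    \<and> unbiased_estimator M (\<lambda>\<omega>. K12_hat p W t (\<Psi> \<omega>)) (K12 p t)
    \<and> unbiased_estimator M (\<lambda>\<omega>. L12_hat p W t (\<Psi> \<omega>)) (palm_laplace_at_origin Q p t)"
proof -
  interpret crm_ball M \<Psi> p t by unfold_locales (fact assms)+
  have cl: "closed (erosion W t)" using assms(4) by (intro closed_erosion compact_imp_closed)
  then have E: "erosion W t \<in> sets borel" by simp
  have "bounded (erosion W t)"
    using compact_imp_bounded[OF assms(4)] by (rule bounded_subset) (auto simp: erosion_def)
  then have "emeasure lborel (erosion W t) \<noteq> \<infinity>" using emeasure_bounded_finite by (simp add: less_top)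
  then have fin: "emeasure lborel (erosion W t) = ennreal (measure lborel (erosion W t))"
    by (simp add: emeasure_eq_ennreal_measure)
  note m2 = summable_moment2[OF assms(7)]
  show ?thesis
    using L2_hat_unbiased[OF m2 E fin assms(6)] K12_hat_unbiased[OF E fin assms(6)]
      L12_hat_unbiased[OF assms(3) summable_moment12[OF m2 assms(8)] E fin assms(6)] by blast
qed

end
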